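(* Let $H$ be the Hilbert transformation extended to $L^2(\mathbb{R}^2,\mathrm{Cl}_2)$. Then $H$ has two nontrivial maximal invariant spaces ${}^2\!H^+$ and ${}^2\!H^-$, with $$L^2(\mathbb{R}^2,\mathrm{Cl}_2)={}^2\!H^+\oplus{}^2\!H^-,$$ and $$Hf=f\quad\forall f\in{}^2\!H^+;\qquad Hg=-g\quad\forall g\in{}^2\!H^-.$$
   Context: $\mathrm{Cl}_2$ is the Clifford algebra with generators $e_1,e_2$, $e_1^2=e_2^2=-1$, $e_1e_2=-e_2e_1$; function values are taken in its complexification, with $i$ commuting with $e_1,e_2$. $x\in\mathbb{R}^2$ is identified with $\underline{x}=x_1e_1+x_2e_2$. The Hilbert transformation is $Hf(\underline{x})=c_2\,\mathrm{p.v.}\!\int_{\mathbb{R}^2}\frac{\underline{x}-\underline{y}}{|\underline{x}-\underline{y}|^{3}}f(\underline{y})\,d\underline{y}$, with $c_2=1/(2\pi)$, so that $H^2=I$. For $\omega\in S^1$, $s_\omega=\cos\phi+\sin\phi\,e_1e_2$ with $\phi\in[0,\pi)$ is the element such that $s_\omega e_2s_\omega^{-1}=\omega$. Writing $L(w)=\{g(\underline{y})=s_{\underline{y}/|\underline{y}|}\alpha(\underline{y})w:\alpha\in L^2(\mathbb{R}^2)\}$ ($\alpha$ complex-valued) and $u=e_1+ie_2+1-ie_1e_2$, $v=e_1+ie_2-(1-ie_1e_2)$, set $\tilde{\tilde H}_1^-=L(u)$, $\tilde{\tilde H}_1^+=L(v)$, $\tilde{\tilde H}_2^-=L(ue_1)$,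 $\tilde{\tilde H}_2^+=L(ve_1)$. With $\mathfrak{F}f(\underline{\xi})=\int_{\mathbb{R}^2}e^{-i2\pi\langle\underline{x},\underline{\xi}\rangle}f(\underline{x})\,d\underline{x}$ (extended to $L^2$), put ${}^2\!H_j^\pm=\mathfrak{F}\tilde{\tilde H}_j^\pm$ for $j=1,2$ and ${}^2\!H^\pm={}^2\!H_1^\pm\oplus{}^2\!H_2^\pm$.
   Formalization: The spaces ²H_j^± are taken as inverse Fourier images of the L(w) spaces; with 𝔉 itself the signs of H on ²H⁺ and ²H⁻ are reversed. "Maximal invariant" means maximal among closed invariant subspaces on which H is a scalar, since the unrestricted reading fails. *)

theory Defs
  imports "HOL-Analysis.Analysis"
begin

section \<open>The complexified Clifford algebra\<close>

text \<open>
  \<open>Cl2 a b c d\<close> stands for \<open>a + b e\<^sub>1 + c e\<^sub>2 + d e\<^sub>1 e\<^sub>2\<close> with complex coefficients.  The complex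
  unit commutes with the generators.  The inner product is the real Euclidean one of the
  coefficients, so that \<open>norm x\<close> is the usual Hermitian norm of the coefficient vector.
\<close>

datatype cl2 = Cl2 (cl_0: complex) (cl_1: complex) (cl_2: complex) (cl_12: complex)

lemma cl2_eq_iff:
  "x = y \<longleftrightarrow> cl_0 x = cl_0 y \<and> cl_1 x = cl_1 y \<and> cl_2 x = cl_2 y \<and> cl_12 x = cl_12 y"
  by (cases x; cases y) auto

instantiation cl2 :: ring_1
begin

definition zero_cl2 :: cl2 where
  "0 = Cl2 0 0 0 0"

definition one_cl2 :: cl2 where
  "1 = Cl2 1 0 0 0"

definition plus_cl2 :: "cl2 \<Rightarrow> cl2 \<Rightarrow> cl2" where
  "x + y = Cl2 (cl_0 x + cl_0 y) (cl_1 x + cl_1 y) (cl_2 x + cl_2 y) (cl_12 x + cl_12 y)"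

definition uminus_cl2 :: "cl2 \<Rightarrow> cl2" where
  "- x = Cl2 (- cl_0 x) (- cl_1 x) (- cl_2 x) (- cl_12 x)"

definition minus_cl2 :: "cl2 \<Rightarrow> cl2 \<Rightarrow> cl2" where
  "x - y = Cl2 (cl_0 x - cl_0 y) (cl_1 x - cl_1 y) (cl_2 x - cl_2 y) (cl_12 x - cl_12 y)"

definition times_cl2 :: "cl2 \<Rightarrow> cl2 \<Rightarrow> cl2" where
  "x * y = Cl2
     (cl_0 x * cl_0 y - cl_1 x * cl_1 y - cl_2 x * cl_2 y - cl_12 x * cl_12 y)
     (cl_0 x * cl_1 y + cl_1 x * cl_0 y + cl_2 x * cl_12 y - cl_12 x * cl_2 y)
     (cl_0 x * cl_2 y + cl_2 x * cl_0 y - cl_1 x * cl_12 y + cl_12 x * cl_1 y)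
     (cl_0 x * cl_12 y + cl_12 x * cl_0 y + cl_1 x * cl_2 y - cl_2 x * cl_1 y)"

lemmas cl2_ring_defs = zero_cl2_def one_cl2_def plus_cl2_def uminus_cl2_def minus_cl2_def times_cl2_def

instance
  by standard (auto simp: cl2_eq_iff cl2_ring_defs algebra_simps)

end

definition of_complex :: "complex \<Rightarrow> cl2" where
  "of_complex z = Cl2 z 0 0 0"

definition e1 :: cl2 where
  "e1 = Cl2 0 1 0 0"

definition e2 :: cl2 where
  "e2 = Cl2 0 0 1 0"

lemma cl2_relations:
  "e1 * e1 = - 1" "e2 * e2 = - 1" "e1 * e2 = - (e2 * e1)"
  "of_complex z * x = x * of_complex z"
  by (auto simp: cl2_eq_iff cl2_ring_defs e1_def e2_def of_complex_def)

lemma cl2_expand: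
  "x = of_complex (cl_0 x) + of_complex (cl_1 x) * e1 + of_complex (cl_2 x) * e2
       + of_complex (cl_12 x) * (e1 * e2)"
  by (auto simp: cl2_eq_iff cl2_ring_defs e1_def e2_def of_complex_def)

lemma of_complex_hom:
  "of_complex (z + w) = of_complex z + of_complex w"
  "of_complex (z * w) = of_complex z * of_complex w"
  "of_complex 0 = 0" "of_complex 1 = 1"
  by (auto simp: cl2_eq_iff cl2_ring_defs of_complex_def)

instantiation cl2 :: real_algebra_1
begin

definition scaleR_cl2 :: "real \<Rightarrow> cl2 \<Rightarrow> cl2" where
  "scaleR r x = Cl2 (r *\<^sub>R cl_0 x) (r *\<^sub>R cl_1 x) (r *\<^sub>R cl_2 x) (r *\<^sub>R cl_12 x)"

instance
  by standard (auto simp: cl2_eq_iff cl2_ring_defs scaleR_cl2_def algebra_simps)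

end

instantiation cl2 :: real_inner
begin

definition inner_cl2 :: "cl2 \<Rightarrow> cl2 \<Rightarrow> real" where
  "inner x y = inner (cl_0 x) (cl_0 y) + inner (cl_1 x) (cl_1 y)
             + inner (cl_2 x) (cl_2 y) + inner (cl_12 x) (cl_12 y)"

definition norm_cl2 :: "cl2 \<Rightarrow> real" where
  "norm (x :: cl2) = sqrt (inner x x)"

definition sgn_cl2 :: "cl2 \<Rightarrow> cl2" where
  "sgn (x :: cl2) = x /\<^sub>R norm x"

definition dist_cl2 :: "cl2 \<Rightarrow> cl2 \<Rightarrow> real" where
  "dist (x :: cl2) y = norm (x - y)"

definition uniformity_cl2 :: "(cl2 \<times> cl2) filter" where
  "uniformity_cl2 = (INF e\<in>{0 <..}. principal {(x, y). dist x y < e})"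

definition open_cl2 :: "cl2 set \<Rightarrow> bool" where
  "open_cl2 U \<longleftrightarrow> (\<forall>x\<in>U. eventually (\<lambda>(x', y). x' = x \<longrightarrow> y \<in> U) uniformity)"

instance
proof
  fix x y z :: cl2 and r :: real
  show "inner x y = inner y x"
    by (simp add: inner_cl2_def inner_commute)
  show "inner (x + y) z = inner x z + inner y z"
    by (simp add: inner_cl2_def plus_cl2_def inner_add_left)
  show "inner (r *\<^sub>R x) y = r * inner x y"
    by (simp add: inner_cl2_def scaleR_cl2_def distrib_left)
  show "0 \<le> inner x x"
    by (simp add: inner_cl2_def)
  show "inner x x = 0 \<longleftrightarrow> x = 0"
    by (simp add: inner_cl2_def cl2_eq_iff zero_cl2_def add_nonneg_eq_0_iff)
qed (simp_all only: norm_cl2_def sgn_cl2_def dist_cl2_def uniformity_cl2_def open_cl2_def)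

end

instantiation cl2 :: euclidean_space
begin

definition Basis_cl2 :: "cl2 set" where
  "Basis = (\<lambda>b. Cl2 b 0 0 0) ` Basis \<union> (\<lambda>b. Cl2 0 b 0 0) ` Basis
         \<union> (\<lambda>b. Cl2 0 0 b 0) ` Basis \<union> (\<lambda>b. Cl2 0 0 0 b) ` Basis"

instance
proof
  show "(Basis :: cl2 set) \<noteq> {}" "finite (Basis :: cl2 set)"
    by (auto simp: Basis_cl2_def)
  show "inner u v = (if u = v then 1 else 0)" if "u \<in> Basis" "v \<in> Basis" for u v :: cl2
    using that unfolding Basis_cl2_def
    by (elim UnE imageE) (auto simp: inner_cl2_def inner_Basis nonzero_Basis)
  show "(\<forall>u\<in>Basis. inner x u = 0) \<longleftrightarrow> x = 0" for x :: cl2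
    by (simp add: Basis_cl2_def inner_cl2_def ball_Un cl2_eq_iff zero_cl2_def
        euclidean_all_zero_iff conj_assoc)
qed

end

lemma power2_norm_cl2:
  "(norm x)\<^sup>2 = (norm (cl_0 x))\<^sup>2 + (norm (cl_1 x))\<^sup>2 + (norm (cl_2 x))\<^sup>2 + (norm (cl_12 x))\<^sup>2"
  by (simp add: power2_norm_eq_inner inner_cl2_def)

section \<open>The Hilbert space of square integrable functions\<close>

definition square_integrable :: "(real^2 \<Rightarrow> 'b::euclidean_space) \<Rightarrow> bool" where
  "square_integrable f \<longleftrightarrow>
     f \<in> borel_measurable lborel \<and> integrable lborel (\<lambda>x. (norm (f x))\<^sup>2)"

lemma square_integrableD:
  "square_integrable f \<Longrightarrow> f \<in> borel_measurable borel"
  "square_integrable f \<Longrightarrow> integrable lborel (\<lambda>x. (norm (f x))\<^sup>2)"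
  by (auto simp: square_integrable_def)

lemma square_integrable_0: "square_integrable (\<lambda>_. 0)"
  by (simp add: square_integrable_def)

lemma square_integrable_bound:
  fixes f :: "real^2 \<Rightarrow> 'b::euclidean_space" and g :: "real^2 \<Rightarrow> 'c::euclidean_space"
  assumes "square_integrable f" "g \<in> borel_measurable borel" "\<And>x. norm (g x) \<le> c * norm (f x)"
  shows "square_integrable g"
proof -
  have "integrable lborel (\<lambda>x. (norm (g x))\<^sup>2)"
  proof (rule Bochner_Integration.integrable_bound)
    show "integrable lborel (\<lambda>x. c\<^sup>2 * (norm (f x))\<^sup>2)"
      using assms(1) by (simp add: square_integrable_def)
    show "(\<lambda>x. (norm (g x))\<^sup>2) \<in> borel_measurable lborel"
      using assms(2) by measurable
    show "AE x in lborel. norm ((norm (g x))\<^sup>2) \<le> norm (c\<^sup>2 * (norm (f x))\<^sup>2)"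
      using power_mono[OF assms(3) norm_ge_zero, of _ 2] by (simp add: power_mult_distrib)
  qed
  thus ?thesis
    using assms(2) by (simp add: square_integrable_def)
qed

lemma square_integrable_add:
  fixes f g :: "real^2 \<Rightarrow> 'b::euclidean_space"
  assumes "square_integrable f" "square_integrable g"
  shows "square_integrable (\<lambda>x. f x + g x)"
proof -
  note [measurable] = assms[THEN square_integrableD(1)]
  have *: "(norm (x + y))\<^sup>2 \<le> 2 * (norm x)\<^sup>2 + 2 * (norm y)\<^sup>2" for x y :: 'b
    using zero_le_power2[of "norm (x - y)"]
    by (simp add: power2_norm_eq_inner inner_add inner_diff inner_commute)
  have "integrable lborel (\<lambda>x. (norm (f x + g x))\<^sup>2)"
  proof (rule Bochner_Integration.integrable_bound)
    show "integrable lborel (\<lambda>x. 2 * (norm (f x))\<^sup>2 + 2 * (norm (g x))\<^sup>2)"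
      using assms by (simp add: square_integrable_def)
    show "(\<lambda>x. (norm (f x + g x))\<^sup>2) \<in> borel_measurable lborel"
      by measurable
    show "AE x in lborel. norm ((norm (f x + g x))\<^sup>2) \<le> norm (2 * (norm (f x))\<^sup>2 + 2 * (norm (g x))\<^sup>2)"
      using * by (auto intro: AE_I2)
  qed
  thus ?thesis
    by (simp add: square_integrable_def)
qed

text \<open>
  Square integrable functions are identified when they agree almost everywhere.
\<close>

quotient_type l2 = "real^2 \<Rightarrow> cl2" /
  partial: "\<lambda>f g. square_integrable f \<and> square_integrable g \<and> (AE x in lborel. f x = g x)"
  morphisms rep_l2 abs_l2
proof (rule part_equivpI)
  show "\<exists>f :: real^2 \<Rightarrow> cl2. square_integrable f \<and> square_integrable f \<and> (AE x in lborel. f x = f x)"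
    using square_integrable_0 by auto
qed (auto simp: symp_def transp_def elim: eventually_elim2)

lemma square_integrable_cmult:
  fixes f :: "real^2 \<Rightarrow> cl2"
  assumes "square_integrable f"
  shows "square_integrable (\<lambda>x. of_complex c * f x)"
proof (rule square_integrable_bound[OF assms])
  have lin: "bounded_linear (\<lambda>x. of_complex c * x)"
    by (intro linear_conv_bounded_linear[THEN iffD1] linearI)
       (auto simp: algebra_simps)
  show "(\<lambda>x. of_complex c * f x) \<in> borel_measurable borel"
    using square_integrableD(1)[OF assms]
      borel_measurable_continuous_onI[OF linear_continuous_on[OF lin]]
    by (rule measurable_compose)
  show "norm (of_complex c * f x) \<le> norm c * norm (f x)" for x
  proof (rule power2_le_imp_le)
    show "(norm (of_complex c * f x))\<^sup>2 \<le> (norm c * norm (f x))\<^sup>2"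
      by (simp add: power2_norm_cl2 of_complex_def times_cl2_def norm_mult power_mult_distrib
          distrib_left)
  qed simp
qed

lemma square_integrable_scaleR:
  fixes f :: "real^2 \<Rightarrow> cl2"
  assumes "square_integrable f"
  shows "square_integrable (\<lambda>x. r *\<^sub>R f x)"
proof (rule square_integrable_bound[OF assms, where c = "\<bar>r\<bar>"])
  show "(\<lambda>x. r *\<^sub>R f x) \<in> borel_measurable borel"
    using square_integrableD(1)[OF assms] by measurable
qed simp

lemma integrable_inner_square_integrable:
  fixes f g :: "real^2 \<Rightarrow> cl2"
  assumes "square_integrable f" "square_integrable g"
  shows "integrable lborel (\<lambda>x. inner (f x) (g x))"
proof (rule Bochner_Integration.integrable_bound)
  note [measurable] = assms[THEN square_integrableD(1)]
  show "integrable lborel (\<lambda>x. (norm (f x))\<^sup>2 + (norm (g x))\<^sup>2)"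
    using assms by (simp add: square_integrable_def)
  show "(\<lambda>x. inner (f x) (g x)) \<in> borel_measurable lborel"
    by measurable
  have "\<bar>inner x y\<bar> \<le> (norm x)\<^sup>2 + (norm y)\<^sup>2" for x y :: cl2
  proof -
    have "2 * \<bar>inner x y\<bar> \<le> (norm x)\<^sup>2 + (norm y)\<^sup>2"
      using Cauchy_Schwarz_ineq2[of x y] sum_squares_bound[of "norm x" "norm y"] by linarith
    thus ?thesis
      by linarith
  qed
  thus "AE x in lborel. norm (inner (f x) (g x)) \<le> norm ((norm (f x))\<^sup>2 + (norm (g x))\<^sup>2)"
    by (simp add: AE_I2)
qed

lemma inner_integral_cong_AE:
  fixes f f' g g' :: "real^2 \<Rightarrow> cl2"
  assumes "square_integrable f \<and> square_integrable f' \<and> (AE x in lborel. f x = f' x)"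
    and "square_integrable g \<and> square_integrable g' \<and> (AE x in lborel. g x = g' x)"
  shows "(\<integral>x. inner (f x) (g x) \<partial>lborel) = (\<integral>x. inner (f' x) (g' x) \<partial>lborel)"
proof (rule integral_cong_AE)
  have [measurable]: "f \<in> borel_measurable borel" "f' \<in> borel_measurable borel"
    "g \<in> borel_measurable borel" "g' \<in> borel_measurable borel"
    using assms by (simp_all add: square_integrable_def)
  show "(\<lambda>x. inner (f x) (g x)) \<in> borel_measurable lborel"
    by measurable
  show "(\<lambda>x. inner (f' x) (g' x)) \<in> borel_measurable lborel"
    by measurable
  show "AE x in lborel. inner (f x) (g x) = inner (f' x) (g' x)"
    using assms[THEN conjunct2, THEN conjunct2] by eventually_elim simp
qed

lemma integral_inner_eq_0_iff:
  fixes f :: "real^2 \<Rightarrow> cl2"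
  assumes "square_integrable f"
  shows "(\<integral>x. inner (f x) (f x) \<partial>lborel) = 0 \<longleftrightarrow> (AE x in lborel. f x = 0)"
proof -
  have "(\<integral>x. inner (f x) (f x) \<partial>lborel) = 0 \<longleftrightarrow> (AE x in lborel. inner (f x) (f x) = 0)"
    by (intro integral_nonneg_eq_0_iff_AE integrable_inner_square_integrable assms AE_I2 inner_ge_zero)
  thus ?thesis
    by simp
qed

instantiation l2 :: real_vector
begin

lift_definition zero_l2 :: l2 is "\<lambda>_. 0"
  by (simp add: square_integrable_0)

lift_definition plus_l2 :: "l2 \<Rightarrow> l2 \<Rightarrow> l2" is "\<lambda>f g x. f x + g x"
  by (auto intro: square_integrable_add elim: eventually_elim2)

lift_definition scaleR_l2 :: "real \<Rightarrow> l2 \<Rightarrow> l2" is "\<lambda>r f x. r *\<^sub>R f x"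
  by (auto intro: square_integrable_scaleR elim: eventually_elim2)

lift_definition uminus_l2 :: "l2 \<Rightarrow> l2" is "\<lambda>f x. - f x"
  using square_integrable_scaleR[where r = "-1"] by (auto elim: eventually_elim2)

definition minus_l2 :: "l2 \<Rightarrow> l2 \<Rightarrow> l2" where
  "f - g = f + (- g :: l2)"

instance
proof
  fix f g h :: l2 and r s :: real
  show "f + g + h = f + (g + h)"
    by transfer (simp add: square_integrable_add add.assoc)
  show "f + g = g + f"
    by transfer (simp add: square_integrable_add add.commute)
  show "0 + f = f"
    by transfer simp
  show "- f + f = 0"
    by transfer (simp add: square_integrable_0)
  show "f - g = f + - g"
    by (simp add: minus_l2_def)
  show "r *\<^sub>R (f + g) = r *\<^sub>R f + r *\<^sub>R g"
    by transfer (simp add: square_integrable_add square_integrable_scaleR scaleR_add_right)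
  show "(r + s) *\<^sub>R f = r *\<^sub>R f + s *\<^sub>R f"
    by transfer (simp add: square_integrable_add square_integrable_scaleR scaleR_add_left)
  show "r *\<^sub>R s *\<^sub>R f = (r * s) *\<^sub>R f"
    by transfer (simp add: square_integrable_scaleR)
  show "1 *\<^sub>R f = f"
    by transfer simp
qed

end

instantiation l2 :: real_inner
begin

lift_definition inner_l2 :: "l2 \<Rightarrow> l2 \<Rightarrow> real" is "\<lambda>f g. \<integral>x. inner (f x) (g x) \<partial>lborel"
  by (rule inner_integral_cong_AE)

definition norm_l2 :: "l2 \<Rightarrow> real" where
  "norm (f :: l2) = sqrt (inner f f)"

definition sgn_l2 :: "l2 \<Rightarrow> l2" where
  "sgn (f :: l2) = f /\<^sub>R norm f"

definition dist_l2 :: "l2 \<Rightarrow> l2 \<Rightarrow> real" where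
  "dist (f :: l2) g = norm (f - g)"

definition uniformity_l2 :: "(l2 \<times> l2) filter" where
  "uniformity_l2 = (INF e\<in>{0 <..}. principal {(x, y). dist x y < e})"

definition open_l2 :: "l2 set \<Rightarrow> bool" where
  "open_l2 U \<longleftrightarrow> (\<forall>x\<in>U. eventually (\<lambda>(x', y). x' = x \<longrightarrow> y \<in> U) uniformity)"

instance
proof
  fix f g h :: l2 and r :: real
  show "inner f g = inner g f"
    by transfer (simp add: inner_commute)
  show "inner (f + g) h = inner f h + inner g h"
    by transfer (simp add: inner_add_left integrable_inner_square_integrable)
  show "inner (r *\<^sub>R f) g = r * inner f g"
    by transfer simp
  show "0 \<le> inner f f"
    by transfer simp
  show "inner f f = 0 \<longleftrightarrow> f = 0"
    by transfer (simp add: integral_inner_eq_0_iff square_integrable_0)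
qed (simp_all only: norm_l2_def sgn_l2_def dist_l2_def uniformity_l2_def open_l2_def)

end

lift_definition scaleC :: "complex \<Rightarrow> l2 \<Rightarrow> l2" (infixr \<open>*\<^sub>C\<close> 75) is
  "\<lambda>c f x. of_complex c * f x"
  by (auto intro: square_integrable_cmult elim: eventually_elim2)

definition complex_subspace :: "l2 set \<Rightarrow> bool" where
  "complex_subspace V \<longleftrightarrow> 0 \<in> V \<and> (\<forall>f\<in>V. \<forall>g\<in>V. f + g \<in> V) \<and> (\<forall>c. \<forall>f\<in>V. c *\<^sub>C f \<in> V)"

definition internal_direct_sum :: "l2 set \<Rightarrow> l2 set \<Rightarrow> l2 set \<Rightarrow> bool" where
  "internal_direct_sum W U V \<longleftrightarrow> W = {f + g | f g. f \<in> U \<and> g \<in> V} \<and> U \<inter> V = {0}"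

text \<open>
  Extension by continuity of a densely defined operator, given by its graph: the value at \<open>f\<close> is the
  unique limit of the values along sequences in the original domain that converge to \<open>f\<close>.
\<close>

definition l2_extension :: "(l2 \<times> l2) set \<Rightarrow> l2 \<Rightarrow> l2" where
  "l2_extension T f = (THE g. (f, g) \<in> closure T)"

section \<open>The Fourier and the Hilbert transformation\<close>

definition fourier_integral :: "(real^2 \<Rightarrow> cl2) \<Rightarrow> real^2 \<Rightarrow> cl2" where
  "fourier_integral f \<xi> = (\<integral>x. of_complex (exp (- (\<i> * 2 * pi * (x \<bullet> \<xi>)))) * f x \<partial>lborel)"

text \<open>The graph of the integral on \<open>L\<^sup>1 \<inter> L\<^sup>2\<close>, extended to \<open>L\<^sup>2\<close>.\<close>

definition fourier :: "l2 \<Rightarrow> l2" where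
  "fourier = l2_extension {(abs_l2 f, abs_l2 (fourier_integral f)) | f.
     integrable lborel f \<and> square_integrable f \<and> square_integrable (fourier_integral f)}"

definition vec_cl :: "real^2 \<Rightarrow> cl2" where
  "vec_cl x = (x $ 1) *\<^sub>R e1 + (x $ 2) *\<^sub>R e2"

text \<open>
  The integral over \<open>\<bar>x - y\<bar> > \<epsilon>\<close>; the integrand is absolutely integrable there for every square
  integrable \<open>f\<close>.
\<close>

definition truncated_hilbert :: "real \<Rightarrow> (real^2 \<Rightarrow> cl2) \<Rightarrow> real^2 \<Rightarrow> cl2" where
  "truncated_hilbert \<epsilon> f x =
     (1 / (2 * pi)) *\<^sub>R (LINT y:{y. \<epsilon> < norm (x - y)}|lborel. (vec_cl (x - y) /\<^sub>R norm (x - y) ^ 3) * f y)"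

text \<open>
  The principal value operator, defined where the principal value exists almost everywhere and is
  again square integrable, extended to \<open>L\<^sup>2\<close>.
\<close>

definition hilbert :: "l2 \<Rightarrow> l2" where
  "hilbert = l2_extension {(abs_l2 f, abs_l2 g) | f g. square_integrable f \<and> square_integrable g \<and>
     (AE x in lborel. ((\<lambda>\<epsilon>. truncated_hilbert \<epsilon> f x) \<longlongrightarrow> g x) (at_right 0))}"

section \<open>The spaces\<close>

definition cl_inv :: "cl2 \<Rightarrow> cl2" where
  "cl_inv s = (THE t. s * t = 1 \<and> t * s = 1)"

definition rotor :: "real^2 \<Rightarrow> cl2" where
  "rotor \<omega> = (THE s. (\<exists>\<phi>\<in>{0..<pi}. s = of_real (cos \<phi>) + of_real (sin \<phi>) * (e1 * e2)) \<and>
                     s * e2 * cl_inv s = vec_cl \<omega>)"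

definition L_space :: "cl2 \<Rightarrow> l2 set" where
  "L_space w = {abs_l2 (\<lambda>y. rotor (y /\<^sub>R norm y) * of_complex (\<alpha> y) * w) | \<alpha>. square_integrable \<alpha>}"

definition cl_u :: cl2 where
  "cl_u = e1 + of_complex \<i> * e2 + 1 - of_complex \<i> * e1 * e2"

definition cl_v :: cl2 where
  "cl_v = e1 + of_complex \<i> * e2 - (1 - of_complex \<i> * e1 * e2)"

text \<open>
  The spaces \<open>L_space w\<close> live on the frequency side, where \<open>hilbert\<close> is the left multiplication by
  \<open>- \<i> \<xi> / \<bar>\<xi>\<bar>\<close>; this is \<open>- 1\<close> on \<open>L_space cl_u\<close> and \<open>1\<close> on \<open>L_space cl_v\<close>.  The corresponding
  spaces of functions are their images under the inverse Fourier transformation, i.e. preimages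
  under \<open>fourier\<close>.  With the kernels chosen above, the images under \<open>fourier\<close> itself are the same
  spaces with the labels plus and minus interchanged: \<open>fourier\<close> applied twice is the reflection
  \<open>\<xi> \<mapsto> - \<xi>\<close>, and \<open>rotor (- \<omega>) * cl_u\<close> is a complex multiple of \<open>rotor \<omega> * cl_v\<close>.
\<close>

definition H1_minus :: "l2 set" where "H1_minus = fourier -` L_space cl_u"
definition H1_plus :: "l2 set" where "H1_plus = fourier -` L_space cl_v"
definition H2_minus :: "l2 set" where "H2_minus = fourier -` L_space (cl_u * e1)"
definition H2_plus :: "l2 set" where "H2_plus = fourier -` L_space (cl_v * e1)"

text \<open>The sums below are direct; this is part of the claim.\<close>

definition H_minus :: "l2 set" where "H_minus = {f + g | f g. f \<in> H1_minus \<and> g \<in> H2_minus}"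
definition H_plus :: "l2 set" where "H_plus = {f + g | f g. f \<in> H1_plus \<and> g \<in> H2_plus}"

section \<open>Maximal invariant spaces\<close>

definition invariant_space :: "(l2 \<Rightarrow> l2) \<Rightarrow> l2 set \<Rightarrow> bool" where
  "invariant_space T V \<longleftrightarrow> complex_subspace V \<and> closed V \<and> T ` V \<subseteq> V"

definition acts_as_scalar :: "(l2 \<Rightarrow> l2) \<Rightarrow> l2 set \<Rightarrow> bool" where
  "acts_as_scalar T V \<longleftrightarrow> (\<exists>c. \<forall>f\<in>V. T f = c *\<^sub>C f)"

text \<open>
  Maximality is meant among the invariant spaces on which the operator is a multiple of the
  identity.  It cannot be meant among all proper invariant spaces: for an involution, the sum of one
  eigenspace and any closed subspace of the other one is invariant again.
\<close>

definition maximal_invariant_space :: "(l2 \<Rightarrow> l2) \<Rightarrow> l2 set \<Rightarrow> bool" where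
  "maximal_invariant_space T V \<longleftrightarrow>
     invariant_space T V \<and> acts_as_scalar T V \<and>
     (\<forall>W. invariant_space T W \<and> acts_as_scalar T W \<and> V \<subseteq> W \<longrightarrow> W = V)"

definition nontrivial_space :: "l2 set \<Rightarrow> bool" where
  "nontrivial_space V \<longleftrightarrow> V \<noteq> {0} \<and> V \<noteq> UNIV"

end

(*
  The Hilbert transformation is the Fourier multiplier with symbol -i xi/|xi|.  Writing a unit vector as
  xi/|xi| = s e2 s^{-1}, this symbol maps s w to s (-i e2 w), so that it is -1 on L(u), L(u e1) and 1 on
  L(v), L(v e1), because u, u e1 and v, v e1 span the two eigenspaces of the left multiplication by e2.
  As the Fourier transformation is unitary, the preimages are the two eigenspaces of an involution.

  The symbol comes from the superposition x/(2 pi |x|^3) = int_0^oo 2 t^2 x exp(-pi t^2 |x|^2) dt of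
  functions with explicit Fourier transforms.  Restricting t to [eps, 1/eps] gives an integrable kernel
  whose transform -i xi int_{-1/eps}^{-eps} 2 exp(-pi u^2 |xi|^2) du converges boundedly to the symbol.  It
  differs from the truncation of the kernel to |x| > eps by the part t < eps, which is O(eps) in L^2, and
  by a dilated integrable odd kernel, which tends to 0 as an approximate identity of mass 0.  So every almost
  everywhere principal value coincides with the multiplier.  For indicator functions of finite unions of
  boxes the truncations are eventually constant off the boundary, hence the principal value is densely
  defined and its extension is the multiplier.
*)
theory Submission
  imports Defs "HOL-Probability.Probability"
begin

lemma norm_of_complex_mult: "norm (of_complex c * x) = cmod c * norm x"
proof (rule power2_eq_imp_eq)
  show "(norm (of_complex c * x))\<^sup>2 = (cmod c * norm x)\<^sup>2"
    by (simp add: power2_norm_cl2 of_complex_def times_cl2_def norm_mult power_mult_distrib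
        distrib_left)
qed auto

lemma norm_e_mult: "norm (e1 * x) = norm x" "norm (e2 * x) = norm x"
  by (rule power2_eq_imp_eq; simp add: power2_norm_cl2 e1_def e2_def times_cl2_def)+

lemma norm_cl2_components:
  "cmod (cl_0 x) \<le> norm x" "cmod (cl_1 x) \<le> norm x"
  "cmod (cl_2 x) \<le> norm x" "cmod (cl_12 x) \<le> norm x"
  by (rule power2_le_imp_le; simp add: power2_norm_cl2)+

lemma norm_cl2_mult_le: "norm (x * y :: cl2) \<le> 4 * norm x * norm y"
proof -
  have "x * y = of_complex (cl_0 x) * y + of_complex (cl_1 x) * (e1 * y) + of_complex (cl_2 x) * (e2 * y)
       + of_complex (cl_12 x) * (e1 * (e2 * y))"
    by (subst cl2_expand[of x]) (simp add: algebra_simps)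
  also have "norm \<dots> \<le> cmod (cl_0 x) * norm y + cmod (cl_1 x) * norm y + cmod (cl_2 x) * norm y
      + cmod (cl_12 x) * norm y"
    by (intro norm_triangle_mono) (simp_all add: norm_of_complex_mult norm_e_mult)
  also have "\<dots> \<le> norm x * norm y + norm x * norm y + norm x * norm y + norm x * norm y"
    by (intro add_mono mult_right_mono norm_cl2_components norm_ge_zero)
  finally show ?thesis by simp
qed

lemma bounded_bilinear_cl2_mult: "bounded_bilinear ((*) :: cl2 \<Rightarrow> cl2 \<Rightarrow> cl2)"
proof
  show "\<exists>K. \<forall>a b :: cl2. norm (a * b) \<le> norm a * norm b * K"
    by (rule exI[of _ 4]) (use norm_cl2_mult_le in \<open>auto simp: mult_ac\<close>)
qed (auto simp: algebra_simps)

lemmas bounded_linear_cl2_mult_right = bounded_bilinear.bounded_linear_right[OF bounded_bilinear_cl2_mult]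
lemmas bounded_linear_cl2_mult_left = bounded_bilinear.bounded_linear_left[OF bounded_bilinear_cl2_mult]
lemmas continuous_on_cl2_mult [continuous_intros] =
  bounded_bilinear.continuous_on[OF bounded_bilinear_cl2_mult]
lemmas tendsto_cl2_mult [tendsto_intros] = bounded_bilinear.tendsto[OF bounded_bilinear_cl2_mult]

lemma borel_measurable_cl2_mult [measurable (raw)]:
  fixes f g :: "'a \<Rightarrow> cl2"
  assumes "f \<in> borel_measurable M" "g \<in> borel_measurable M"
  shows "(\<lambda>x. f x * g x) \<in> borel_measurable M"
  using assms by (rule borel_measurable_continuous_Pair)
    (auto intro!: continuous_intros simp: split_beta)

lemma of_complex_simps [simp]:
  "of_complex 0 = 0" "of_complex 1 = 1"
  "of_complex (of_real r) = of_real r"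
  by (simp_all add: of_complex_hom)
     (simp add: of_complex_def of_real_def scaleR_cl2_def one_cl2_def complex_eq_iff)

lemma of_complex_diff: "of_complex (z - w) = of_complex z - of_complex w"
  and of_complex_minus: "of_complex (- z) = - of_complex z"
  and of_complex_scaleR: "of_complex (r *\<^sub>R z) = r *\<^sub>R of_complex z"
  by (auto simp: cl2_eq_iff cl2_ring_defs of_complex_def scaleR_cl2_def)

lemma norm_of_complex [simp]: "norm (of_complex c) = cmod c"
  by (rule power2_eq_imp_eq) (simp_all add: power2_norm_cl2 of_complex_def)

lemma norm_one_cl2 [simp]: "norm (1 :: cl2) = 1"
  using norm_of_complex[of 1] by simp

lemma bounded_linear_of_complex: "bounded_linear of_complex"
  by (rule bounded_linear_intro[where K = 1])
     (simp_all add: of_complex_hom of_complex_scaleR)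

declare bounded_linear.continuous_on[OF bounded_linear_of_complex, continuous_intros]
declare bounded_linear.tendsto[OF bounded_linear_of_complex, tendsto_intros]

lemma borel_measurable_of_complex [measurable (raw)]:
  "f \<in> borel_measurable M \<Longrightarrow> (\<lambda>x. of_complex (f x)) \<in> borel_measurable M"
  by (rule measurable_compose[OF _ borel_measurable_continuous_onI, where g = of_complex])
     (auto intro!: continuous_intros)

lemma inner_of_complex_mult: "inner (of_complex c * x) y = inner x (of_complex (cnj c) * y)"
  by (simp add: inner_cl2_def of_complex_def times_cl2_def inner_complex_def algebra_simps)

lemma mult_of_complex: "x * (of_complex c * y) = of_complex c * (x * y)"
  by (metis cl2_relations(4) mult.assoc)

lemma norm_vec_cl: "norm (vec_cl x) = norm x"
proof (rule power2_eq_imp_eq)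
  show "(norm (vec_cl x))\<^sup>2 = (norm x)\<^sup>2"
    by (simp add: power2_norm_cl2 vec_cl_def e1_def e2_def plus_cl2_def scaleR_cl2_def
      norm_vec_def L2_set_def UNIV_2 sum_nonneg)
qed auto

lemma bounded_linear_vec_cl: "bounded_linear vec_cl"
  by (rule bounded_linear_intro[where K = 1])
     (simp_all add: norm_vec_cl, simp_all add: vec_cl_def algebra_simps)

declare bounded_linear.continuous_on[OF bounded_linear_vec_cl, continuous_intros]

lemma borel_measurable_vec_cl [measurable (raw)]:
  "f \<in> borel_measurable M \<Longrightarrow> (\<lambda>x. vec_cl (f x)) \<in> borel_measurable M"
  by (rule measurable_compose[OF _ borel_measurable_continuous_onI, where g = vec_cl])
     (auto intro!: continuous_intros)

lemma vec_cl_linear: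
  "vec_cl (x + y) = vec_cl x + vec_cl y" "vec_cl (x - y) = vec_cl x - vec_cl y"
  "vec_cl (- x) = - vec_cl x" "vec_cl (r *\<^sub>R x) = r *\<^sub>R vec_cl x"
  by (simp_all add: vec_cl_def algebra_simps)

lemma nn_integral_affine:
  fixes f :: "'a::euclidean_space \<Rightarrow> ennreal"
  assumes c: "c \<noteq> 0" and [measurable]: "f \<in> borel_measurable borel"
  shows "(\<integral>\<^sup>+x. f x \<partial>lborel) = ennreal (\<bar>c\<bar> ^ DIM('a)) * (\<integral>\<^sup>+x. f (t + c *\<^sub>R x) \<partial>lborel)"
  by (subst lborel_affine[OF c, of t])
     (simp add: nn_integral_density nn_integral_distr nn_integral_cmult)

lemma integrable_affine:
  fixes f :: "'a::euclidean_space \<Rightarrow> 'b::{banach,second_countable_topology}"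
  assumes c: "c \<noteq> 0" and f: "integrable lborel f"
  shows "integrable lborel (\<lambda>x. f (t + c *\<^sub>R x))"
proof -
  have [measurable]: "f \<in> borel_measurable borel"
    using f by auto
  have "(\<integral>\<^sup>+x. norm (f x) \<partial>lborel) < \<infinity>"
    using f by (simp add: integrable_iff_bounded)
  then show ?thesis
    using c by (subst (asm) nn_integral_affine[OF c, of _ t])
      (auto simp: integrable_iff_bounded ennreal_mult_less_top)
qed

lemma integral_affine:
  fixes f :: "'a::euclidean_space \<Rightarrow> 'b::{banach,second_countable_topology}"
  assumes c: "c \<noteq> 0"
  shows "(\<integral>x. f (t + c *\<^sub>R x) \<partial>lborel) = (\<integral>x. f x \<partial>lborel) /\<^sub>R \<bar>c\<bar> ^ DIM('a)"
proof (cases "integrable lborel f")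
  case True
  then have [measurable]: "f \<in> borel_measurable borel"
    by auto
  have "(\<integral>x. f x \<partial>lborel) = \<bar>c\<bar> ^ DIM('a) *\<^sub>R (\<integral>x. f (t + c *\<^sub>R x) \<partial>lborel)"
    using integrable_affine[OF c True, of t]
    by (subst lborel_affine[OF c, of t]) (simp add: integral_density integral_distr)
  then show ?thesis using c by simp
next
  case False
  moreover have "\<not> integrable lborel (\<lambda>x. f (t + c *\<^sub>R x))"
    using integrable_affine[of "1/c" "\<lambda>x. f (t + c *\<^sub>R x)" "- (1 / c) *\<^sub>R t"] False c
    by (auto simp: scaleR_add_right scaleR_diff_right)
  ultimately show ?thesis
    by (simp add: not_integrable_integral_eq)
qed

lemma integral_reflect:
  fixes f :: "'a::euclidean_space \<Rightarrow> 'b::{banach,second_countable_topology}"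
  shows "(\<integral>x. f (t - x) \<partial>lborel) = (\<integral>x. f x \<partial>lborel)"
  using integral_affine[of "-1" f t] by simp

lemma integral_odd:
  fixes f :: "'a::euclidean_space \<Rightarrow> 'b::{banach,second_countable_topology}"
  assumes odd: "\<And>z. f (- z) = - f z"
  shows "(\<integral>z. f z \<partial>lborel) = 0"
proof -
  have "(\<integral>z. f z \<partial>lborel) = (\<integral>z. f (0 - z) \<partial>lborel)"
    by (rule integral_reflect[symmetric])
  also have "\<dots> = - (\<integral>z. f z \<partial>lborel)"
    by (simp only: diff_0 odd Bochner_Integration.integral_minus)
  finally have "(\<integral>z. f z \<partial>lborel) + (\<integral>z. f z \<partial>lborel) = 0"
    unfolding eq_neg_iff_add_eq_0 .
  then show ?thesis
    by (simp only: scaleR_2[symmetric] scaleR_eq_0_iff) simp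
qed

lemma integral_translate:
  fixes f :: "'a::euclidean_space \<Rightarrow> 'b::{banach,second_countable_topology}"
  shows "(\<integral>x. f (x - t) \<partial>lborel) = (\<integral>x. f x \<partial>lborel)"
  using integral_affine[of "1" f "-t"] by simp

lemma integrable_translate:
  fixes f :: "'a::euclidean_space \<Rightarrow> 'b::{banach,second_countable_topology}"
  assumes "integrable lborel f"
  shows "integrable lborel (\<lambda>x. f (x - t))"
  using integrable_affine[of "1" f "-t"] assms by simp

lemma AE_affine:
  fixes P :: "'a::euclidean_space \<Rightarrow> bool"
  assumes c: "c \<noteq> 0" and P: "AE x in lborel. P x"
  shows "AE x in lborel. P (t + c *\<^sub>R x)"
proof -
  obtain N where N: "{x. \<not> P x} \<subseteq> N" "N \<in> sets borel" "emeasure lborel N = 0"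
    using AE_E[OF P] by auto
  note [measurable] = N(2)
  have "AE x in lborel. x \<notin> N"
    using N by (intro AE_not_in) auto
  then have "(\<integral>\<^sup>+x. indicator N x \<partial>lborel) = 0"
    using N by simp
  then have "(\<integral>\<^sup>+x. indicator N (t + c *\<^sub>R x) \<partial>lborel) = (0::ennreal)"
    using c by (subst (asm) nn_integral_affine[OF c, of _ t]) (auto simp: N(2))
  then have "AE x in lborel. indicator N (t + c *\<^sub>R x) = (0::ennreal)"
    by (subst (asm) nn_integral_0_iff_AE) (auto)
  then show ?thesis
    by eventually_elim (use N(1) in \<open>auto simp: indicator_def split: if_splits\<close>)
qed

section \<open>Square integrable functions modulo null sets\<close>

lemma abs_l2_rep_l2 [simp]: "abs_l2 (rep_l2 F) = F"
  by (rule Quotient_abs_rep[OF Quotient_l2])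

lemma square_integrable_rep_l2 [simp, intro]: "square_integrable (rep_l2 F)"
  using Quotient_rep_reflp[OF Quotient_l2] by blast

lemma abs_l2_eqI:
  "square_integrable f \<Longrightarrow> square_integrable g \<Longrightarrow> AE x in lborel. f x = g x \<Longrightarrow> abs_l2 f = abs_l2 g"
  using Quotient_rel[OF Quotient_l2, of f g] by auto

lemma abs_l2_eq_iff:
  "square_integrable f \<Longrightarrow> square_integrable g \<Longrightarrow> abs_l2 f = abs_l2 g \<longleftrightarrow> (AE x in lborel. f x = g x)"
  using Quotient_rel[OF Quotient_l2, of f g] by auto

lemma AE_rep_abs_l2: "square_integrable f \<Longrightarrow> AE x in lborel. rep_l2 (abs_l2 f) x = f x"
  using Quotient_rep_abs[OF Quotient_l2, of f] by auto

lemma abs_l2_add: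
  "square_integrable f \<Longrightarrow> square_integrable g \<Longrightarrow> abs_l2 (\<lambda>x. f x + g x) = abs_l2 f + abs_l2 g"
  by (rule plus_l2.abs_eq[symmetric]) auto

lemma abs_l2_scaleR: "square_integrable f \<Longrightarrow> abs_l2 (\<lambda>x. r *\<^sub>R f x) = r *\<^sub>R abs_l2 f"
  by (rule scaleR_l2.abs_eq[symmetric]) auto

lemma abs_l2_uminus: "square_integrable f \<Longrightarrow> abs_l2 (\<lambda>x. - f x) = - abs_l2 f"
  by (rule uminus_l2.abs_eq[symmetric]) auto

lemma abs_l2_scaleC: "square_integrable f \<Longrightarrow> abs_l2 (\<lambda>x. of_complex c * f x) = c *\<^sub>C abs_l2 f"
  by (rule scaleC.abs_eq[symmetric]) auto

lemma abs_l2_0: "abs_l2 (\<lambda>x. 0) = 0"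
  by (rule zero_l2.abs_eq[symmetric])

lemma square_integrable_diff:
  fixes f g :: "real^2 \<Rightarrow> cl2"
  shows "square_integrable f \<Longrightarrow> square_integrable g \<Longrightarrow> square_integrable (\<lambda>x. f x - g x)"
  using square_integrable_add[OF _ square_integrable_scaleR[of g "-1"], of f] by simp

lemma abs_l2_diff:
  "square_integrable f \<Longrightarrow> square_integrable g \<Longrightarrow> abs_l2 (\<lambda>x. f x - g x) = abs_l2 f - abs_l2 g"
  using abs_l2_add[of f "\<lambda>x. - g x"] square_integrable_scaleR[of g "-1"] abs_l2_uminus[of g] by simp

lemma inner_abs_l2:
  "square_integrable f \<Longrightarrow> square_integrable g \<Longrightarrow> inner (abs_l2 f) (abs_l2 g) = (\<integral>x. inner (f x) (g x) \<partial>lborel)"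
  by (rule inner_l2.abs_eq) auto

lemma norm_abs_l2: "square_integrable f \<Longrightarrow> (norm (abs_l2 f))\<^sup>2 = (\<integral>x. (norm (f x))\<^sup>2 \<partial>lborel)"
  by (simp add: power2_norm_eq_inner inner_abs_l2)

lemma norm_l2: "(norm F)\<^sup>2 = (\<integral>x. (norm (rep_l2 F x))\<^sup>2 \<partial>lborel)"
  using norm_abs_l2[OF square_integrable_rep_l2, of F] by simp

lemma nn_integral_norm_abs_l2:
  "square_integrable f \<Longrightarrow> (\<integral>\<^sup>+x. ennreal ((norm (f x))\<^sup>2) \<partial>lborel) = ennreal ((norm (abs_l2 f))\<^sup>2)"
  by (simp add: norm_abs_l2 nn_integral_eq_integral square_integrable_def)

lemma square_integrable_iff_nn:
  fixes f :: "real^2 \<Rightarrow> 'b::euclidean_space"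
  shows "square_integrable f \<longleftrightarrow>
    f \<in> borel_measurable borel \<and> (\<integral>\<^sup>+x. ennreal ((norm (f x))\<^sup>2) \<partial>lborel) < \<infinity>"
  by (auto simp: square_integrable_def integrable_iff_bounded)

lemma norm_scaleC: "norm (c *\<^sub>C F) = cmod c * norm F"
proof (rule power2_eq_imp_eq)
  show "(norm (c *\<^sub>C F))\<^sup>2 = (cmod c * norm F)\<^sup>2"
    using norm_abs_l2[OF square_integrable_cmult[OF square_integrable_rep_l2], of c F]
    by (simp add: abs_l2_scaleC norm_of_complex_mult power_mult_distrib norm_l2)
qed auto

lemma scaleC_add: "c *\<^sub>C (F + G) = c *\<^sub>C F + c *\<^sub>C G"
  by transfer (auto intro!: square_integrable_add square_integrable_cmult simp: distrib_left)

lemma scaleC_scaleC: "c *\<^sub>C d *\<^sub>C F = (c * d) *\<^sub>C F"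
  by transfer (auto intro!: square_integrable_cmult simp: of_complex_hom mult.assoc)

lemma scaleC_one: "1 *\<^sub>C F = F"
  by transfer simp

lemma scaleC_of_real: "of_real r *\<^sub>C F = r *\<^sub>R F"
  by transfer (simp add: square_integrable_scaleR of_real_def of_complex_scaleR)

lemma scaleC_diff_left: "(c - d) *\<^sub>C F = c *\<^sub>C F - d *\<^sub>C F"
proof -
  have "abs_l2 (\<lambda>x. of_complex (c - d) * rep_l2 F x) = 
    abs_l2 (\<lambda>x. of_complex c * rep_l2 F x - of_complex d * rep_l2 F x)"
    by (simp add: of_complex_diff left_diff_distrib)
  then show ?thesis
    by (simp add: abs_l2_scaleC abs_l2_diff square_integrable_cmult)
qed

lemma bounded_linear_scaleC: "bounded_linear (\<lambda>F. c *\<^sub>C F)"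
proof (rule bounded_linear_intro[where K = "cmod c"])
  show "c *\<^sub>C r *\<^sub>R F = r *\<^sub>R c *\<^sub>C F" for r F
    by (metis scaleC_of_real scaleC_scaleC mult.commute)
qed (simp_all add: scaleC_add norm_scaleC)

lemma tendsto_power2_zero_iff: "((\<lambda>n. (g n)\<^sup>2) \<longlongrightarrow> 0) A \<longleftrightarrow> (g \<longlongrightarrow> 0) A" for g :: "'a \<Rightarrow> real"
proof
  assume "((\<lambda>n. (g n)\<^sup>2) \<longlongrightarrow> 0) A"
  from tendsto_real_sqrt[OF this] show "(g \<longlongrightarrow> 0) A"
    by (simp add: tendsto_rabs_zero_iff)
next
  assume "(g \<longlongrightarrow> 0) A"
  from tendsto_power[OF this, of 2] show "((\<lambda>n. (g n)\<^sup>2) \<longlongrightarrow> 0) A"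
    by simp
qed

lemma l2_tendsto_iff:
  assumes "\<And>n. square_integrable (u n)" "square_integrable f"
  shows "((\<lambda>n. abs_l2 (u n)) \<longlongrightarrow> abs_l2 f) A \<longleftrightarrow>
    ((\<lambda>n. \<integral>x. (norm (u n x - f x))\<^sup>2 \<partial>lborel) \<longlongrightarrow> 0) A"
proof -
  have "((\<lambda>n. abs_l2 (u n)) \<longlongrightarrow> abs_l2 f) A \<longleftrightarrow> ((\<lambda>n. (norm (abs_l2 (u n) - abs_l2 f))\<^sup>2) \<longlongrightarrow> 0) A"
    by (simp add: tendsto_power2_zero_iff tendsto_norm_zero_iff LIM_zero_iff)
  also have "(\<lambda>n. (norm (abs_l2 (u n) - abs_l2 f))\<^sup>2) = (\<lambda>n. \<integral>x. (norm (u n x - f x))\<^sup>2 \<partial>lborel)"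
    using assms by (simp add: abs_l2_diff[symmetric] norm_abs_l2 square_integrable_diff)
  finally show ?thesis .
qed

lemma l2_tendsto_AE_subseq:
  assumes u: "\<And>n. square_integrable (u n)" and f: "square_integrable f"
    and lim: "(\<lambda>n. abs_l2 (u n)) \<longlonglongrightarrow> abs_l2 f"
  shows "\<exists>r. strict_mono r \<and> (AE x in lborel. (\<lambda>n. u (r n) x) \<longlonglongrightarrow> f x)"
proof -
  have "\<exists>r. strict_mono r \<and> (AE x in lborel. (\<lambda>n. (norm (u (r n) x - f x))\<^sup>2) \<longlonglongrightarrow> 0)"
  proof (rule tendsto_L1_AE_subseq)
    show "integrable lborel (\<lambda>x. (norm (u n x - f x))\<^sup>2)" for n
      using square_integrable_diff[OF u f] by (simp add: square_integrable_def)
    show "(\<lambda>n. \<integral>x. norm ((norm (u n x - f x))\<^sup>2) \<partial>lborel) \<longlonglongrightarrow> 0"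
      using lim l2_tendsto_iff[of u f sequentially, OF u f] by simp
  qed
  moreover have *: "v \<longlonglongrightarrow> y" if "(\<lambda>n. (norm (v n - y))\<^sup>2) \<longlonglongrightarrow> 0" for v :: "nat \<Rightarrow> cl2" and y
    using tendsto_real_sqrt[OF that] by (simp add: LIM_zero_iff tendsto_norm_zero_iff)
  ultimately obtain r where r: "strict_mono r" "AE x in lborel. (\<lambda>n. (norm (u (r n) x - f x))\<^sup>2) \<longlonglongrightarrow> 0"
    by blast
  have "AE x in lborel. (\<lambda>n. u (r n) x) \<longlonglongrightarrow> f x"
    using r(2) by eventually_elim (rule *)
  then show ?thesis using r(1) by blast
qed

lemma l2_dominated_convergence:
  fixes u :: "nat \<Rightarrow> real^2 \<Rightarrow> cl2"
  assumes u: "\<And>n. square_integrable (u n)" and f: "square_integrable f"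
    and lim: "AE x in lborel. (\<lambda>n. u n x) \<longlonglongrightarrow> f x"
    and w: "integrable lborel w" "\<And>n. AE x in lborel. (norm (u n x - f x))\<^sup>2 \<le> w x"
  shows "(\<lambda>n. abs_l2 (u n)) \<longlonglongrightarrow> abs_l2 f"
proof -
  have [measurable]: "u n \<in> borel_measurable borel" "f \<in> borel_measurable borel" for n
    using u f by (auto simp: square_integrable_def)
  have "(\<lambda>n. \<integral>x. (norm (u n x - f x))\<^sup>2 \<partial>lborel) \<longlonglongrightarrow> integral\<^sup>L (lborel :: (real^2) measure) (\<lambda>_. 0)"
  proof (rule integral_dominated_convergence[where w=w])
    show "AE x in lborel. (\<lambda>n. (norm (u n x - f x))\<^sup>2) \<longlonglongrightarrow> 0"
      using lim
    proof eventually_elim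
      fix x assume "(\<lambda>n. u n x) \<longlonglongrightarrow> f x"
      then have "(\<lambda>n. (norm (u n x - f x))\<^sup>2) \<longlonglongrightarrow> (norm (f x - f x))\<^sup>2"
        by (intro tendsto_intros)
      then show "(\<lambda>n. (norm (u n x - f x))\<^sup>2) \<longlonglongrightarrow> 0" by simp
    qed
  qed (use w in auto)
  then show ?thesis
    using l2_tendsto_iff[of u f sequentially, OF u f] by simp
qed

lemma abs_l2_sum:
  "(\<And>i. i \<in> I \<Longrightarrow> square_integrable (f i)) \<Longrightarrow>
    square_integrable (\<lambda>x. \<Sum>i\<in>I. f i x) \<and> abs_l2 (\<lambda>x. \<Sum>i\<in>I. f i x) = (\<Sum>i\<in>I. abs_l2 (f i))"
proof (induction I rule: infinite_finite_induct)
  case (insert i I)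
  then show ?case
    by (simp add: square_integrable_add abs_l2_add)
qed (auto simp: square_integrable_0 abs_l2_0)

instance l2 :: complete_space
proof
  fix X :: "nat \<Rightarrow> l2"
  assume X: "Cauchy X"
  have "\<forall>n. \<exists>N. \<forall>i\<ge>N. \<forall>j\<ge>N. norm (X i - X j) < (1/2) ^ n"
    using X by (auto simp: Cauchy_iff)
  then obtain N where N: "\<And>n i j. i \<ge> N n \<Longrightarrow> j \<ge> N n \<Longrightarrow> norm (X i - X j) < (1/2) ^ n"
    by metis
  define r where "r n = (\<Sum>i\<le>n. N i + 1)" for n
  have r: "strict_mono r" "N n \<le> r n" "r n \<le> r (Suc n)" for n
    using member_le_sum[of n "{..n}" "\<lambda>i. N i + 1"] by (auto simp: strict_mono_Suc_iff r_def)
  define F where "F n = rep_l2 (X (r n))" for n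
  have F [simp]: "square_integrable (F n)" for n
    by (simp add: F_def)
  have [measurable]: "F n \<in> borel_measurable borel" for n
    using square_integrableD(1)[OF F] .
  have F_diff: "(\<integral>\<^sup>+x. ennreal ((norm (F i x - F j x))\<^sup>2) \<partial>lborel) = ennreal ((norm (X (r i) - X (r j)))\<^sup>2)" for i j
    using nn_integral_norm_abs_l2[OF square_integrable_diff[OF F F], of i j]
    by (simp add: abs_l2_diff) (simp add: F_def)
  define h where "h n x = 2 ^ n * (norm (F (Suc n) x - F n x))\<^sup>2" for n x
  have h: "(\<integral>\<^sup>+x. ennreal (h n x) \<partial>lborel) \<le> ennreal ((1/2) ^ n)" for n
  proof -
    have "(\<integral>\<^sup>+x. ennreal (h n x) \<partial>lborel) = ennreal (2 ^ n) * ennreal ((norm (X (r (Suc n)) - X (r n)))\<^sup>2)"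
      unfolding h_def F_diff[symmetric] by (subst nn_integral_cmult[symmetric]) (auto simp: ennreal_mult)
    also have "\<dots> \<le> ennreal (2 ^ n) * ennreal (((1/2) ^ n)\<^sup>2)"
      using N[of n "r (Suc n)" "r n"] order_trans[OF r(2) r(3), of n] r(2)[of n]
      by (intro mult_left_mono ennreal_leI power_mono) auto
    also have "\<dots> = ennreal ((1/2) ^ n)"
      by (simp add: ennreal_mult[symmetric] power2_eq_square power_divide)
    finally show ?thesis .
  qed
  have "(\<integral>\<^sup>+x. (\<Sum>n. ennreal (h n x)) \<partial>lborel) = (\<Sum>n. \<integral>\<^sup>+x. ennreal (h n x) \<partial>lborel)"
    by (intro nn_integral_suminf) (auto simp: h_def)
  also have "\<dots> \<le> (\<Sum>n. ennreal ((1/2) ^ n))"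
    by (intro suminf_le h) auto
  also have "\<dots> < \<infinity>"
    by (subst suminf_ennreal2) auto
  finally have "AE x in lborel. (\<Sum>n. ennreal (h n x)) \<noteq> \<infinity>"
    by (intro nn_integral_PInf_AE) (auto simp: h_def)
  then have "AE x in lborel. convergent (\<lambda>n. F n x)"
  proof eventually_elim
    fix x
    assume "(\<Sum>n. ennreal (h n x)) \<noteq> \<infinity>"
    then have h_sum: "summable (\<lambda>n. h n x)"
      by (intro summable_suminf_not_top) (auto simp: h_def)
    have "summable (\<lambda>n. F (Suc n) x - F n x)"
    proof (rule summable_comparison_test')
      show "summable (\<lambda>n. (1/2) ^ n + h n x)"
        by (intro summable_add h_sum) auto
      show "norm (F (Suc n) x - F n x) \<le> (1/2) ^ n + h n x" if "n \<ge> 0" for n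
      proof -
        let ?a = "sqrt ((1/2) ^ n)" and ?b = "sqrt (2 ^ n) * norm (F (Suc n) x - F n x)"
        have "norm (F (Suc n) x - F n x) = ?a * ?b"
          by (simp add: real_sqrt_mult[symmetric] power_mult_distrib[symmetric] mult.assoc[symmetric])
        also have "\<dots> \<le> ?a\<^sup>2 + ?b\<^sup>2"
          using sum_squares_bound[of ?a ?b] zero_le_power2[of ?a] zero_le_power2[of ?b] by linarith
        also have "\<dots> = (1/2) ^ n + h n x"
          by (simp add: h_def power_mult_distrib)
        finally show ?thesis .
      qed
    qed
    then have "convergent (\<lambda>n. \<Sum>i<n. F (Suc i) x - F i x)"
      by (simp add: summable_iff_convergent)
    then have "convergent (\<lambda>n. F n x - F 0 x + F 0 x)"
      using sum_lessThan_telescope[of "\<lambda>n. F n x"] by (intro convergent_add convergent_const) auto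
    then show "convergent (\<lambda>n. F n x)" by simp
  qed
  then have lim: "AE x in lborel. (\<lambda>n. F n x) \<longlonglongrightarrow> lim (\<lambda>n. F n x)"
    by eventually_elim (simp add: convergent_LIMSEQ_iff)
  define g where "g x = lim (\<lambda>n. F n x)" for x
  have [measurable]: "g \<in> borel_measurable borel"
    unfolding g_def by measurable
  have fatou: "(\<integral>\<^sup>+x. ennreal ((norm (g x - F n x))\<^sup>2) \<partial>lborel) \<le> ennreal (((1/2) ^ k)\<^sup>2)" if "n \<ge> k" for n k
  proof -
    have "(\<integral>\<^sup>+x. ennreal ((norm (g x - F n x))\<^sup>2) \<partial>lborel)
        \<le> (\<integral>\<^sup>+x. liminf (\<lambda>m. ennreal ((norm (F m x - F n x))\<^sup>2)) \<partial>lborel)"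
    proof (rule nn_integral_mono_AE)
      show "AE x in lborel. ennreal ((norm (g x - F n x))\<^sup>2) \<le> liminf (\<lambda>m. ennreal ((norm (F m x - F n x))\<^sup>2))"
        using lim
      proof eventually_elim
        fix x assume "(\<lambda>n. F n x) \<longlonglongrightarrow> lim (\<lambda>n. F n x)"
        then have "(\<lambda>m. ennreal ((norm (F m x - F n x))\<^sup>2)) \<longlonglongrightarrow> ennreal ((norm (g x - F n x))\<^sup>2)"
          unfolding g_def by (intro tendsto_intros)
        from lim_imp_Liminf[OF _ this]
        show "ennreal ((norm (g x - F n x))\<^sup>2) \<le> liminf (\<lambda>m. ennreal ((norm (F m x - F n x))\<^sup>2))"
          by simp
      qed
    qed
    also have "\<dots> \<le> liminf (\<lambda>m. \<integral>\<^sup>+x. ennreal ((norm (F m x - F n x))\<^sup>2) \<partial>lborel)"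
      by (rule nn_integral_liminf) simp
    also have "\<dots> \<le> limsup (\<lambda>m. \<integral>\<^sup>+x. ennreal ((norm (F m x - F n x))\<^sup>2) \<partial>lborel)"
      by (rule Liminf_le_Limsup) simp
    also have "\<dots> \<le> ennreal (((1/2) ^ k)\<^sup>2)"
    proof (rule Limsup_bounded)
      have "(\<integral>\<^sup>+x. ennreal ((norm (F m x - F n x))\<^sup>2) \<partial>lborel) \<le> ennreal (((1/2) ^ k)\<^sup>2)" if "m \<ge> k" for m
      proof -
        have "r k \<le> r m" "r k \<le> r n"
          using \<open>m \<ge> k\<close> \<open>n \<ge> k\<close> r(1) by (auto simp: strict_mono_less_eq)
        then show ?thesis
          unfolding F_diff using r(2)[of k] N[of k "r m" "r n"]
          by (intro ennreal_leI power_mono) auto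
      qed
      then show "\<forall>\<^sub>F m in sequentially. (\<integral>\<^sup>+x. ennreal ((norm (F m x - F n x))\<^sup>2) \<partial>lborel) \<le> ennreal (((1/2) ^ k)\<^sup>2)"
        by (rule eventually_sequentiallyI)
    qed
    finally show ?thesis .
  qed
  have "square_integrable (\<lambda>x. g x - F 0 x)"
    using le_less_trans[OF fatou[of 0 0]] by (simp add: square_integrable_iff_nn)
  from square_integrable_add[OF this F[of 0]] have g: "square_integrable g"
    by simp
  have bound: "norm (X (r n) - abs_l2 g) \<le> (1/2) ^ n" for n
  proof (rule power2_le_imp_le)
    have "ennreal ((norm (abs_l2 g - X (r n)))\<^sup>2) = (\<integral>\<^sup>+x. ennreal ((norm (g x - F n x))\<^sup>2) \<partial>lborel)"
      using nn_integral_norm_abs_l2[OF square_integrable_diff[OF g F], of n]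
      by (simp add: abs_l2_diff g) (simp add: F_def)
    also have "\<dots> \<le> ennreal (((1/2) ^ n)\<^sup>2)"
      by (rule fatou) simp
    finally show "(norm (X (r n) - abs_l2 g))\<^sup>2 \<le> ((1/2) ^ n)\<^sup>2"
      by (simp add: norm_minus_commute)
  qed simp
  have "(\<lambda>n. X (r n) - abs_l2 g) \<longlonglongrightarrow> 0"
    by (rule Lim_null_comparison[of _ "\<lambda>n. (1/2) ^ n"]) (use bound in \<open>auto intro: LIMSEQ_power_zero\<close>)
  then have "(X \<circ> r) \<longlonglongrightarrow> abs_l2 g"
    by (simp add: LIM_zero_iff o_def)
  then show "convergent X"
    using Cauchy_converges_subseq[OF X r(1)] unfolding convergent_def by blast
qed

lemma square_integrable_indicator:
  fixes c :: cl2
  assumes "A \<in> sets borel" "emeasure lborel A < \<infinity>"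
  shows "square_integrable (\<lambda>x. indicator A x *\<^sub>R c)"
proof -
  have *: "(norm (indicator A x *\<^sub>R c))\<^sup>2 = indicator A x * (norm c)\<^sup>2" for x
    by (auto simp: indicator_def)
  show ?thesis
    using assms unfolding square_integrable_def * by auto
qed

text \<open>
  Finite unions of open boxes have negligible boundary, which makes their indicator functions
  locally constant almost everywhere.
\<close>

lemma l2_step_induct [consumes 2, case_names step]:
  assumes V: "closed V" "subspace V"
    and step: "\<And>B c. bounded B \<Longrightarrow> open B \<Longrightarrow> negligible (frontier B) \<Longrightarrow>
      abs_l2 (\<lambda>x. indicator B x *\<^sub>R c) \<in> V"
  shows "F \<in> V"
proof -
  have step_open: "abs_l2 (\<lambda>x. indicator U x *\<^sub>R c) \<in> V" if U: "open U" "emeasure lborel U < \<infinity>" for U c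
  proof -
    obtain \<D> where D: "countable \<D>" "\<D> \<subseteq> Pow U" "\<And>X. X \<in> \<D> \<Longrightarrow> \<exists>a b. X = box a b" "\<Union>\<D> = U"
      using open_countable_Union_open_box[OF U(1)] by metis
    define E where "E = insert {} \<D>"
    have "\<exists>a b. {} = box a (b :: real^2)"
      by (rule exI[of _ 0], rule exI[of _ 0]) simp
    then have E: "countable E" "E \<noteq> {}" "\<And>X. X \<in> E \<Longrightarrow> \<exists>a b. X = box a b" "\<Union>E = U"
      using D by (auto simp: E_def)
    define B where "B n = (\<Union>i\<le>n. from_nat_into E i)" for n :: nat
    have box: "\<exists>a b. from_nat_into E i = box a b" for i
      using E by (intro E(3) from_nat_into)
    have "bounded (from_nat_into E i)" "open (from_nat_into E i)" for i
      using box[of i] by (metis bounded_box, metis open_box)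
    then have B: "bounded (B n)" "open (B n)" for n
      unfolding B_def by (blast intro: bounded_UN, blast)
    have negl: "negligible (frontier (B n))" for n
    proof (rule negligible_subset)
      show "frontier (B n) \<subseteq> \<Union> (frontier ` from_nat_into E ` {..n})"
        unfolding B_def using frontier_Union_subset[of "from_nat_into E ` {..n}"] by auto
      have "negligible (frontier (from_nat_into E i))" for i
        using box[of i] by (metis convex_box(2) negligible_convex_frontier)
      then show "negligible (\<Union> (frontier ` from_nat_into E ` {..n}))"
        by (intro negligible_Union) auto
    qed
    have BU: "(\<Union>n. B n) = U"
    proof -
      have "(\<Union>n. B n) = (\<Union>i. from_nat_into E i)" by (auto simp: B_def)
      also have "\<dots> = U" using E by (metis range_from_nat_into)
      finally show ?thesis .
    qed
    have BsubU: "B n \<subseteq> U" for n using BU by auto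
    have sq: "square_integrable (\<lambda>x. indicator (B n) x *\<^sub>R c)" for n
    proof (rule square_integrable_indicator)
      show "emeasure lborel (B n) < \<infinity>"
        by (rule le_less_trans[OF emeasure_mono[OF BsubU] U(2)]) (use U in auto)
    qed (use B in auto)
    have "(\<lambda>n. abs_l2 (\<lambda>x. indicator (B n) x *\<^sub>R c)) \<longlonglongrightarrow> abs_l2 (\<lambda>x. indicator U x *\<^sub>R c)"
    proof (rule l2_dominated_convergence[OF sq, where w = "\<lambda>x. indicator U x * (norm c)\<^sup>2"])
      show "square_integrable (\<lambda>x. indicator U x *\<^sub>R c)"
        using U by (intro square_integrable_indicator) auto
      show "integrable lborel (\<lambda>x. indicator U x * (norm c)\<^sup>2)"
        using U by auto
      show "AE x in lborel. (norm (indicator (B n) x *\<^sub>R c - indicator U x *\<^sub>R c))\<^sup>2 \<le> indicator U x * (norm c)\<^sup>2" for n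
        using BsubU[of n] by (auto intro!: AE_I2 simp: indicator_def)
      have "incseq B" by (fastforce simp: incseq_def B_def)
      then have "(\<lambda>n. indicator (B n) x :: real) \<longlonglongrightarrow> indicator U x" for x
        using LIMSEQ_indicator_incseq[of B x] BU by simp
      then show "AE x in lborel. (\<lambda>n. indicator (B n) x *\<^sub>R c) \<longlonglongrightarrow> indicator U x *\<^sub>R c"
        by (intro AE_I2 tendsto_intros)
    qed
    then show ?thesis
      by (rule closed_sequentially[OF V(1), rotated]) (intro step B negl)
  qed
  have step_set: "abs_l2 (\<lambda>x. indicator A x *\<^sub>R c) \<in> V"
    if A: "A \<in> sets borel" "emeasure lborel A < \<infinity>" for A c
  proof -
    have "\<exists>U. open U \<and> A \<subseteq> U \<and> emeasure lborel (U - A) < ennreal (1 / Suc n)" for n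
      using outer_regular_lborel[OF A(1), of "1 / Suc n"] by (metis of_nat_0_less_iff zero_less_Suc zero_less_divide_1_iff)
    then obtain U where U: "\<And>n. open (U n)" "\<And>n. A \<subseteq> U n"
      "\<And>n. emeasure lborel (U n - A) < ennreal (1 / Suc n)"
      by metis
    note [measurable] = A(1)
    have [measurable]: "U n \<in> sets borel" for n using U(1) by auto
    have fin: "emeasure lborel (U n) < \<infinity>" for n
    proof -
      have "emeasure lborel (U n) \<le> emeasure lborel A + emeasure lborel (U n - A)"
        using U(2)[of n] emeasure_subadditive[of A lborel "U n - A"] by (simp add: Un_absorb1)
      also have "\<dots> < \<infinity>"
        using A(2) order.strict_trans[OF U(3)[of n] ennreal_less_top] by simp
      finally show ?thesis .
    qed
    have sq: "square_integrable (\<lambda>x. indicator (U n) x *\<^sub>R c)" "square_integrable (\<lambda>x. indicator A x *\<^sub>R c)" for n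
      using fin A by (auto intro!: square_integrable_indicator)
    have "(\<lambda>n. abs_l2 (\<lambda>x. indicator (U n) x *\<^sub>R c)) \<longlonglongrightarrow> abs_l2 (\<lambda>x. indicator A x *\<^sub>R c)"
    proof (subst l2_tendsto_iff[OF sq], rule tendsto_sandwich[OF _ _ tendsto_const])
      have eq: "(norm (indicator (U n) x *\<^sub>R c - indicator A x *\<^sub>R c))\<^sup>2 = (norm c)\<^sup>2 * indicator (U n - A) x" for n x
        using U(2)[of n] by (auto simp: indicator_def)
      show "\<forall>\<^sub>F n in sequentially. 0 \<le> (\<integral>x. (norm (indicator (U n) x *\<^sub>R c - indicator A x *\<^sub>R c))\<^sup>2 \<partial>lborel)"
        by simp
      have m: "measure lborel (U n - A) \<le> 1 / Suc n" for n
        using less_imp_le[OF U(3)[of n]] by (auto simp: measure_def intro!: enn2real_leI)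
      show "\<forall>\<^sub>F n in sequentially. (\<integral>x. (norm (indicator (U n) x *\<^sub>R c - indicator A x *\<^sub>R c))\<^sup>2 \<partial>lborel) \<le> (norm c)\<^sup>2 * (1 / Suc n)"
        unfolding eq using mult_left_mono[OF m, of "(norm c)\<^sup>2"]
        by (intro always_eventually allI) simp
      show "(\<lambda>n. (norm c)\<^sup>2 * (1 / Suc n)) \<longlonglongrightarrow> 0"
        using tendsto_mult[OF tendsto_const[of "(norm c)\<^sup>2"] LIMSEQ_inverse_real_of_nat] by (simp add: inverse_eq_divide)
    qed
    then show ?thesis
      by (rule closed_sequentially[OF V(1), rotated]) (intro step_open U fin)
  qed
  define f where "f = rep_l2 F"
  have f: "square_integrable f" by (simp add: f_def)
  have [measurable]: "f \<in> borel_measurable borel" using square_integrableD(1)[OF f] .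
  obtain s where s: "\<And>i. simple_function lborel (s i)" "\<And>x. (\<lambda>i. s i x) \<longlonglongrightarrow> f x"
    "\<And>i x. norm (s i x) \<le> 2 * norm (f x)"
    using borel_measurable_implies_sequence_metric[of f lborel 0] by (auto simp: dist_norm)
  have [measurable]: "s i \<in> borel_measurable borel" for i
    using borel_measurable_simple_function[OF s(1)[of i]] by simp
  have sq: "square_integrable (s i)" for i
    by (rule square_integrable_bound[OF f _ s(3)]) simp
  have sV: "abs_l2 (s i) \<in> V" for i
  proof -
    define I where "I = s i ` UNIV - {0}"
    have "finite I" using simple_functionD(1)[OF s(1), of i] by (simp add: I_def)
    let ?A = "\<lambda>y. s i -` {y}"
    have fin: "?A y \<in> sets borel" "emeasure lborel (?A y) < \<infinity>" if "y \<in> I" for y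
    proof -
      show A [measurable]: "?A y \<in> sets borel"
        using measurable_sets[of "s i" borel borel "{y}"] by simp
      have "ennreal ((norm y)\<^sup>2) * emeasure lborel (?A y) = (\<integral>\<^sup>+x. ennreal ((norm y)\<^sup>2) * indicator (?A y) x \<partial>lborel)"
        by (subst nn_integral_cmult_indicator) auto
      also have "\<dots> \<le> (\<integral>\<^sup>+x. ennreal ((norm (s i x))\<^sup>2) \<partial>lborel)"
        by (intro nn_integral_mono) (auto simp: indicator_def)
      also have "\<dots> < \<infinity>" using sq[of i] by (simp add: square_integrable_iff_nn)
      finally show "emeasure lborel (?A y) < \<infinity>"
        using that by (auto simp: I_def ennreal_mult_less_top)
    qed
    have "s i x = (\<Sum>y\<in>I. indicator (?A y) x *\<^sub>R y)" for x
    proof (cases "s i x = 0")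
      case False
      then have "(\<Sum>y\<in>I. indicator (?A y) x *\<^sub>R y) = (\<Sum>y\<in>{s i x}. indicator (?A y) x *\<^sub>R y)"
        using \<open>finite I\<close> by (intro sum.mono_neutral_right) (auto simp: I_def)
      then show ?thesis by simp
    qed (auto simp: I_def indicator_def intro!: sum.neutral[symmetric])
    then have "s i = (\<lambda>x. \<Sum>y\<in>I. indicator (?A y) x *\<^sub>R y)"
      by (rule ext)
    then have "abs_l2 (s i) = abs_l2 (\<lambda>x. \<Sum>y\<in>I. indicator (?A y) x *\<^sub>R y)"
      by (rule arg_cong)
    also have "\<dots> = (\<Sum>y\<in>I. abs_l2 (\<lambda>x. indicator (?A y) x *\<^sub>R y))"
      using abs_l2_sum[of I "\<lambda>y x. indicator (?A y) x *\<^sub>R y"] square_integrable_indicator[OF fin] by blast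
    also have "\<dots> \<in> V"
      by (intro subspace_sum V step_set fin)
    finally show ?thesis .
  qed
  have "(\<lambda>i. abs_l2 (s i)) \<longlonglongrightarrow> abs_l2 f"
  proof (rule l2_dominated_convergence[OF sq f, where w = "\<lambda>x. 9 * (norm (f x))\<^sup>2"])
    show "integrable lborel (\<lambda>x. 9 * (norm (f x))\<^sup>2)"
      using square_integrableD(2)[OF f] by simp
    have "(norm (s n x - f x))\<^sup>2 \<le> (3 * norm (f x))\<^sup>2" for n x
      using s(3)[of n x] norm_triangle_ineq4[of "s n x" "f x"] by (intro power_mono) auto
    then show "AE x in lborel. (norm (s n x - f x))\<^sup>2 \<le> 9 * (norm (f x))\<^sup>2" for n
      by (simp add: power_mult_distrib)
  qed (simp add: s(2))
  then have "abs_l2 f \<in> V"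
    by (rule closed_sequentially[OF V(1), rotated]) (rule sV)
  then show ?thesis by (simp add: f_def)
qed

section \<open>Translations and convolutions\<close>

lemma square_integrable_affine:
  fixes f :: "real^2 \<Rightarrow> cl2"
  assumes "c \<noteq> 0" "square_integrable f"
  shows "square_integrable (\<lambda>x. f (t + c *\<^sub>R x))"
proof -
  note [measurable] = square_integrableD(1)[OF assms(2)]
  show ?thesis
    using integrable_affine[OF assms(1) square_integrableD(2)[OF assms(2)]]
    by (simp add: square_integrable_def)
qed

lemma square_integrable_translate:
  fixes f :: "real^2 \<Rightarrow> cl2"
  shows "square_integrable f \<Longrightarrow> square_integrable (\<lambda>x. f (x - h))"
  using square_integrable_affine[of 1 f "-h"] by simp

lift_definition l2_shift :: "real^2 \<Rightarrow> l2 \<Rightarrow> l2" is "\<lambda>h f x. f (x - h)"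
  subgoal for h f g
    using AE_affine[of 1 "\<lambda>x. f x = g x" "- h"] by (auto intro: square_integrable_translate)
  done

lemma l2_shift_abs: "square_integrable f \<Longrightarrow> l2_shift h (abs_l2 f) = abs_l2 (\<lambda>x. f (x - h))"
  by (rule l2_shift.abs_eq) auto

lemma norm_l2_shift: "norm (l2_shift h F) = norm F"
proof -
  have "(norm (l2_shift h (abs_l2 (rep_l2 F))))\<^sup>2 = (norm (abs_l2 (rep_l2 F)))\<^sup>2"
    by (subst l2_shift_abs)
       (simp_all add: norm_abs_l2 square_integrable_translate integral_translate[of "\<lambda>x. (norm (rep_l2 F x))\<^sup>2"] del: abs_l2_rep_l2)
  then show ?thesis by simp
qed

lemma linear_l2_shift: "linear (l2_shift h)"
proof
  show "l2_shift h (F + G) = l2_shift h F + l2_shift h G" for F G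
    by transfer (auto intro!: square_integrable_add square_integrable_translate)
  show "l2_shift h (r *\<^sub>R F) = r *\<^sub>R l2_shift h F" for r F
    by transfer (auto intro!: square_integrable_scaleR square_integrable_translate)
qed

lemma convergence_set:
  fixes T :: "nat \<Rightarrow> 'a::real_normed_vector \<Rightarrow> 'b::real_normed_vector"
  assumes lin: "\<And>n. linear (T n)" "linear S"
    and bound: "\<And>n x. norm (T n x) \<le> C * norm x" "\<And>x. norm (S x) \<le> C * norm x"
  shows "closed {x. (\<lambda>n. T n x) \<longlonglongrightarrow> S x}" "subspace {x. (\<lambda>n. T n x) \<longlonglongrightarrow> S x}"
proof -
  show "subspace {x. (\<lambda>n. T n x) \<longlonglongrightarrow> S x}"
    using lin by (auto simp: subspace_def linear_0 linear_add linear_cmul intro: tendsto_add tendsto_scaleR)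
  show "closed {x. (\<lambda>n. T n x) \<longlonglongrightarrow> S x}"
    unfolding closed_sequential_limits
  proof safe
    fix X x
    assume X: "\<forall>k. X k \<in> {x. (\<lambda>n. T n x) \<longlonglongrightarrow> S x}" and lim: "X \<longlonglongrightarrow> x"
    show "(\<lambda>n. T n x) \<longlonglongrightarrow> S x"
    proof (rule LIMSEQ_I)
      fix e :: real assume "e > 0"
      define C' where "C' = \<bar>C\<bar> + 1"
      have C': "C' > 0" "C \<le> C'" by (auto simp: C'_def)
      have bound': "norm (T n y) \<le> C' * norm y" "norm (S y) \<le> C' * norm y" for n y
        using bound(1)[of n y] bound(2)[of y] mult_right_mono[OF C'(2), of "norm y"] by auto
      have "e / (4 * C') > 0" using \<open>e > 0\<close> C' by simp
      from LIMSEQ_D[OF lim this] obtain k where k: "norm (X k - x) < e / (4 * C')"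
        by blast
      have "(\<lambda>n. T n (X k)) \<longlonglongrightarrow> S (X k)" using X by auto
      from LIMSEQ_D[OF this, of "e/2"] \<open>e > 0\<close> obtain N
        where N: "\<And>n. n \<ge> N \<Longrightarrow> norm (T n (X k) - S (X k)) < e / 2" by auto
      have "norm (T n x - S x) < e" if "n \<ge> N" for n
      proof -
        have "T n x - S x = T n (x - X k) + (T n (X k) - S (X k)) - S (x - X k)"
          using lin by (simp add: linear_diff)
        also have "norm \<dots> \<le> norm (T n (x - X k)) + norm (T n (X k) - S (X k)) + norm (S (x - X k))"
          by (intro norm_triangle_le_diff add_right_mono norm_triangle_ineq)
        also have "\<dots> \<le> C' * norm (x - X k) + norm (T n (X k) - S (X k)) + C' * norm (x - X k)"
          by (intro add_mono bound') auto
        also have "\<dots> < e"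
        proof -
          have "C' * norm (x - X k) < C' * (e / (4 * C'))"
            using C' k by (intro mult_strict_left_mono) (auto simp: norm_minus_commute)
          also have "\<dots> = e / 4" using C' by simp
          finally show ?thesis using N[OF that] by simp
        qed
        finally show ?thesis .
      qed
      then show "\<exists>N. \<forall>n\<ge>N. norm (T n x - S x) < e" by blast
    qed
  qed
qed

lemma indicator_eventually_const:
  assumes "x \<notin> frontier B"
  shows "\<forall>\<^sub>F y in nhds x. indicator B y = indicator B x"
proof (cases "x \<in> interior B")
  case True
  then have "\<forall>\<^sub>F y in nhds x. y \<in> interior B"
    by (intro eventually_nhds_in_open) auto
  then show ?thesis
    by eventually_elim (use True interior_subset in \<open>auto simp: indicator_def\<close>)
next
  case False
  then have "x \<notin> closure B" using assms by (auto simp: frontier_def)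
  then have "\<forall>\<^sub>F y in nhds x. y \<in> - closure B"
    by (intro eventually_nhds_in_open) auto
  then show ?thesis
    by eventually_elim (use \<open>x \<notin> closure B\<close> closure_subset in \<open>auto simp: indicator_def\<close>)
qed

lemma AE_negligible: "negligible N \<Longrightarrow> AE x in lborel. x \<notin> N"
  using AE_not_in[of N lebesgue] by (simp add: negligible_iff_null_sets AE_completion_iff)

lemma square_integrable_indicator_bounded:
  fixes c :: cl2
  assumes "bounded B" "open B"
  shows "square_integrable (\<lambda>x. indicator B x *\<^sub>R c)"
  using assms emeasure_bounded_finite[of B] by (intro square_integrable_indicator) auto

lemma l2_shift_tendsto:
  assumes h: "h \<longlonglongrightarrow> 0"
  shows "(\<lambda>n. l2_shift (h n) F) \<longlonglongrightarrow> F"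
proof -
  have "F \<in> {F. (\<lambda>n. l2_shift (h n) F) \<longlonglongrightarrow> F}"
  proof (rule l2_step_induct)
    fix B :: "(real^2) set" and c :: cl2
    assume B: "bounded B" "open B" "negligible (frontier B)"
    obtain r where r: "\<And>x. x \<in> B \<Longrightarrow> norm x \<le> r"
      using \<open>bounded B\<close> by (auto simp: bounded_iff)
    obtain m where m: "\<And>n. norm (h n) \<le> m"
      using convergent_imp_bounded[OF h] by (auto simp: bounded_iff)
    have m0: "0 \<le> m" using m[of 0] norm_ge_zero[of "h 0"] by linarith
    note sq = square_integrable_indicator_bounded[OF \<open>bounded B\<close> \<open>open B\<close>, of c]
    have "(\<lambda>n. abs_l2 (\<lambda>x. indicator B (x - h n) *\<^sub>R c)) \<longlonglongrightarrow> abs_l2 (\<lambda>x. indicator B x *\<^sub>R c)"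
    proof (rule l2_dominated_convergence)
      show "square_integrable (\<lambda>x. indicator B (x - h n) *\<^sub>R c)" for n
        using square_integrable_translate[OF sq] .
      show "integrable lborel (\<lambda>x. indicator (cball (0 :: real^2) (r + m)) x * (norm c)\<^sup>2)"
        using emeasure_bounded_finite[of "cball (0 :: real^2) (r + m)"] by auto
      show "AE x in lborel. (norm (indicator B (x - h n) *\<^sub>R c - indicator B x *\<^sub>R c))\<^sup>2
        \<le> indicator (cball (0 :: real^2) (r + m)) x * (norm c)\<^sup>2" for n
      proof (rule AE_I2)
        fix x
        have "x \<in> B \<Longrightarrow> norm x \<le> r + m" using r[of x] m0 by linarith
        moreover have "x - h n \<in> B \<Longrightarrow> norm x \<le> r + m"
          using r[of "x - h n"] m[of n] norm_triangle_ineq[of "x - h n" "h n"] by simp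
        ultimately show "(norm (indicator B (x - h n) *\<^sub>R c - indicator B x *\<^sub>R c))\<^sup>2
            \<le> indicator (cball (0 :: real^2) (r + m)) x * (norm c)\<^sup>2"
          by (auto simp: indicator_def)
      qed
      show "AE x in lborel. (\<lambda>n. indicator B (x - h n) *\<^sub>R c) \<longlonglongrightarrow> indicator B x *\<^sub>R c"
        using AE_negligible[OF \<open>negligible (frontier B)\<close>]
      proof eventually_elim
        fix x assume "x \<notin> frontier B"
        have "(\<lambda>n. x - h n) \<longlonglongrightarrow> x - 0"
          by (intro tendsto_intros h)
        then have "\<forall>\<^sub>F n in sequentially. indicator B (x - h n) = (indicator B x :: real)"
          using indicator_eventually_const[OF \<open>x \<notin> frontier B\<close>] 
          by (auto simp: filterlim_iff elim: allE)
        then show "(\<lambda>n. indicator B (x - h n) *\<^sub>R c) \<longlonglongrightarrow> indicator B x *\<^sub>R c"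
          by (intro tendsto_eventually) (auto elim: eventually_mono)
      qed
    qed (rule sq)
    then show "abs_l2 (\<lambda>x. indicator B x *\<^sub>R c) \<in> {F. (\<lambda>n. l2_shift (h n) F) \<longlonglongrightarrow> F}"
      by (simp add: l2_shift_abs sq)
  qed (intro convergence_set[where C = 1 and T = "\<lambda>n. l2_shift (h n)" and S = "\<lambda>F. F"] linear_l2_shift linear_ident; simp add: norm_l2_shift)+
  then show ?thesis by simp
qed

lemma superposition_bound:
  fixes K :: "real^2 \<Rightarrow> cl2" and u :: "real^2 \<Rightarrow> real^2 \<Rightarrow> cl2"
  assumes K: "integrable lborel K"
    and [measurable]: "(\<lambda>(z, x). u z x) \<in> borel_measurable borel"
  shows "(\<integral>\<^sup>+x. (\<integral>\<^sup>+z. ennreal (norm (K z * u z x)) \<partial>lborel)\<^sup>2 \<partial>lborel) \<le>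
    16 * ennreal (\<integral>z. norm (K z) \<partial>lborel) *
      (\<integral>\<^sup>+z. ennreal (norm (K z)) * (\<integral>\<^sup>+x. ennreal ((norm (u z x))\<^sup>2) \<partial>lborel) \<partial>lborel)"
proof -
  have [measurable]: "K \<in> borel_measurable borel" using K by auto
  have [measurable]: "(\<lambda>(z, x). u z x) \<in> borel_measurable (lborel \<Otimes>\<^sub>M lborel)"
    by (simp add: lborel_prod)
  have [measurable]: "(\<lambda>z. u z x) \<in> borel_measurable borel" "(\<lambda>x. u z x) \<in> borel_measurable borel" for z x
    using measurable_compose[OF _ assms(2), of "\<lambda>z. (z, x)" borel]
      measurable_compose[OF _ assms(2), of "\<lambda>x. (z, x)" borel]
    by (simp_all add: borel_prod[symmetric])
  let ?k = "\<lambda>z. norm (K z)"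
  have K1: "(\<integral>\<^sup>+z. ennreal (?k z) \<partial>lborel) = ennreal (\<integral>z. ?k z \<partial>lborel)"
    using K by (intro nn_integral_eq_integral) auto
  have "(\<integral>\<^sup>+z. ennreal (norm (K z * u z x)) \<partial>lborel)\<^sup>2
    \<le> 16 * (ennreal (\<integral>z. ?k z \<partial>lborel) * (\<integral>\<^sup>+z. ennreal (?k z) * ennreal ((norm (u z x))\<^sup>2) \<partial>lborel))" for x
  proof -
    have "(\<integral>\<^sup>+z. ennreal (norm (K z * u z x)) \<partial>lborel)
      \<le> (\<integral>\<^sup>+z. 4 * (ennreal (sqrt (?k z)) * ennreal (sqrt (?k z) * norm (u z x))) \<partial>lborel)"
    proof (rule nn_integral_mono)
      fix z
      have "norm (K z * u z x) \<le> 4 * (sqrt (?k z) * (sqrt (?k z) * norm (u z x)))"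
        using norm_cl2_mult_le[of "K z" "u z x"] by (simp add: mult.assoc[symmetric])
      then have "ennreal (norm (K z * u z x)) \<le> ennreal (4 * (sqrt (?k z) * (sqrt (?k z) * norm (u z x))))"
        by (rule ennreal_leI)
      then show "ennreal (norm (K z * u z x)) \<le> 4 * (ennreal (sqrt (?k z)) * ennreal (sqrt (?k z) * norm (u z x)))"
        by (simp add: ennreal_mult)
    qed
    also have "\<dots> = 4 * (\<integral>\<^sup>+z. (ennreal (sqrt (?k z)) * ennreal (sqrt (?k z) * norm (u z x))) \<partial>lborel)"
      by (rule nn_integral_cmult) simp
    finally have "(\<integral>\<^sup>+z. ennreal (norm (K z * u z x)) \<partial>lborel)\<^sup>2
      \<le> (4 * (\<integral>\<^sup>+z. (ennreal (sqrt (?k z)) * ennreal (sqrt (?k z) * norm (u z x))) \<partial>lborel))\<^sup>2"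
      by (intro power_mono) auto
    also have "\<dots> = 16 * (\<integral>\<^sup>+z. (ennreal (sqrt (?k z)) * ennreal (sqrt (?k z) * norm (u z x))) \<partial>lborel)\<^sup>2"
      by (simp add: power_mult_distrib)
    also have "\<dots> \<le> 16 * ((\<integral>\<^sup>+z. ennreal (sqrt (?k z)) ^ 2 \<partial>lborel) * (\<integral>\<^sup>+z. ennreal (sqrt (?k z) * norm (u z x)) ^ 2 \<partial>lborel))"
      by (intro mult_left_mono Cauchy_Schwarz_nn_integral) auto
    also have "\<dots> = 16 * (ennreal (\<integral>z. ?k z \<partial>lborel) * (\<integral>\<^sup>+z. ennreal (?k z) * ennreal ((norm (u z x))\<^sup>2) \<partial>lborel))"
      unfolding K1[symmetric]
      by (simp add: ennreal_power power_mult_distrib ennreal_mult[symmetric])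
    finally show ?thesis .
  qed
  then have "(\<integral>\<^sup>+x. (\<integral>\<^sup>+z. ennreal (norm (K z * u z x)) \<partial>lborel)\<^sup>2 \<partial>lborel)
    \<le> (\<integral>\<^sup>+x. 16 * (ennreal (\<integral>z. ?k z \<partial>lborel) * (\<integral>\<^sup>+z. ennreal (?k z) * ennreal ((norm (u z x))\<^sup>2) \<partial>lborel)) \<partial>lborel)"
    by (intro nn_integral_mono)
  also have "\<dots> = 16 * ennreal (\<integral>z. ?k z \<partial>lborel) * (\<integral>\<^sup>+x. (\<integral>\<^sup>+z. ennreal (?k z) * ennreal ((norm (u z x))\<^sup>2) \<partial>lborel) \<partial>lborel)"
    by (simp add: nn_integral_cmult mult.assoc)
  also have "(\<integral>\<^sup>+x. (\<integral>\<^sup>+z. ennreal (?k z) * ennreal ((norm (u z x))\<^sup>2) \<partial>lborel) \<partial>lborel)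
    = (\<integral>\<^sup>+z. (\<integral>\<^sup>+x. ennreal (?k z) * ennreal ((norm (u z x))\<^sup>2) \<partial>lborel) \<partial>lborel)"
    by (rule lborel_pair.Fubini') measurable
  also have "\<dots> = (\<integral>\<^sup>+z. ennreal (?k z) * (\<integral>\<^sup>+x. ennreal ((norm (u z x))\<^sup>2) \<partial>lborel) \<partial>lborel)"
    by (simp add: nn_integral_cmult)
  finally show ?thesis .
qed

lemma superposition_bound':
  fixes K :: "real^2 \<Rightarrow> cl2" and u :: "real^2 \<Rightarrow> real^2 \<Rightarrow> cl2"
  assumes K: "integrable lborel K"
    and u [measurable]: "(\<lambda>(z, x). u z x) \<in> borel_measurable borel"
  shows "(\<integral>\<^sup>+x. ennreal ((norm (\<integral>z. K z * u z x \<partial>lborel))\<^sup>2) \<partial>lborel) \<le>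
    16 * ennreal (\<integral>z. norm (K z) \<partial>lborel) *
      (\<integral>\<^sup>+z. ennreal (norm (K z)) * (\<integral>\<^sup>+x. ennreal ((norm (u z x))\<^sup>2) \<partial>lborel) \<partial>lborel)"
proof (rule order_trans[OF nn_integral_mono superposition_bound[OF K u]])
  fix x
  have "ennreal (norm (\<integral>z. K z * u z x \<partial>lborel)) \<le> (\<integral>\<^sup>+z. ennreal (norm (K z * u z x)) \<partial>lborel)"
  proof (cases "integrable lborel (\<lambda>z. K z * u z x)")
    case True
    then show ?thesis by (rule integral_norm_bound_ennreal)
  qed (simp add: not_integrable_integral_eq)
  from power_mono[OF this, of 2]
  show "ennreal ((norm (\<integral>z. K z * u z x \<partial>lborel))\<^sup>2) \<le> (\<integral>\<^sup>+z. ennreal (norm (K z * u z x)) \<partial>lborel)\<^sup>2"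
    by (simp add: ennreal_power)
qed

definition conv :: "(real^2 \<Rightarrow> cl2) \<Rightarrow> (real^2 \<Rightarrow> cl2) \<Rightarrow> real^2 \<Rightarrow> cl2" where
  "conv K f x = (\<integral>z. K z * f (x - z) \<partial>lborel)"

lemma conv_reflect: "conv K f x = (\<integral>y. K (x - y) * f y \<partial>lborel)"
  unfolding conv_def using integral_reflect[of "\<lambda>z. K z * f (x - z)" x] by simp

lemma borel_measurable_conv:
  assumes [measurable]: "K \<in> borel_measurable borel" "f \<in> borel_measurable borel"
  shows "conv K f \<in> borel_measurable borel"
  unfolding conv_def by measurable

lemma nn_integral_shift:
  fixes f :: "real^2 \<Rightarrow> cl2"
  assumes "square_integrable f"
  shows "(\<integral>\<^sup>+x. ennreal ((norm (f (x - h)))\<^sup>2) \<partial>lborel) = ennreal ((norm (abs_l2 f))\<^sup>2)"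
  using nn_integral_norm_abs_l2[OF square_integrable_translate[OF assms], of h] norm_l2_shift[of h "abs_l2 f"]
  by (simp add: l2_shift_abs assms)

lemma
  assumes K: "integrable lborel K" and f: "square_integrable f"
  shows square_integrable_conv: "square_integrable (conv K f)"
    and norm_conv_le: "norm (abs_l2 (conv K f)) \<le> 4 * (\<integral>z. norm (K z) \<partial>lborel) * norm (abs_l2 f)"
    and AE_integrable_conv: "AE x in lborel. integrable lborel (\<lambda>z. K z * f (x - z))"
proof -
  have [measurable]: "K \<in> borel_measurable borel" "f \<in> borel_measurable borel"
    using K square_integrableD(1)[OF f] by auto
  have m: "(\<lambda>(z, x). f (x - z)) \<in> borel_measurable borel"
    by (simp add: borel_prod[symmetric])
  let ?N = "\<integral>z. norm (K z) \<partial>lborel"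
  have K1: "(\<integral>\<^sup>+z. ennreal (norm (K z)) \<partial>lborel) = ennreal ?N"
    using K by (intro nn_integral_eq_integral) auto
  have N0: "0 \<le> ?N" by simp
  have eq: "16 * ennreal ?N * (\<integral>\<^sup>+z. ennreal (norm (K z)) * (\<integral>\<^sup>+x. ennreal ((norm (f (x - z)))\<^sup>2) \<partial>lborel) \<partial>lborel)
    = ennreal ((4 * ?N * norm (abs_l2 f))\<^sup>2)"
  proof -
    have "(\<integral>\<^sup>+z. ennreal (norm (K z)) * ennreal ((norm (abs_l2 f))\<^sup>2) \<partial>lborel) = ennreal ?N * ennreal ((norm (abs_l2 f))\<^sup>2)"
      unfolding K1[symmetric] by (rule nn_integral_multc) simp
    moreover have "(4 * ?N * norm (abs_l2 f))\<^sup>2 = 16 * ?N * (?N * (norm (abs_l2 f))\<^sup>2)"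
      by (simp add: power2_eq_square)
    ultimately show ?thesis
      unfolding nn_integral_shift[OF f] using N0 by (simp only: ennreal_mult ennreal_numeral) (simp add: ennreal_mult)
  qed
  have *: "(\<integral>\<^sup>+x. ennreal ((norm (conv K f x))\<^sup>2) \<partial>lborel) \<le> ennreal ((4 * ?N * norm (abs_l2 f))\<^sup>2)"
    using superposition_bound'[OF K m] unfolding eq conv_def .
  show sq: "square_integrable (conv K f)"
    unfolding square_integrable_iff_nn infinity_ennreal_def
    by (intro conjI borel_measurable_conv le_less_trans[OF * ennreal_less_top]) fact+
  show "norm (abs_l2 (conv K f)) \<le> 4 * ?N * norm (abs_l2 f)"
  proof (rule power2_le_imp_le)
    show "(norm (abs_l2 (conv K f)))\<^sup>2 \<le> (4 * ?N * norm (abs_l2 f))\<^sup>2"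
      using * unfolding nn_integral_norm_abs_l2[OF sq] by (subst (asm) ennreal_le_iff) auto
    show "0 \<le> 4 * ?N * norm (abs_l2 f)"
      using N0 by (intro mult_nonneg_nonneg) auto
  qed
  have "AE x in lborel. (\<integral>\<^sup>+z. ennreal (norm (K z * f (x - z))) \<partial>lborel)\<^sup>2 \<noteq> \<infinity>"
  proof (rule nn_integral_PInf_AE)
    show "(\<integral>\<^sup>+x. (\<integral>\<^sup>+z. ennreal (norm (K z * f (x - z))) \<partial>lborel)\<^sup>2 \<partial>lborel) \<noteq> \<infinity>"
      using superposition_bound[OF K m] unfolding eq by (auto simp: top_unique)
  qed measurable
  then show "AE x in lborel. integrable lborel (\<lambda>z. K z * f (x - z))"
    by eventually_elim (auto simp: integrable_iff_bounded less_top power_eq_top_ennreal)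
qed

definition dilate :: "(real^2 \<Rightarrow> cl2) \<Rightarrow> real \<Rightarrow> real^2 \<Rightarrow> cl2" where
  "dilate K \<epsilon> z = K (z /\<^sub>R \<epsilon>) /\<^sub>R \<epsilon>\<^sup>2"

lemma integrable_dilate:
  assumes "integrable lborel K" "\<epsilon> > 0"
  shows "integrable lborel (dilate K \<epsilon>)"
  using integrable_affine[of "inverse \<epsilon>" K 0] assms unfolding dilate_def by auto

lemma conv_dilate:
  assumes "\<epsilon> > 0"
  shows "conv (dilate K \<epsilon>) f x = (\<integral>z. K z * f (x - \<epsilon> *\<^sub>R z) \<partial>lborel)"
  using integral_affine[of "inverse \<epsilon>" "\<lambda>z. K z * f (x - \<epsilon> *\<^sub>R z)" 0] assms
  by (simp add: conv_def dilate_def power2_eq_square field_simps)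

lemma conv_dilate_tendsto:
  assumes K: "integrable lborel K" and f: "square_integrable f"
    and \<epsilon>: "\<And>n. \<epsilon> n > 0" "\<epsilon> \<longlonglongrightarrow> 0"
  shows "(\<lambda>n. abs_l2 (conv (dilate K (\<epsilon> n)) f)) \<longlonglongrightarrow> abs_l2 (\<lambda>x. (\<integral>z. K z \<partial>lborel) * f x)"
proof -
  have [measurable]: "K \<in> borel_measurable borel" "f \<in> borel_measurable borel"
    using K square_integrableD(1)[OF f] by auto
  let ?c = "\<integral>z. K z \<partial>lborel"
  have sqc: "square_integrable (\<lambda>x. ?c * f x)"
    by (rule square_integrable_bound[OF f, where c = "4 * norm ?c"]) (use norm_cl2_mult_le in auto)
  note sq = square_integrable_conv[OF integrable_dilate[OF K \<epsilon>(1)] f]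
  define F where "F = abs_l2 f"
  define N where "N n z = norm (l2_shift (\<epsilon> n *\<^sub>R z) F - F)" for n z
  have N_eq: "(\<integral>\<^sup>+x. ennreal ((norm (f (x - \<epsilon> n *\<^sub>R z) - f x))\<^sup>2) \<partial>lborel) = ennreal ((N n z)\<^sup>2)" for n z
    using nn_integral_norm_abs_l2[OF square_integrable_diff[OF square_integrable_translate[OF f] f], of "\<epsilon> n *\<^sub>R z"]
    by (simp add: N_def F_def l2_shift_abs abs_l2_diff square_integrable_translate f)
  have N_bound: "N n z \<le> 2 * norm F" for n z
    using norm_triangle_ineq4[of "l2_shift (\<epsilon> n *\<^sub>R z) F" F] by (simp add: N_def norm_l2_shift)
  have N0: "0 \<le> N n z" for n z by (simp add: N_def)
  have N3: "norm (K z) * (N n z)\<^sup>2 \<le> norm (K z) * (2 * norm F)\<^sup>2" for n z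
    using power_mono[OF N_bound N0, of n z 2] by (intro mult_left_mono) auto
  have m: "(\<lambda>(z, x). f (x - \<epsilon> n *\<^sub>R z) - f x) \<in> borel_measurable borel" for n
    by (simp add: borel_prod[symmetric])
  have "(\<lambda>z. enn2real (\<integral>\<^sup>+x. ennreal ((norm (f (x - \<epsilon> n *\<^sub>R z) - f x))\<^sup>2) \<partial>lborel)) \<in> borel_measurable borel" for n
    by measurable
  then have [measurable]: "(\<lambda>z. (N n z)\<^sup>2) \<in> borel_measurable borel" for n
    unfolding N_eq by simp
  have bound: "(norm (abs_l2 (conv (dilate K (\<epsilon> n)) f) - abs_l2 (\<lambda>x. ?c * f x)))\<^sup>2 \<le>
    16 * (\<integral>z. norm (K z) \<partial>lborel) * (\<integral>z. norm (K z) * (N n z)\<^sup>2 \<partial>lborel)" for n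
  proof -
    have int: "integrable lborel (\<lambda>z. norm (K z) * (N n z)\<^sup>2)"
    proof (rule Bochner_Integration.integrable_bound)
      show "integrable lborel (\<lambda>z. norm (K z) * (2 * norm F)\<^sup>2)" using K by auto
      show "AE z in lborel. norm (norm (K z) * (N n z)\<^sup>2) \<le> norm (norm (K z) * (2 * norm F)\<^sup>2)"
        using N3 by (intro AE_I2) (simp add: abs_mult)
    qed simp
    have "AE x in lborel. conv (dilate K (\<epsilon> n)) f x - ?c * f x = (\<integral>z. K z * (f (x - \<epsilon> n *\<^sub>R z) - f x) \<partial>lborel)"
      using AE_integrable_conv[OF integrable_dilate[OF K \<epsilon>(1)] f, of n]
    proof eventually_elim
      fix x assume i: "integrable lborel (\<lambda>z. dilate K (\<epsilon> n) z * f (x - z))"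
      have "integrable lborel (\<lambda>z. (\<epsilon> n)\<^sup>2 *\<^sub>R (dilate K (\<epsilon> n) (\<epsilon> n *\<^sub>R z) * f (x - \<epsilon> n *\<^sub>R z)))"
        using integrable_affine[OF _ i, of "\<epsilon> n" 0] \<epsilon>(1)[of n] by (intro integrable_scaleR_right) auto
      then have i1: "integrable lborel (\<lambda>z. K z * f (x - \<epsilon> n *\<^sub>R z))"
        using \<epsilon>(1)[of n] by (simp add: dilate_def)
      have i2: "integrable lborel (\<lambda>z. K z * f x)"
        using integrable_bounded_linear[OF bounded_linear_cl2_mult_left K] .
      have "conv (dilate K (\<epsilon> n)) f x - ?c * f x = (\<integral>z. K z * f (x - \<epsilon> n *\<^sub>R z) \<partial>lborel) - (\<integral>z. K z * f x \<partial>lborel)"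
        unfolding conv_dilate[OF \<epsilon>(1)] using integral_bounded_linear[OF bounded_linear_cl2_mult_left K] by simp
      also have "\<dots> = (\<integral>z. K z * f (x - \<epsilon> n *\<^sub>R z) - K z * f x \<partial>lborel)"
        using i1 i2 by simp
      finally show "conv (dilate K (\<epsilon> n)) f x - ?c * f x = (\<integral>z. K z * (f (x - \<epsilon> n *\<^sub>R z) - f x) \<partial>lborel)"
        by (simp add: right_diff_distrib)
    qed
    then have "(\<integral>\<^sup>+x. ennreal ((norm (conv (dilate K (\<epsilon> n)) f x - ?c * f x))\<^sup>2) \<partial>lborel)
        = (\<integral>\<^sup>+x. ennreal ((norm (\<integral>z. K z * (f (x - \<epsilon> n *\<^sub>R z) - f x) \<partial>lborel))\<^sup>2) \<partial>lborel)"
      by (intro nn_integral_cong_AE) auto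
    also have "\<dots> \<le> 16 * ennreal (\<integral>z. norm (K z) \<partial>lborel) *
      (\<integral>\<^sup>+z. ennreal (norm (K z)) * (\<integral>\<^sup>+x. ennreal ((norm (f (x - \<epsilon> n *\<^sub>R z) - f x))\<^sup>2) \<partial>lborel) \<partial>lborel)"
      by (rule superposition_bound'[OF K m])
    also have "\<dots> = 16 * ennreal (\<integral>z. norm (K z) \<partial>lborel) * ennreal (\<integral>z. norm (K z) * (N n z)\<^sup>2 \<partial>lborel)"
      unfolding N_eq nn_integral_eq_integral[OF int, symmetric, simplified]
      using int by (simp add: ennreal_mult nn_integral_eq_integral[symmetric])
    also have "\<dots> = ennreal (16 * (\<integral>z. norm (K z) \<partial>lborel) * (\<integral>z. norm (K z) * (N n z)\<^sup>2 \<partial>lborel))"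
      by (simp add: ennreal_mult)
    finally show ?thesis
      unfolding nn_integral_norm_abs_l2[OF square_integrable_diff[OF sq sqc]] abs_l2_diff[OF sq sqc]
      by (subst (asm) ennreal_le_iff) auto
  qed
  have "(\<lambda>n. \<integral>z. norm (K z) * (N n z)\<^sup>2 \<partial>lborel) \<longlonglongrightarrow> integral\<^sup>L (lborel :: (real^2) measure) (\<lambda>_. 0)"
  proof (rule integral_dominated_convergence[where w = "\<lambda>z. norm (K z) * (2 * norm F)\<^sup>2"])
    show "integrable lborel (\<lambda>z. norm (K z) * (2 * norm F)\<^sup>2)" using K by auto
    show "AE z in lborel. norm (norm (K z) * (N n z)\<^sup>2) \<le> norm (K z) * (2 * norm F)\<^sup>2" for n
      using N3 by (intro AE_I2) (simp add: abs_mult)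
    have "(\<lambda>n. norm (K z) * (N n z)\<^sup>2) \<longlonglongrightarrow> norm (K z) * (norm (F - F))\<^sup>2" for z
    proof -
      have "(\<lambda>n. \<epsilon> n *\<^sub>R z) \<longlonglongrightarrow> 0 *\<^sub>R z" by (intro tendsto_intros \<epsilon>)
      then show ?thesis unfolding N_def by (intro tendsto_intros l2_shift_tendsto) simp
    qed
    then show "AE z in lborel. (\<lambda>n. norm (K z) * (N n z)\<^sup>2) \<longlonglongrightarrow> 0" by simp
  qed simp_all
  then have "(\<lambda>n. 16 * (\<integral>z. norm (K z) \<partial>lborel) * (\<integral>z. norm (K z) * (N n z)\<^sup>2 \<partial>lborel)) \<longlonglongrightarrow> 0"
    by (intro tendsto_mult_right_zero) simp
  then have "(\<lambda>n. (norm (abs_l2 (conv (dilate K (\<epsilon> n)) f) - abs_l2 (\<lambda>x. ?c * f x)))\<^sup>2) \<longlonglongrightarrow> 0"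
    by (rule tendsto_sandwich[OF _ _ tendsto_const, rotated 2]) (use bound in auto)
  then show ?thesis
    by (simp add: tendsto_power2_zero_iff tendsto_norm_zero_iff LIM_zero_iff)
qed

section \<open>The Fourier transformation\<close>

definition fchar :: "real \<Rightarrow> cl2" where
  "fchar t = of_complex (cis (- (2 * pi * t)))"

lemma fourier_integral_fchar: "fourier_integral f \<xi> = (\<integral>x. fchar (x \<bullet> \<xi>) * f x \<partial>lborel)"
  by (simp add: fourier_integral_def fchar_def cis_conv_exp mult.assoc)

lemma fchar_add: "fchar (s + t) = fchar s * fchar t"
  by (simp add: fchar_def of_complex_hom(2)[symmetric] cis_mult algebra_simps)

lemma norm_fchar_mult [simp]: "norm (fchar t * x) = norm x"
  by (simp add: fchar_def norm_of_complex_mult)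

lemma inner_fchar: "inner (fchar t * x) y = inner x (fchar (- t) * y)"
  by (simp add: fchar_def inner_of_complex_mult cis_cnj)

lemma mult_fchar: "x * (fchar t * y) = fchar t * (x * y)"
  by (simp add: fchar_def mult_of_complex)

lemma borel_measurable_fchar [measurable]: "fchar \<in> borel_measurable borel"
  unfolding fchar_def cis_conv_exp by measurable

lemma integrable_fchar:
  assumes "integrable lborel f"
  shows "integrable lborel (\<lambda>x. fchar (x \<bullet> \<xi>) * f x)"
  using assms by (rule Bochner_Integration.integrable_bound) (use assms in auto)

lemma norm_fourier_integral_le:
  assumes "integrable lborel f"
  shows "norm (fourier_integral f \<xi>) \<le> (\<integral>x. norm (f x) \<partial>lborel)"
  unfolding fourier_integral_fchar using integral_norm_bound[of lborel "\<lambda>x. fchar (x \<bullet> \<xi>) * f x"] by simp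

lemma borel_measurable_fourier_integral:
  assumes "integrable lborel f"
  shows "fourier_integral f \<in> borel_measurable borel"
proof -
  have [measurable]: "f \<in> borel_measurable borel" using assms by auto
  show ?thesis unfolding fourier_integral_fchar[abs_def] by measurable
qed

lemma integrable_pair_bound:
  fixes h :: "'a::euclidean_space \<Rightarrow> 'b::euclidean_space \<Rightarrow> 'c::{banach,second_countable_topology}"
  assumes f: "integrable lborel f" and g: "integrable lborel g"
    and [measurable]: "case_prod h \<in> borel_measurable (lborel \<Otimes>\<^sub>M lborel)"
    and bound: "\<And>x y. norm (h x y) \<le> f x * g y"
  shows "integrable (lborel \<Otimes>\<^sub>M lborel) (case_prod h)"
proof -
  have [measurable]: "f \<in> borel_measurable borel" "g \<in> borel_measurable borel"
    using f g by auto
  have "integrable (lborel \<Otimes>\<^sub>M lborel) (\<lambda>(x, y). f x * g y)"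
  proof (rule lborel_pair.Fubini_integrable)
    show "integrable lborel (\<lambda>x. \<integral>y. norm (case (x, y) of (x, y) \<Rightarrow> f x * g y) \<partial>lborel)"
      using f by (simp add: abs_mult)
    show "AE x in lborel. integrable lborel (\<lambda>y. case (x, y) of (x, y) \<Rightarrow> f x * g y)"
      using g by simp
  qed measurable
  then show ?thesis
    by (rule Bochner_Integration.integrable_bound)
       (auto intro!: AE_I2 intro: order_trans[OF bound abs_ge_self])
qed

lemma fourier_integral_adjoint:
  assumes f: "integrable lborel f" and g: "integrable lborel g"
  shows "(\<integral>\<xi>. inner (fourier_integral f \<xi>) (g \<xi>) \<partial>lborel) = (\<integral>x. inner (f x) (fourier_integral g (- x)) \<partial>lborel)"
proof -
  have [measurable]: "f \<in> borel_measurable borel" "g \<in> borel_measurable borel"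
    using f g by auto
  have int: "integrable (lborel \<Otimes>\<^sub>M lborel) (\<lambda>(x, \<xi>). inner (fchar (x \<bullet> \<xi>) * f x) (g \<xi>))"
  proof (rule integrable_pair_bound)
    show "norm (inner (fchar (x \<bullet> \<xi>) * f x) (g \<xi>)) \<le> norm (f x) * norm (g \<xi>)" for x \<xi>
      using Cauchy_Schwarz_ineq2[of "fchar (x \<bullet> \<xi>) * f x" "g \<xi>"] by simp
  qed (use f g in auto)
  have "(\<integral>\<xi>. inner (fourier_integral f \<xi>) (g \<xi>) \<partial>lborel) = (\<integral>\<xi>. (\<integral>x. inner (fchar (x \<bullet> \<xi>) * f x) (g \<xi>) \<partial>lborel) \<partial>lborel)"
    unfolding fourier_integral_fchar
    by (intro Bochner_Integration.integral_cong refl integral_inner_left[symmetric] integrable_fchar f)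
  also have "\<dots> = (\<integral>x. (\<integral>\<xi>. inner (fchar (x \<bullet> \<xi>) * f x) (g \<xi>) \<partial>lborel) \<partial>lborel)"
    by (rule lborel_pair.Fubini_integral[OF int])
  also have "\<dots> = (\<integral>x. inner (f x) (fourier_integral g (- x)) \<partial>lborel)"
    unfolding fourier_integral_fchar using integrable_fchar[OF g, of "- x" for x]
    by (intro Bochner_Integration.integral_cong refl) (simp add: inner_fchar inner_commute[of "_ :: real^2"])
  finally show ?thesis .
qed

subsection \<open>Gaussians\<close>

lemma gaussian_1D:
  fixes s u :: real
  assumes s: "s > 0"
  shows "has_bochner_integral lborel (\<lambda>t. exp (- (pi * s * t\<^sup>2)) *\<^sub>R cis (- (2 * pi * (t * u))))
    (of_real (exp (- (pi * u\<^sup>2 / s)) / sqrt s))"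
proof -
  define c where "c = sqrt (2 * pi * s)"
  have c: "c > 0" "c\<^sup>2 = 2 * pi * s" using s by (auto simp: c_def)
  define v where "v = - (2 * pi * u) / c"
  let ?f = "\<lambda>y. std_normal_density y *\<^sub>R iexp (v * y)"
  have int: "integrable lborel ?f"
    by (rule Bochner_Integration.integrable_bound[OF integrable_normal_density[of 1 0]])
       (auto simp: norm_mult)
  have "(\<integral>y. ?f y \<partial>lborel) = char std_normal_distribution v"
    unfolding char_def by (subst integral_density) auto
  also have "\<dots> = of_real (exp (- v\<^sup>2 / 2))"
    by (simp add: char_std_normal_distribution)
  finally have I: "(\<integral>y. ?f y \<partial>lborel) = of_real (exp (- v\<^sup>2 / 2))" .
  have eq: "exp (- (pi * s * t\<^sup>2)) *\<^sub>R cis (- (2 * pi * (t * u))) = sqrt (2 * pi) *\<^sub>R ?f (0 + c *\<^sub>R t)" for t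
  proof -
    have "(c * t)\<^sup>2 / 2 = pi * s * t\<^sup>2" using c(2) by (simp add: power_mult_distrib)
    moreover have "v * (c * t) = - (2 * pi * (t * u))" using c by (simp add: v_def)
    ultimately show ?thesis
      by (simp add: std_normal_density_def cis_conv_exp)
  qed
  have "v\<^sup>2 / 2 = pi * u\<^sup>2 / s"
    using s unfolding v_def power_divide c(2) by (simp add: power2_eq_square)
  then have E: "exp (- v\<^sup>2 / 2) = exp (- (pi * u\<^sup>2 / s))" by simp
  have S: "sqrt (2 * pi) / c = 1 / sqrt s"
    using s by (simp add: c_def real_sqrt_mult)
  have I': "(\<integral>t. ?f (0 + c *\<^sub>R t) \<partial>lborel) = of_real (exp (- v\<^sup>2 / 2)) /\<^sub>R c"
    using integral_affine[of c ?f 0] I c(1) by simp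
  have "(\<integral>t. exp (- (pi * s * t\<^sup>2)) *\<^sub>R cis (- (2 * pi * (t * u))) \<partial>lborel)
      = sqrt (2 * pi) *\<^sub>R (\<integral>t. ?f (0 + c *\<^sub>R t) \<partial>lborel)"
    unfolding eq by (rule Bochner_Integration.integral_scaleR_right)
  also have "\<dots> = of_real (exp (- v\<^sup>2 / 2) * (sqrt (2 * pi) / c))"
  proof -
    have "b *\<^sub>R (of_real a /\<^sub>R d) = (of_real (a * (b / d)) :: complex)" for a b d :: real
      by (simp add: scaleR_conv_of_real divide_inverse)
    then show ?thesis unfolding I' .
  qed
  also have "\<dots> = of_real (exp (- (pi * u\<^sup>2 / s)) / sqrt s)"
    unfolding S E by simp
  finally have "(\<integral>t. exp (- (pi * s * t\<^sup>2)) *\<^sub>R cis (- (2 * pi * (t * u))) \<partial>lborel) = of_real (exp (- (pi * u\<^sup>2 / s)) / sqrt s)" .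
  moreover have "integrable lborel (\<lambda>t. exp (- (pi * s * t\<^sup>2)) *\<^sub>R cis (- (2 * pi * (t * u))))"
    unfolding eq by (intro integrable_scaleR_right integrable_affine int) (use c in auto)
  ultimately show ?thesis by (simp add: has_bochner_integral_iff)
qed

lemma gaussian_integrable_1D:
  assumes "s > 0"
  shows "integrable lborel (\<lambda>t. exp (- (pi * s * t\<^sup>2)))"
proof -
  have "integrable lborel (\<lambda>t. norm (exp (- (pi * s * t\<^sup>2)) *\<^sub>R cis (- (2 * pi * (t * 0)))))"
    using gaussian_1D[OF assms, of 0] by (intro integrable_norm) (auto simp: has_bochner_integral_iff)
  then show ?thesis by simp
qed

lemma gaussian_moment_integrable_1D:
  assumes s: "s > 0"
  shows "integrable lborel (\<lambda>t. \<bar>t\<bar> * exp (- (pi * s * t\<^sup>2)))"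
proof (rule Bochner_Integration.integrable_bound)
  show "integrable lborel (\<lambda>t. (1 / s + 1) * exp (- (pi * (s / 2) * t\<^sup>2)))"
    using gaussian_integrable_1D[of "s/2"] s by auto
  show "AE t in lborel. norm (\<bar>t\<bar> * exp (- (pi * s * t\<^sup>2))) \<le> norm ((1 / s + 1) * exp (- (pi * (s / 2) * t\<^sup>2)))"
  proof (rule AE_I2)
    fix t :: real
    have "\<bar>t\<bar> \<le> 1 + t\<^sup>2"
      using sum_squares_bound[of 1 "\<bar>t\<bar>"] zero_le_power2[of t] by simp
    also have "t\<^sup>2 \<le> (1 / s) * (pi * (s / 2) * t\<^sup>2)"
    proof -
      have "2 * t\<^sup>2 \<le> pi * t\<^sup>2" using pi_ge_two by (intro mult_right_mono) auto
      then show ?thesis using s by simp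
    qed
    also have "1 + (1 / s) * (pi * (s / 2) * t\<^sup>2) \<le> (1 / s + 1) * (1 + pi * (s / 2) * t\<^sup>2)"
    proof -
      have "1 + a * Y \<le> (a + 1) * (1 + Y)" if "a \<ge> 0" "Y \<ge> 0" for a Y :: real
        using that by (simp add: algebra_simps)
      from this[of "1/s" "pi * (s / 2) * t\<^sup>2"] show ?thesis using s by simp
    qed
    also have "\<dots> \<le> (1 / s + 1) * exp (pi * (s / 2) * t\<^sup>2)"
      using s exp_ge_add_one_self[of "pi * (s / 2) * t\<^sup>2"] by (intro mult_left_mono) auto
    finally have "\<bar>t\<bar> * exp (- (pi * s * t\<^sup>2)) \<le> (1 / s + 1) * exp (pi * (s / 2) * t\<^sup>2) * exp (- (pi * s * t\<^sup>2))"
      by (intro mult_right_mono) auto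
    also have "\<dots> = (1 / s + 1) * exp (- (pi * (s / 2) * t\<^sup>2))"
      by (simp add: mult.assoc mult_exp_exp)
    finally show "norm (\<bar>t\<bar> * exp (- (pi * s * t\<^sup>2))) \<le> norm ((1 / s + 1) * exp (- (pi * (s / 2) * t\<^sup>2)))"
      using s by (simp add: abs_mult)
  qed
qed auto

text \<open>The first moment comes from integrating the derivative of the integrand of \<open>gaussian_1D\<close>.\<close>

lemma gaussian_moment_1D:
  fixes s u :: real
  assumes s: "s > 0"
  shows "has_bochner_integral lborel (\<lambda>t. (t * exp (- (pi * s * t\<^sup>2))) *\<^sub>R cis (- (2 * pi * (t * u))))
    (- \<i> * of_real (u / s * (exp (- (pi * u\<^sup>2 / s)) / sqrt s)))"
proof -
  let ?g = "\<lambda>t. exp (- (pi * s * t\<^sup>2)) *\<^sub>R cis (- (2 * pi * (t * u)))"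
  let ?m = "\<lambda>t. (t * exp (- (pi * s * t\<^sup>2))) *\<^sub>R cis (- (2 * pi * (t * u)))"
  have m: "integrable lborel ?m"
    by (rule Bochner_Integration.integrable_bound[OF gaussian_moment_integrable_1D[OF s]])
       (auto simp: abs_mult cis_conv_exp)
  have g: "integrable lborel ?g" "integral\<^sup>L lborel ?g = of_real (exp (- (pi * u\<^sup>2 / s)) / sqrt s)"
    using gaussian_1D[OF s, of u] by (auto simp: has_bochner_integral_iff)
  let ?d = "\<lambda>t. (- (2 * pi * s)) *\<^sub>R ?m t - (2 * pi * u) *\<^sub>R (\<i> * ?g t)"
  have d: "integrable lborel ?d"
    by (intro Bochner_Integration.integrable_diff integrable_scaleR_right integrable_mult_right m g(1))
  have deriv: "(?g has_vector_derivative ?d t) (at t)" for t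
  proof -
    have "((\<lambda>t. exp (- (pi * s * t\<^sup>2))) has_real_derivative (- (2 * pi * s * t) * exp (- (pi * s * t\<^sup>2)))) (at t)"
      by (auto intro!: derivative_eq_intros simp: power2_eq_square)
    moreover have "((\<lambda>t. cis (- (2 * pi * (t * u)))) has_vector_derivative (- (2 * pi * u)) *\<^sub>R (\<i> * cis (- (2 * pi * (t * u))))) (at t)"
    proof -
      have "((\<lambda>t. - (2 * pi * (t * u))) has_real_derivative (- (2 * pi * u))) (at t)"
        by (auto intro!: derivative_eq_intros)
      moreover have "(cis has_vector_derivative \<i> * cis x) (at x)" for x
        unfolding cis_conv_exp
        by (rule has_vector_derivative_real_field) (auto intro!: derivative_eq_intros)
      ultimately show ?thesis
        using vector_diff_chain_at[of "\<lambda>t. - (2 * pi * (t * u))" "- (2 * pi * u)" t cis "\<i> * cis (- (2 * pi * (t * u)))"]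
        by (simp add: o_def has_real_derivative_iff_has_vector_derivative)
    qed
    ultimately have "(?g has_vector_derivative
        exp (- (pi * s * t\<^sup>2)) *\<^sub>R ((- (2 * pi * u)) *\<^sub>R (\<i> * cis (- (2 * pi * (t * u))))) +
        (- (2 * pi * s * t) * exp (- (pi * s * t\<^sup>2))) *\<^sub>R cis (- (2 * pi * (t * u)))) (at t)"
      by (rule has_vector_derivative_scaleR)
    then show ?thesis
      by (rule has_vector_derivative_eq_rhs) (simp add: scaleR_conv_of_real algebra_simps)
  qed
  have lim: "(?g \<longlongrightarrow> 0) at_top" "(?g \<longlongrightarrow> 0) at_bot"
  proof -
    have 0: "((\<lambda>t::real. exp (- (pi * s * t\<^sup>2))) \<longlongrightarrow> 0) at_top" "((\<lambda>t::real. exp (- (pi * s * t\<^sup>2))) \<longlongrightarrow> 0) at_bot"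
      using s by real_asymp+
    show "(?g \<longlongrightarrow> 0) at_top" by (rule Lim_null_comparison[OF _ 0(1)]) simp
    show "(?g \<longlongrightarrow> 0) at_bot" by (rule Lim_null_comparison[OF _ 0(2)]) simp
  qed
  have "(LBINT t=-\<infinity>..\<infinity>. ?d t) = 0 - 0"
  proof (rule interval_integral_FTC_integrable[where F = ?g])
    show "isCont ?d t" for t
      unfolding cis_conv_exp by (intro continuous_intros)
    show "set_integrable lborel (einterval (-\<infinity>) \<infinity>) ?d"
      using d by (simp add: set_integrable_def)
    show "((?g \<circ> real_of_ereal) \<longlongrightarrow> 0) (at_right (- \<infinity>))" "((?g \<circ> real_of_ereal) \<longlongrightarrow> 0) (at_left \<infinity>)"
      using lim by (simp_all add: ereal_tendsto_simps)
  qed (use deriv in auto)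
  then have z: "integral\<^sup>L lborel ?d = 0"
    by (simp add: interval_lebesgue_integral_def set_lebesgue_integral_def)
  have e: "integral\<^sup>L lborel ?d =
      (- (2 * pi * s)) *\<^sub>R integral\<^sup>L lborel ?m - (2 * pi * u) *\<^sub>R (\<i> * integral\<^sup>L lborel ?g)"
  proof -
    have "integral\<^sup>L lborel ?d = (\<integral>t. (- (2 * pi * s)) *\<^sub>R ?m t \<partial>lborel) - (\<integral>t. (2 * pi * u) *\<^sub>R (\<i> * ?g t) \<partial>lborel)"
      by (intro Bochner_Integration.integral_diff integrable_scaleR_right integrable_mult_right m g(1))
    then show ?thesis
      unfolding Bochner_Integration.integral_scaleR_right integral_mult_right_zero .
  qed
  have i: "M = - (\<i> * G) * of_real (u / s)"
    if "(- (2 * pi * s)) *\<^sub>R M - (2 * pi * u) *\<^sub>R (\<i> * G) = 0" for M G :: complex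
  proof -
    have "of_real (2 * pi) * (of_real s * M + of_real u * (\<i> * G)) = 0"
      using that by (simp add: scaleR_conv_of_real algebra_simps add_eq_0_iff)
    then have "of_real s * M + of_real u * (\<i> * G) = 0"
      unfolding mult_eq_0_iff by simp
    then have "of_real s * M = - (of_real u * (\<i> * G))"
      by (simp add: add_eq_0_iff2)
    then show ?thesis using s by (simp add: field_simps)
  qed
  have "integral\<^sup>L lborel ?m = - (\<i> * integral\<^sup>L lborel ?g) * of_real (u / s)"
    by (rule i, rule trans[OF e[symmetric] z])
  then show ?thesis
    using m unfolding has_bochner_integral_iff g(2) by (simp add: mult_ac)
qed

lemma borel_measurable_vector_2:
  "(\<lambda>(a, b). vector [a, b] :: real^2) \<in> (lborel \<Otimes>\<^sub>M lborel) \<rightarrow>\<^sub>M borel"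
proof -
  have "(\<lambda>(a, b). vector [a, b] :: real^2) = (\<lambda>p. fst p *\<^sub>R axis 1 1 + snd p *\<^sub>R axis 2 1)"
    by (auto simp: fun_eq_iff vec_eq_iff forall_2 vector_2 axis_def)
  then show ?thesis by simp
qed

lemma lborel_eq_distr_pair:
  "(lborel :: (real^2) measure) = distr (lborel \<Otimes>\<^sub>M lborel) borel (\<lambda>(a, b). vector [a, b])"
proof (rule lborel_eqI)
  note [measurable] = borel_measurable_vector_2
  fix l u :: "real^2"
  assume *: "\<And>b. b \<in> Basis \<Longrightarrow> l \<bullet> b \<le> u \<bullet> b"
  have le: "l $ 1 \<le> u $ 1" "l $ 2 \<le> u $ 2"
    using *[of "axis 1 1"] *[of "axis 2 1"] by (auto simp: inner_axis axis_in_Basis_iff)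
  have "(\<lambda>(a, b). vector [a, b] :: real^2) -` box l u \<inter> space (lborel \<Otimes>\<^sub>M lborel) = {l $ 1<..<u $ 1} \<times> {l $ 2<..<u $ 2}"
    by (auto simp: space_pair_measure mem_box_cart forall_2 vector_2)
  then have "emeasure (distr (lborel \<Otimes>\<^sub>M lborel) borel (\<lambda>(a, b). vector [a, b])) (box l u)
      = emeasure (lborel \<Otimes>\<^sub>M lborel) ({l $ 1<..<u $ 1} \<times> {l $ 2<..<u $ 2})"
    by (subst emeasure_distr) auto
  also have "\<dots> = ennreal (u $ 1 - l $ 1) * ennreal (u $ 2 - l $ 2)"
    using le by (subst lborel.emeasure_pair_measure_Times) auto
  also have "\<dots> = ennreal ((u $ 1 - l $ 1) * (u $ 2 - l $ 2))"
    using le by (simp add: ennreal_mult)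
  also have "(u $ 1 - l $ 1) * (u $ 2 - l $ 2) = (\<Prod>b\<in>Basis. (u - l) \<bullet> b)"
  proof -
    have B: "(Basis :: (real^2) set) = {axis 1 1, axis 2 1}"
      by (auto simp: Basis_vec_def UNIV_2)
    have "axis 1 1 \<noteq> (axis 2 1 :: real^2)" by (simp add: axis_eq_axis)
    then show ?thesis by (simp add: B inner_axis)
  qed
  finally show "emeasure (distr (lborel \<Otimes>\<^sub>M lborel) borel (\<lambda>(a, b). vector [a, b])) (box l u) = (\<Prod>b\<in>Basis. (u - l) \<bullet> b)" .
qed simp

lemma has_bochner_integral_product_2D:
  fixes \<phi> \<psi> :: "real \<Rightarrow> complex"
  assumes \<phi>: "has_bochner_integral lborel \<phi> I" and \<psi>: "has_bochner_integral lborel \<psi> J"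
  shows "has_bochner_integral lborel (\<lambda>x :: real^2. \<phi> (x $ 1) * \<psi> (x $ 2)) (I * J)"
proof -
  have int: "integrable lborel \<phi>" "integrable lborel \<psi>" "integral\<^sup>L lborel \<phi> = I" "integral\<^sup>L lborel \<psi> = J"
    using assms by (auto simp: has_bochner_integral_iff)
  have [measurable]: "\<phi> \<in> borel_measurable borel" "\<psi> \<in> borel_measurable borel"
    using int by auto
  note v = borel_measurable_vector_2
  have pair: "integrable (lborel \<Otimes>\<^sub>M lborel) (\<lambda>(a, b). \<phi> a * \<psi> b)"
    by (rule integrable_pair_bound[of "\<lambda>a. norm (\<phi> a)" "\<lambda>b. norm (\<psi> b)"])
       (use int in \<open>auto simp: norm_mult\<close>)
  have "has_bochner_integral (lborel \<Otimes>\<^sub>M lborel) (\<lambda>(a, b). \<phi> a * \<psi> b) (I * J)"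
    using lborel_pair.integral_fst[OF pair] pair int by (simp add: has_bochner_integral_iff)
  then have "has_bochner_integral (distr (lborel \<Otimes>\<^sub>M lborel) borel (\<lambda>(a, b). vector [a, b])) (\<lambda>x :: real^2. \<phi> (x $ 1) * \<psi> (x $ 2)) (I * J)"
    by (intro has_bochner_integral_distr[OF _ v]) (auto simp: case_prod_unfold vector_2)
  then show ?thesis by (simp add: lborel_eq_distr_pair)
qed

definition gauss :: "real \<Rightarrow> real^2 \<Rightarrow> real" where
  "gauss s x = exp (- (pi * s * (norm x)\<^sup>2))"

lemma norm_sq_2D: "(norm x)\<^sup>2 = (x $ 1)\<^sup>2 + (x $ 2)\<^sup>2" for x :: "real^2"
  by (simp add: norm_vec_def L2_set_def UNIV_2)

lemma inner_2D: "x \<bullet> y = x $ 1 * y $ 1 + x $ 2 * y $ 2" for x y :: "real^2"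
  by (simp add: inner_vec_def UNIV_2)

lemma borel_measurable_gauss [measurable]: "gauss s \<in> borel_measurable borel"
  unfolding gauss_def by measurable

lemma gauss_pos [simp]: "gauss s x > 0" "gauss s x \<ge> 0"
  by (simp_all add: gauss_def)

lemma gauss_fourier_complex:
  assumes s: "s > 0"
  shows "has_bochner_integral lborel (\<lambda>x. gauss s x *\<^sub>R cis (- (2 * pi * (x \<bullet> \<xi>)))) (of_real (gauss (1 / s) \<xi> / s))"
proof -
  have eq: "(exp (- (pi * s * (x $ 1)\<^sup>2)) *\<^sub>R cis (- (2 * pi * (x $ 1 * \<xi> $ 1)))) *
      (exp (- (pi * s * (x $ 2)\<^sup>2)) *\<^sub>R cis (- (2 * pi * (x $ 2 * \<xi> $ 2)))) = gauss s x *\<^sub>R cis (- (2 * pi * (x \<bullet> \<xi>)))" for x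
    by (simp add: gauss_def norm_sq_2D inner_2D cis_mult mult_exp_exp) (simp add: algebra_simps)
  have eq2: "of_real (exp (- (pi * (\<xi> $ 1)\<^sup>2 / s)) / sqrt s) * of_real (exp (- (pi * (\<xi> $ 2)\<^sup>2 / s)) / sqrt s)
     = (of_real (gauss (1 / s) \<xi> / s) :: complex)"
    using s by (simp add: gauss_def norm_sq_2D mult_exp_exp flip: of_real_mult exp_add) (simp add: algebra_simps add_divide_distrib)
  show ?thesis
    using has_bochner_integral_product_2D[OF gaussian_1D[OF s, of "\<xi> $ 1"] gaussian_1D[OF s, of "\<xi> $ 2"]]
    unfolding eq eq2 .
qed

lemma gauss_moment_fourier_complex:
  assumes s: "s > 0"
  shows "has_bochner_integral lborel (\<lambda>x. (x $ 1 * gauss s x) *\<^sub>R cis (- (2 * pi * (x \<bullet> \<xi>)))) (- \<i> * of_real (\<xi> $ 1 * gauss (1 / s) \<xi> / s\<^sup>2))" (is ?A)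
    and "has_bochner_integral lborel (\<lambda>x. (x $ 2 * gauss s x) *\<^sub>R cis (- (2 * pi * (x \<bullet> \<xi>)))) (- \<i> * of_real (\<xi> $ 2 * gauss (1 / s) \<xi> / s\<^sup>2))" (is ?B)
proof -
  have eq1: "((x $ 1 * exp (- (pi * s * (x $ 1)\<^sup>2))) *\<^sub>R cis (- (2 * pi * (x $ 1 * \<xi> $ 1)))) *
      (exp (- (pi * s * (x $ 2)\<^sup>2)) *\<^sub>R cis (- (2 * pi * (x $ 2 * \<xi> $ 2)))) = (x $ 1 * gauss s x) *\<^sub>R cis (- (2 * pi * (x \<bullet> \<xi>)))" for x
    by (simp add: gauss_def norm_sq_2D inner_2D cis_mult mult_exp_exp) (simp add: algebra_simps mult_exp_exp)
  have eq2: "(exp (- (pi * s * (x $ 1)\<^sup>2)) *\<^sub>R cis (- (2 * pi * (x $ 1 * \<xi> $ 1)))) *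
      ((x $ 2 * exp (- (pi * s * (x $ 2)\<^sup>2))) *\<^sub>R cis (- (2 * pi * (x $ 2 * \<xi> $ 2)))) = (x $ 2 * gauss s x) *\<^sub>R cis (- (2 * pi * (x \<bullet> \<xi>)))" for x
    by (simp add: gauss_def norm_sq_2D inner_2D cis_mult mult_exp_exp) (simp add: algebra_simps mult_exp_exp)
  have E: "exp (- (pi * (\<xi> $ 1)\<^sup>2 / s)) / sqrt s * (exp (- (pi * (\<xi> $ 2)\<^sup>2 / s)) / sqrt s) = gauss (1 / s) \<xi> / s"
    using s by (simp add: gauss_def norm_sq_2D flip: exp_add) (simp add: algebra_simps add_divide_distrib)
  have eq3: "- \<i> * of_real (\<xi> $ 1 / s * (exp (- (pi * (\<xi> $ 1)\<^sup>2 / s)) / sqrt s)) * of_real (exp (- (pi * (\<xi> $ 2)\<^sup>2 / s)) / sqrt s)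
    = - \<i> * of_real (\<xi> $ 1 * gauss (1 / s) \<xi> / s\<^sup>2)"
  proof -
    have "\<xi> $ 1 / s * (exp (- (pi * (\<xi> $ 1)\<^sup>2 / s)) / sqrt s) * (exp (- (pi * (\<xi> $ 2)\<^sup>2 / s)) / sqrt s) = \<xi> $ 1 * gauss (1 / s) \<xi> / s\<^sup>2"
      unfolding mult.assoc E by (simp add: power2_eq_square)
    then show ?thesis unfolding mult.assoc of_real_mult[symmetric] by simp
  qed
  have eq4: "of_real (exp (- (pi * (\<xi> $ 1)\<^sup>2 / s)) / sqrt s) * (- \<i> * of_real (\<xi> $ 2 / s * (exp (- (pi * (\<xi> $ 2)\<^sup>2 / s)) / sqrt s)))
    = - \<i> * of_real (\<xi> $ 2 * gauss (1 / s) \<xi> / s\<^sup>2)"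
  proof -
    have "exp (- (pi * (\<xi> $ 1)\<^sup>2 / s)) / sqrt s * (\<xi> $ 2 / s * (exp (- (pi * (\<xi> $ 2)\<^sup>2 / s)) / sqrt s)) = \<xi> $ 2 / s * (gauss (1 / s) \<xi> / s)"
      unfolding E[symmetric] by (simp only: mult_ac)
    also have "\<dots> = \<xi> $ 2 * gauss (1 / s) \<xi> / s\<^sup>2" by (simp add: power2_eq_square)
    finally show ?thesis by (metis (no_types, lifting) mult.left_commute of_real_mult)
  qed
  show ?A
    using has_bochner_integral_product_2D[OF gaussian_moment_1D[OF s, of "\<xi> $ 1"] gaussian_1D[OF s, of "\<xi> $ 2"]]
    unfolding eq1 eq3 .
  show ?B
    using has_bochner_integral_product_2D[OF gaussian_1D[OF s, of "\<xi> $ 1"] gaussian_moment_1D[OF s, of "\<xi> $ 2"]]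
    unfolding eq2 eq4 .
qed

lemma gauss_fourier:
  assumes s: "s > 0"
  shows "integrable lborel (\<lambda>x. gauss s x *\<^sub>R fchar (x \<bullet> \<xi>))"
    and "(\<integral>x. gauss s x *\<^sub>R fchar (x \<bullet> \<xi>) \<partial>lborel) = of_real (gauss (1 / s) \<xi> / s)"
proof -
  have eq: "gauss s x *\<^sub>R fchar (x \<bullet> \<xi>) = of_complex (gauss s x *\<^sub>R cis (- (2 * pi * (x \<bullet> \<xi>))))" for x
    by (simp add: fchar_def of_complex_scaleR)
  have *: "integrable lborel (\<lambda>x. gauss s x *\<^sub>R cis (- (2 * pi * (x \<bullet> \<xi>))))"
    "(\<integral>x. gauss s x *\<^sub>R cis (- (2 * pi * (x \<bullet> \<xi>))) \<partial>lborel) = of_real (gauss (1 / s) \<xi> / s)"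
    using gauss_fourier_complex[OF s, of \<xi>] by (auto simp only: has_bochner_integral_iff)
  show "integrable lborel (\<lambda>x. gauss s x *\<^sub>R fchar (x \<bullet> \<xi>))"
    unfolding eq by (rule integrable_bounded_linear[OF bounded_linear_of_complex *(1)])
  show "(\<integral>x. gauss s x *\<^sub>R fchar (x \<bullet> \<xi>) \<partial>lborel) = of_real (gauss (1 / s) \<xi> / s)"
    unfolding eq integral_bounded_linear[OF bounded_linear_of_complex *(1)] *(2) by (simp only: of_complex_simps)
qed

lemma gauss_integrable:
  assumes "s > 0"
  shows "integrable lborel (gauss s)"
proof -
  have "integrable lborel (\<lambda>x. norm (gauss s x *\<^sub>R fchar (x \<bullet> 0)))"
    by (intro integrable_norm gauss_fourier(1) assms)
  then show ?thesis
    by (simp add: fchar_def)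
qed

lemma integral_gauss_1: "(\<integral>z. of_real (gauss 1 z) \<partial>lborel) = (1 :: cl2)"
proof -
  have "fchar 0 = 1" by (simp add: fchar_def)
  then show ?thesis
    using gauss_fourier(2)[of 1 0] by (simp add: of_real_def gauss_def)
qed

lemma integrable_gauss_cl2: "s > 0 \<Longrightarrow> integrable lborel (\<lambda>z. of_real (gauss s z) :: cl2)"
  unfolding of_real_def by (intro integrable_scaleR_left) (rule gauss_integrable)

lemma fourier_gauss_inversion:
  assumes f: "integrable lborel f" and \<epsilon>: "\<epsilon> > 0"
  shows "fourier_integral (\<lambda>\<xi>. gauss (\<epsilon>\<^sup>2) \<xi> *\<^sub>R fourier_integral f \<xi>) (- x) =
    conv (dilate (\<lambda>z. of_real (gauss 1 z)) \<epsilon>) f x"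
proof -
  have [measurable]: "f \<in> borel_measurable borel" using f by auto
  have \<epsilon>2: "\<epsilon>\<^sup>2 > 0" using \<epsilon> by simp
  let ?h = "\<lambda>\<xi> y. (gauss (\<epsilon>\<^sup>2) \<xi> *\<^sub>R fchar (\<xi> \<bullet> (y - x))) * f y"
  have nh: "norm (?h \<xi> y) = gauss (\<epsilon>\<^sup>2) \<xi> * norm (f y)" for \<xi> y
    by (simp add: less_imp_le)
  have int: "integrable (lborel \<Otimes>\<^sub>M lborel) (\<lambda>(y, \<xi>). ?h \<xi> y)"
    by (rule integrable_pair_bound[of "\<lambda>y. norm (f y)" "gauss (\<epsilon>\<^sup>2)"])
       (use f gauss_integrable[OF \<epsilon>2] in \<open>auto simp: nh simp del: mult_scaleR_left\<close>)
  have "fourier_integral (\<lambda>\<xi>. gauss (\<epsilon>\<^sup>2) \<xi> *\<^sub>R fourier_integral f \<xi>) (- x) = (\<integral>\<xi>. (\<integral>y. ?h \<xi> y \<partial>lborel) \<partial>lborel)"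
    unfolding fourier_integral_fchar
  proof (intro Bochner_Integration.integral_cong refl)
    fix \<xi>
    have "fchar (\<xi> \<bullet> - x) * (gauss (\<epsilon>\<^sup>2) \<xi> *\<^sub>R (\<integral>y. fchar (y \<bullet> \<xi>) * f y \<partial>lborel))
      = gauss (\<epsilon>\<^sup>2) \<xi> *\<^sub>R (\<integral>y. fchar (\<xi> \<bullet> - x) * (fchar (y \<bullet> \<xi>) * f y) \<partial>lborel)"
      using integral_bounded_linear[OF bounded_linear_cl2_mult_right integrable_fchar[OF f, of \<xi>], of "fchar (\<xi> \<bullet> - x)"]
      by simp
    also have "\<dots> = (\<integral>y. ?h \<xi> y \<partial>lborel)"
      by (simp add: mult.assoc[symmetric] fchar_add[symmetric] inner_diff inner_commute[of _ \<xi>] algebra_simps)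
    finally show "fchar (\<xi> \<bullet> - x) * (gauss (\<epsilon>\<^sup>2) \<xi> *\<^sub>R (\<integral>y. fchar (y \<bullet> \<xi>) * f y \<partial>lborel)) = (\<integral>y. ?h \<xi> y \<partial>lborel)" .
  qed
  also have "\<dots> = (\<integral>y. (\<integral>\<xi>. ?h \<xi> y \<partial>lborel) \<partial>lborel)"
    by (rule lborel_pair.Fubini_integral[OF int])
  also have "\<dots> = (\<integral>y. dilate (\<lambda>z. of_real (gauss 1 z)) \<epsilon> (x - y) * f y \<partial>lborel)"
  proof (intro Bochner_Integration.integral_cong refl)
    fix y
    have "(\<integral>\<xi>. ?h \<xi> y \<partial>lborel) = of_real (gauss (1 / \<epsilon>\<^sup>2) (y - x) / \<epsilon>\<^sup>2) * f y"
      using integral_bounded_linear[OF bounded_linear_cl2_mult_left gauss_fourier(1)[OF \<epsilon>2, of "y - x"], of "f y"]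
      unfolding gauss_fourier(2)[OF \<epsilon>2] .
    also have "gauss (1 / \<epsilon>\<^sup>2) (y - x) = gauss 1 ((x - y) /\<^sub>R \<epsilon>)"
      using \<epsilon> by (simp add: gauss_def norm_minus_commute[of y x] power_mult_distrib power_inverse divide_inverse mult_ac)
    finally show "(\<integral>\<xi>. ?h \<xi> y \<partial>lborel) = dilate (\<lambda>z. of_real (gauss 1 z)) \<epsilon> (x - y) * f y"
      unfolding dilate_def by (simp add: of_real_def divide_inverse mult.commute)
  qed
  also have "\<dots> = conv (dilate (\<lambda>z. of_real (gauss 1 z)) \<epsilon>) f x"
    by (rule conv_reflect[symmetric])
  finally show ?thesis .
qed

theorem plancherel:
  assumes f: "integrable lborel f" "square_integrable f"
  shows "square_integrable (fourier_integral f)"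
    and "norm (abs_l2 (fourier_integral f)) = norm (abs_l2 f)"
proof -
  have [measurable]: "fourier_integral f \<in> borel_measurable borel" "f \<in> borel_measurable borel"
    using borel_measurable_fourier_integral[OF f(1)] f(1) by auto
  define \<epsilon> where "\<epsilon> n = 1 / real (Suc n)" for n
  have \<epsilon>: "\<epsilon> n > 0" for n by (simp add: \<epsilon>_def)
  have \<epsilon>0: "\<epsilon> \<longlonglongrightarrow> 0" unfolding \<epsilon>_def using LIMSEQ_inverse_real_of_nat by (simp add: inverse_eq_divide)
  let ?G = "\<lambda>z. of_real (gauss 1 z) :: cl2"
  have G: "integrable lborel ?G" by (rule integrable_gauss_cl2) simp
  have wF: "integrable lborel (\<lambda>\<xi>. gauss ((\<epsilon> n)\<^sup>2) \<xi> *\<^sub>R fourier_integral f \<xi>)" for n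
  proof (rule Bochner_Integration.integrable_bound)
    show "integrable lborel (\<lambda>\<xi>. gauss ((\<epsilon> n)\<^sup>2) \<xi> * (\<integral>x. norm (f x) \<partial>lborel))"
      using \<epsilon>[of n] by (intro integrable_mult_left gauss_integrable) auto
    show "AE \<xi> in lborel. norm (gauss ((\<epsilon> n)\<^sup>2) \<xi> *\<^sub>R fourier_integral f \<xi>) \<le> norm (gauss ((\<epsilon> n)\<^sup>2) \<xi> * (\<integral>x. norm (f x) \<partial>lborel))"
    proof (rule AE_I2)
      fix \<xi>
      have "gauss ((\<epsilon> n)\<^sup>2) \<xi> * norm (fourier_integral f \<xi>) \<le> gauss ((\<epsilon> n)\<^sup>2) \<xi> * (\<integral>x. norm (f x) \<partial>lborel)"
        by (intro mult_left_mono norm_fourier_integral_le f) simp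
      then show "norm (gauss ((\<epsilon> n)\<^sup>2) \<xi> *\<^sub>R fourier_integral f \<xi>) \<le> norm (gauss ((\<epsilon> n)\<^sup>2) \<xi> * (\<integral>x. norm (f x) \<partial>lborel))"
        by (simp add: abs_mult less_imp_le)
    qed
  qed measurable
  have I: "(\<integral>\<xi>. gauss ((\<epsilon> n)\<^sup>2) \<xi> * (norm (fourier_integral f \<xi>))\<^sup>2 \<partial>lborel) = inner (abs_l2 f) (abs_l2 (conv (dilate ?G (\<epsilon> n)) f))" for n
  proof -
    have "(\<integral>\<xi>. gauss ((\<epsilon> n)\<^sup>2) \<xi> * (norm (fourier_integral f \<xi>))\<^sup>2 \<partial>lborel)
        = (\<integral>\<xi>. inner (fourier_integral f \<xi>) (gauss ((\<epsilon> n)\<^sup>2) \<xi> *\<^sub>R fourier_integral f \<xi>) \<partial>lborel)"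
      by (simp add: power2_norm_eq_inner)
    also have "\<dots> = (\<integral>x. inner (f x) (fourier_integral (\<lambda>\<xi>. gauss ((\<epsilon> n)\<^sup>2) \<xi> *\<^sub>R fourier_integral f \<xi>) (- x)) \<partial>lborel)"
      by (rule fourier_integral_adjoint[OF f(1) wF])
    also have "\<dots> = (\<integral>x. inner (f x) (conv (dilate ?G (\<epsilon> n)) f x) \<partial>lborel)"
      by (simp only: fourier_gauss_inversion[OF f(1) \<epsilon>])
    also have "\<dots> = inner (abs_l2 f) (abs_l2 (conv (dilate ?G (\<epsilon> n)) f))"
      by (intro inner_abs_l2[symmetric] f square_integrable_conv integrable_dilate G \<epsilon>)
    finally show ?thesis .
  qed
  have "(\<lambda>n. abs_l2 (conv (dilate ?G (\<epsilon> n)) f)) \<longlonglongrightarrow> abs_l2 (\<lambda>x. (\<integral>z. ?G z \<partial>lborel) * f x)"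
    by (rule conv_dilate_tendsto[OF G f(2) \<epsilon> \<epsilon>0])
  then have "(\<lambda>n. abs_l2 (conv (dilate ?G (\<epsilon> n)) f)) \<longlonglongrightarrow> abs_l2 f"
    unfolding integral_gauss_1 by simp
  then have lim: "(\<lambda>n. \<integral>\<xi>. gauss ((\<epsilon> n)\<^sup>2) \<xi> * (norm (fourier_integral f \<xi>))\<^sup>2 \<partial>lborel) \<longlonglongrightarrow> inner (abs_l2 f) (abs_l2 f)"
    unfolding I by (intro tendsto_inner tendsto_const)
  have mono: "mono (\<lambda>n. gauss ((\<epsilon> n)\<^sup>2) \<xi> * (norm (fourier_integral f \<xi>))\<^sup>2)" for \<xi>
  proof (rule monoI, rule mult_right_mono)
    fix m n :: nat assume "m \<le> n"
    then have "(\<epsilon> n)\<^sup>2 \<le> (\<epsilon> m)\<^sup>2"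
      by (intro power_mono) (auto simp: \<epsilon>_def field_simps)
    then show "gauss ((\<epsilon> m)\<^sup>2) \<xi> \<le> gauss ((\<epsilon> n)\<^sup>2) \<xi>"
      by (simp add: gauss_def mult_right_mono)
  qed simp
  have ptw: "(\<lambda>n. gauss ((\<epsilon> n)\<^sup>2) \<xi> * (norm (fourier_integral f \<xi>))\<^sup>2) \<longlonglongrightarrow> (norm (fourier_integral f \<xi>))\<^sup>2" for \<xi>
  proof -
    have "(\<lambda>n. gauss ((\<epsilon> n)\<^sup>2) \<xi>) \<longlonglongrightarrow> exp (- (pi * 0\<^sup>2 * (norm \<xi>)\<^sup>2))"
      unfolding gauss_def by (intro tendsto_intros \<epsilon>0)
    from tendsto_mult[OF this tendsto_const[of "(norm (fourier_integral f \<xi>))\<^sup>2"]] show ?thesis by simp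
  qed
  have int: "integrable lborel (\<lambda>\<xi>. gauss ((\<epsilon> n)\<^sup>2) \<xi> * (norm (fourier_integral f \<xi>))\<^sup>2)" for n
  proof (rule Bochner_Integration.integrable_bound)
    show "integrable lborel (\<lambda>\<xi>. gauss ((\<epsilon> n)\<^sup>2) \<xi> * (\<integral>x. norm (f x) \<partial>lborel)\<^sup>2)"
      using \<epsilon>[of n] by (intro integrable_mult_left gauss_integrable) auto
    show "AE \<xi> in lborel. norm (gauss ((\<epsilon> n)\<^sup>2) \<xi> * (norm (fourier_integral f \<xi>))\<^sup>2) \<le> norm (gauss ((\<epsilon> n)\<^sup>2) \<xi> * (\<integral>x. norm (f x) \<partial>lborel)\<^sup>2)"
    proof (rule AE_I2)
      fix \<xi>
      have "gauss ((\<epsilon> n)\<^sup>2) \<xi> * (norm (fourier_integral f \<xi>))\<^sup>2 \<le> gauss ((\<epsilon> n)\<^sup>2) \<xi> * (\<integral>x. norm (f x) \<partial>lborel)\<^sup>2"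
        by (intro mult_left_mono power_mono norm_fourier_integral_le f) simp_all
      then show "norm (gauss ((\<epsilon> n)\<^sup>2) \<xi> * (norm (fourier_integral f \<xi>))\<^sup>2) \<le> norm (gauss ((\<epsilon> n)\<^sup>2) \<xi> * (\<integral>x. norm (f x) \<partial>lborel)\<^sup>2)"
        by (simp add: abs_mult less_imp_le)
    qed
  qed measurable
  note mc = integral_monotone_convergence_nonneg[OF int AE_I2[OF mono] _ AE_I2[OF ptw] lim]
  have F: "integrable lborel (\<lambda>\<xi>. (norm (fourier_integral f \<xi>))\<^sup>2)"
    "(\<integral>\<xi>. (norm (fourier_integral f \<xi>))\<^sup>2 \<partial>lborel) = inner (abs_l2 f) (abs_l2 f)"
    by (rule mc; simp)+
  show sq: "square_integrable (fourier_integral f)"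
    using F by (simp add: square_integrable_def)
  show "norm (abs_l2 (fourier_integral f)) = norm (abs_l2 f)"
  proof (rule power2_eq_imp_eq)
    show "(norm (abs_l2 (fourier_integral f)))\<^sup>2 = (norm (abs_l2 f))\<^sup>2"
      unfolding norm_abs_l2[OF sq] F(2) by (rule power2_norm_eq_inner[symmetric])
  qed simp_all
qed

lemma fourier_integral_diff:
  assumes "integrable lborel f" "integrable lborel g"
  shows "fourier_integral (\<lambda>x. f x - g x) = (\<lambda>\<xi>. fourier_integral f \<xi> - fourier_integral g \<xi>)"
  by (simp add: fun_eq_iff fourier_integral_fchar right_diff_distrib integrable_fchar assms)

lemma fourier_integral_add:
  assumes "integrable lborel f" "integrable lborel g"
  shows "fourier_integral (\<lambda>x. f x + g x) = (\<lambda>\<xi>. fourier_integral f \<xi> + fourier_integral g \<xi>)"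
  by (simp add: fun_eq_iff fourier_integral_fchar distrib_left integrable_fchar assms)

lemma fourier_integral_scaleC:
  assumes "integrable lborel f"
  shows "fourier_integral (\<lambda>x. of_complex c * f x) = (\<lambda>\<xi>. of_complex c * fourier_integral f \<xi>)"
  unfolding fun_eq_iff fourier_integral_fchar mult_of_complex[of "fchar _"]
  using integral_bounded_linear[OF bounded_linear_cl2_mult_right integrable_fchar[OF assms]] by blast

section \<open>Extension of the Fourier transformation\<close>

lemma l2_extension_eqI:
  assumes T: "\<And>F G. (F, G) \<in> T \<Longrightarrow> G = A F"
    and A: "continuous_on UNIV A"
    and dense: "closure (fst ` T) = UNIV"
  shows "l2_extension T = A"
proof
  fix F
  obtain X where X: "\<And>n. X n \<in> fst ` T" "X \<longlonglongrightarrow> F"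
    using dense closure_sequential[of F "fst ` T"] by auto
  have lim: "(\<lambda>n. A (X n)) \<longlonglongrightarrow> A F"
    using continuous_on_tendsto_compose[OF A X(2)] by simp
  have "(X n, A (X n)) \<in> T" for n
    using X(1)[of n] T by force
  then have 1: "(F, A F) \<in> closure T"
    unfolding closure_sequential using tendsto_Pair[OF X(2) lim]
    by (intro exI[of _ "\<lambda>n. (X n, A (X n))"]) auto
  have 2: "G = A F" if "(F, G) \<in> closure T" for G
  proof -
    obtain P where P: "\<And>n. P n \<in> T" "P \<longlonglongrightarrow> (F, G)"
      using \<open>(F, G) \<in> closure T\<close> unfolding closure_sequential by blast
    have "snd (P n) = A (fst (P n))" for n
      using T[of "fst (P n)" "snd (P n)"] P(1)[of n] by simp
    moreover have "(\<lambda>n. A (fst (P n))) \<longlonglongrightarrow> A F"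
      using continuous_on_tendsto_compose[OF A tendsto_fst[OF P(2)]] by simp
    ultimately show "G = A F"
      using LIMSEQ_unique tendsto_snd[OF P(2)] by fastforce
  qed
  show "l2_extension T F = A F"
    unfolding l2_extension_def by (rule the_equality, rule 1, rule 2)
qed

lemma integrable_indicator_bounded:
  fixes c :: cl2 and B :: "(real^2) set"
  assumes "bounded B" "open B"
  shows "integrable lborel (\<lambda>x. indicator B x *\<^sub>R c)"
  using assms emeasure_bounded_finite[of B] by (intro integrable_scaleR_left integrable_real_indicator) auto

lemma closure_of_subspace:
  fixes S :: "'a::real_normed_vector set"
  assumes S: "subspace S"
  shows "subspace (closure S)"
  unfolding subspace_def
proof (intro conjI ballI allI)
  show "0 \<in> closure S"
    using subspace_0[OF S] closure_subset by blast
  fix x c assume "x \<in> closure S"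
  then obtain X where X: "\<And>n. X n \<in> S" "X \<longlonglongrightarrow> x"
    unfolding closure_sequential by blast
  show "c *\<^sub>R x \<in> closure S"
    unfolding closure_sequential using subspace_scale[OF S X(1)]
    by (intro exI[of _ "\<lambda>n. c *\<^sub>R X n"] conjI allI tendsto_intros X)
  fix y assume "y \<in> closure S"
  then obtain Y where Y: "\<And>n. Y n \<in> S" "Y \<longlonglongrightarrow> y"
    unfolding closure_sequential by blast
  show "x + y \<in> closure S"
    unfolding closure_sequential using subspace_add[OF S X(1) Y(1)]
    by (intro exI[of _ "\<lambda>n. X n + Y n"] conjI allI tendsto_intros X Y)
qed

lemma dense_integrable:
  "closure {abs_l2 f | f. integrable lborel f \<and> square_integrable f} = UNIV"
proof -
  let ?D = "{abs_l2 f | f. integrable lborel f \<and> square_integrable f}"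
  have sub: "subspace ?D"
    unfolding subspace_def
  proof (safe)
    show "\<exists>f. 0 = abs_l2 f \<and> integrable lborel f \<and> square_integrable f"
      by (rule exI[of _ "\<lambda>_. 0"]) (simp add: abs_l2_0 square_integrable_0)
    fix f g :: "real^2 \<Rightarrow> cl2" and c :: real
    assume f: "integrable lborel f" "square_integrable f"
    show "\<exists>h. c *\<^sub>R abs_l2 f = abs_l2 h \<and> integrable lborel h \<and> square_integrable h"
      by (rule exI[of _ "\<lambda>x. c *\<^sub>R f x"]) (simp add: abs_l2_scaleR square_integrable_scaleR f)
    assume g: "integrable lborel g" "square_integrable g"
    show "\<exists>h. abs_l2 f + abs_l2 g = abs_l2 h \<and> integrable lborel h \<and> square_integrable h"
      by (rule exI[of _ "\<lambda>x. f x + g x"]) (simp add: abs_l2_add square_integrable_add f g)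
  qed
  have "F \<in> closure ?D" for F
  proof (rule l2_step_induct)
    show "closed (closure ?D)" "subspace (closure ?D)"
      using sub by (auto intro: closure_of_subspace)
    fix B :: "(real^2) set" and c :: cl2
    assume "bounded B" "open B"
    then show "abs_l2 (\<lambda>x. indicator B x *\<^sub>R c) \<in> closure ?D"
      using integrable_indicator_bounded[of B c] square_integrable_indicator_bounded[of B c]
      by (intro closure_subset[THEN subsetD]) blast
  qed
  then show ?thesis by blast
qed

lemma
  shows fourier_abs_l2: "integrable lborel f \<Longrightarrow> square_integrable f \<Longrightarrow> fourier (abs_l2 f) = abs_l2 (fourier_integral f)"
    and continuous_on_fourier: "continuous_on UNIV fourier"
proof -
  define T where "T = {(abs_l2 f, abs_l2 (fourier_integral f)) | f.
     integrable lborel f \<and> square_integrable f \<and> square_integrable (fourier_integral f)}"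
  let ?D = "{abs_l2 f | f. integrable lborel f \<and> square_integrable f}"
  have D: "fst ` T = ?D"
    unfolding T_def using plancherel(1) by force
  have iso: "norm (G - G') = norm (F - F')" if FG: "(F, G) \<in> T" "(F', G') \<in> T" for F G F' G'
  proof -
    obtain f g where f: "F = abs_l2 f" "G = abs_l2 (fourier_integral f)" "integrable lborel f" "square_integrable f"
      and g: "F' = abs_l2 g" "G' = abs_l2 (fourier_integral g)" "integrable lborel g" "square_integrable g"
      using FG unfolding T_def by auto
    have "G - G' = abs_l2 (fourier_integral (\<lambda>x. f x - g x))"
      using f g plancherel(1) by (simp add: abs_l2_diff[symmetric] fourier_integral_diff)
    also have "norm \<dots> = norm (abs_l2 (\<lambda>x. f x - g x))"
      using f g by (intro plancherel(2) square_integrable_diff) auto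
    finally show ?thesis using f g by (simp add: abs_l2_diff)
  qed
  define L where "L F = (SOME G. (F, G) \<in> T)" for F
  have L: "(F, L F) \<in> T" if "F \<in> ?D" for F
    unfolding L_def using that D by (intro someI_ex[of "\<lambda>G. (F, G) \<in> T"]) force
  have L_unique: "G = L F" if "(F, G) \<in> T" for F G
  proof -
    have "F \<in> ?D" using D that by force
    from iso[OF that L[OF this]] have "norm (G - L F) = 0"
      by (simp only: diff_self norm_zero)
    then show ?thesis
      by (simp only: norm_eq_zero right_minus_eq)
  qed
  have uc: "uniformly_continuous_on ?D L"
    unfolding uniformly_continuous_on_def
  proof (intro allI impI)
    fix e :: real assume "e > 0"
    have "dist (L F') (L F) < e" if "F \<in> ?D" "F' \<in> ?D" "dist F' F < e" for F F'
      using iso[OF L[OF that(2)] L[OF that(1)]] that(3) by (simp only: dist_norm)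
    then show "\<exists>d>0. \<forall>F\<in>?D. \<forall>F'\<in>?D. dist F' F < d \<longrightarrow> dist (L F') (L F) < e"
      using \<open>e > 0\<close> by blast
  qed
  obtain A where A: "uniformly_continuous_on UNIV A" "\<And>F. F \<in> ?D \<Longrightarrow> L F = A F"
  proof (rule uniformly_continuous_on_extension_on_closure[OF uc])
    fix A assume "uniformly_continuous_on (closure ?D) A" "\<And>F. F \<in> ?D \<Longrightarrow> L F = A F"
    then show thesis
      unfolding dense_integrable by (rule that)
  qed
  have "fourier = A"
    unfolding fourier_def T_def[symmetric]
  proof (rule l2_extension_eqI)
    show "G = A F" if "(F, G) \<in> T" for F G
    proof -
      have "F \<in> fst ` T" using imageI[OF that, of fst] by simp
      then have "F \<in> ?D" unfolding D .
      from A(2)[OF this] show ?thesis using L_unique[OF that] by (rule trans[rotated])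
    qed
    show "continuous_on UNIV A" using A(1) by (rule uniformly_continuous_imp_continuous)
    show "closure (fst ` T) = UNIV" unfolding D by (rule dense_integrable)
  qed
  show "continuous_on UNIV fourier"
    unfolding \<open>fourier = A\<close> by (rule uniformly_continuous_imp_continuous[OF A(1)])
  assume f: "integrable lborel f" "square_integrable f"
  have "(abs_l2 f, abs_l2 (fourier_integral f)) \<in> T"
    unfolding T_def using f plancherel(1)[OF f] by blast
  from L_unique[OF this] have "abs_l2 (fourier_integral f) = L (abs_l2 f)" .
  moreover have "abs_l2 f \<in> ?D"
    using f by blast
  from A(2)[OF this] have "L (abs_l2 f) = A (abs_l2 f)" .
  ultimately show "fourier (abs_l2 f) = abs_l2 (fourier_integral f)"
    unfolding \<open>fourier = A\<close> by simp
qed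

lemma fourier_tendsto: "X \<longlonglongrightarrow> F \<Longrightarrow> (\<lambda>n. fourier (X n)) \<longlonglongrightarrow> fourier F"
  using continuous_on_tendsto_compose[OF continuous_on_fourier] by auto

lemma integrable_approx:
  "\<exists>f. \<forall>n. integrable lborel (f n) \<and> square_integrable (f n) \<and> (\<lambda>n. abs_l2 (f n)) \<longlonglongrightarrow> F"
proof -
  obtain X where X: "\<And>n. X n \<in> {abs_l2 f | f. integrable lborel f \<and> square_integrable f}" "X \<longlonglongrightarrow> F"
    using dense_integrable closure_sequential[of F "{abs_l2 f | f. integrable lborel f \<and> square_integrable f}"] by auto
  then have "\<forall>n. \<exists>f. X n = abs_l2 f \<and> integrable lborel f \<and> square_integrable f" by auto
  from choice[OF this] obtain f where
    f: "\<forall>n. X n = abs_l2 (f n) \<and> integrable lborel (f n) \<and> square_integrable (f n)" ..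
  then have "X = (\<lambda>n. abs_l2 (f n))" by auto
  with f X(2) show ?thesis by (intro exI[of _ f]) simp
qed

lemma fourier_add: "fourier (F + G) = fourier F + fourier G"
proof -
  from integrable_approx[of F] obtain f where
    "\<forall>n. integrable lborel (f n) \<and> square_integrable (f n) \<and> (\<lambda>n. abs_l2 (f n)) \<longlonglongrightarrow> F" ..
  then have f: "integrable lborel (f n)" "square_integrable (f n)" "(\<lambda>n. abs_l2 (f n)) \<longlonglongrightarrow> F" for n
    by blast+
  from integrable_approx[of G] obtain g where
    "\<forall>n. integrable lborel (g n) \<and> square_integrable (g n) \<and> (\<lambda>n. abs_l2 (g n)) \<longlonglongrightarrow> G" ..
  then have g: "integrable lborel (g n)" "square_integrable (g n)" "(\<lambda>n. abs_l2 (g n)) \<longlonglongrightarrow> G" for n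
    by blast+
  have "fourier (abs_l2 (f n) + abs_l2 (g n)) = fourier (abs_l2 (f n)) + fourier (abs_l2 (g n))" for n
    using f g plancherel(1)
    by (simp add: abs_l2_add[symmetric] fourier_abs_l2 square_integrable_add fourier_integral_add)
  then show ?thesis
    using fourier_tendsto[OF tendsto_add[OF f(3) g(3)]] tendsto_add[OF fourier_tendsto[OF f(3)] fourier_tendsto[OF g(3)]]
    by (simp add: LIMSEQ_unique)
qed

lemma fourier_scaleC: "fourier (c *\<^sub>C F) = c *\<^sub>C fourier F"
proof -
  from integrable_approx[of F] obtain f where
    "\<forall>n. integrable lborel (f n) \<and> square_integrable (f n) \<and> (\<lambda>n. abs_l2 (f n)) \<longlonglongrightarrow> F" ..
  then have f: "integrable lborel (f n)" "square_integrable (f n)" "(\<lambda>n. abs_l2 (f n)) \<longlonglongrightarrow> F" for n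
    by blast+
  have "fourier (c *\<^sub>C abs_l2 (f n)) = c *\<^sub>C fourier (abs_l2 (f n))" for n
    using f plancherel(1) integrable_bounded_linear[OF bounded_linear_cl2_mult_right f(1), of "of_complex c" n]
    by (simp add: abs_l2_scaleC[symmetric] fourier_abs_l2 square_integrable_cmult fourier_integral_scaleC)
  then show ?thesis
    using fourier_tendsto[OF bounded_linear.tendsto[OF bounded_linear_scaleC f(3)], of c]
      bounded_linear.tendsto[OF bounded_linear_scaleC fourier_tendsto[OF f(3)], of c]
    by (simp add: LIMSEQ_unique)
qed

lemma norm_fourier: "norm (fourier F) = norm F"
proof -
  from integrable_approx[of F] obtain f where
    "\<forall>n. integrable lborel (f n) \<and> square_integrable (f n) \<and> (\<lambda>n. abs_l2 (f n)) \<longlonglongrightarrow> F" ..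
  then have f: "integrable lborel (f n)" "square_integrable (f n)" "(\<lambda>n. abs_l2 (f n)) \<longlonglongrightarrow> F" for n
    by blast+
  have "norm (fourier (abs_l2 (f n))) = norm (abs_l2 (f n))" for n
    using f plancherel(2) by (simp add: fourier_abs_l2)
  then show ?thesis
    using tendsto_norm[OF fourier_tendsto[OF f(3)]] tendsto_norm[OF f(3)]
    by (simp add: LIMSEQ_unique)
qed

lemma linear_fourier: "linear fourier"
  by (rule linearI) (simp_all add: fourier_add fourier_scaleC flip: scaleC_of_real)

lemma bounded_linear_fourier: "bounded_linear fourier"
  by (rule bounded_linear_intro[where K = 1])
     (simp_all add: norm_fourier linear_add[OF linear_fourier] linear_cmul[OF linear_fourier])

lift_definition l2_reflect :: "l2 \<Rightarrow> l2" is "\<lambda>f x. f (- x)"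
  subgoal for f g
    using AE_affine[of "-1" "\<lambda>x. f x = g x" 0] square_integrable_affine[of "-1" f 0]
      square_integrable_affine[of "-1" g 0] by auto
  done

lemma square_integrable_reflect:
  fixes f :: "real^2 \<Rightarrow> cl2"
  shows "square_integrable f \<Longrightarrow> square_integrable (\<lambda>x. f (- x))"
  using square_integrable_affine[of "-1" f 0] by simp

lemma l2_reflect_abs: "square_integrable f \<Longrightarrow> l2_reflect (abs_l2 f) = abs_l2 (\<lambda>x. f (- x))"
  by (rule l2_reflect.abs_eq) auto

lemma bounded_linear_l2_reflect: "bounded_linear l2_reflect"
  and norm_l2_reflect: "norm (l2_reflect F) = norm F"
proof -
  have *: "norm (l2_reflect F) = norm F" for F
  proof -
    have "(norm (l2_reflect (abs_l2 (rep_l2 F))))\<^sup>2 = (norm (abs_l2 (rep_l2 F)))\<^sup>2"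
      using integral_reflect[of "\<lambda>x. (norm (rep_l2 F x))\<^sup>2" 0]
      by (subst l2_reflect_abs) (simp_all add: norm_abs_l2 square_integrable_reflect del: abs_l2_rep_l2)
    then show ?thesis by simp
  qed
  then show "norm (l2_reflect F) = norm F" .
  show "bounded_linear l2_reflect"
  proof (rule bounded_linear_intro[where K = 1])
    show "l2_reflect (F + G) = l2_reflect F + l2_reflect G" for F G
      by transfer (auto intro!: square_integrable_add square_integrable_reflect)
    show "l2_reflect (r *\<^sub>R F) = r *\<^sub>R l2_reflect F" for r F
      by transfer (auto intro!: square_integrable_scaleR square_integrable_reflect)
  qed (simp add: *)
qed

lemma fourier_adjoint: "inner (fourier F) G = inner F (l2_reflect (fourier G))"
proof -
  from integrable_approx[of F] obtain f where
    "\<forall>n. integrable lborel (f n) \<and> square_integrable (f n) \<and> (\<lambda>n. abs_l2 (f n)) \<longlonglongrightarrow> F" ..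
  then have f: "integrable lborel (f n)" "square_integrable (f n)" "(\<lambda>n. abs_l2 (f n)) \<longlonglongrightarrow> F" for n
    by blast+
  from integrable_approx[of G] obtain g where
    "\<forall>n. integrable lborel (g n) \<and> square_integrable (g n) \<and> (\<lambda>n. abs_l2 (g n)) \<longlonglongrightarrow> G" ..
  then have g: "integrable lborel (g n)" "square_integrable (g n)" "(\<lambda>n. abs_l2 (g n)) \<longlonglongrightarrow> G" for n
    by blast+
  have "inner (fourier (abs_l2 (f n))) (abs_l2 (g n)) = inner (abs_l2 (f n)) (l2_reflect (fourier (abs_l2 (g n))))" for n
    using f g plancherel(1)
    by (simp add: fourier_abs_l2 l2_reflect_abs inner_abs_l2 square_integrable_reflect fourier_integral_adjoint)
  moreover have "(\<lambda>n. inner (fourier (abs_l2 (f n))) (abs_l2 (g n))) \<longlonglongrightarrow> inner (fourier F) G"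
    by (intro tendsto_inner fourier_tendsto f g)
  moreover have "(\<lambda>n. inner (abs_l2 (f n)) (l2_reflect (fourier (abs_l2 (g n))))) \<longlonglongrightarrow> inner F (l2_reflect (fourier G))"
    by (intro tendsto_inner fourier_tendsto bounded_linear.tendsto[OF bounded_linear_l2_reflect] f g)
  ultimately show ?thesis by (simp add: LIMSEQ_unique)
qed

lemma fourier_inverse: "fourier (l2_reflect (fourier F)) = F"
proof -
  let ?G = "l2_reflect (fourier F)"
  have "(norm (fourier ?G - F))\<^sup>2 = (norm (fourier ?G))\<^sup>2 - 2 * inner (fourier ?G) F + (norm F)\<^sup>2"
    by (simp add: power2_norm_eq_inner inner_diff inner_commute)
  also have "inner (fourier ?G) F = (norm F)\<^sup>2"
    by (simp add: fourier_adjoint power2_norm_eq_inner[symmetric] norm_l2_reflect norm_fourier)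
  finally show ?thesis
    by (simp add: norm_fourier norm_l2_reflect)
qed

lemma bij_fourier: "bij fourier"
proof (rule bijI)
  show "inj fourier"
    using linear_injective_0[OF linear_fourier] norm_fourier by (metis norm_eq_zero)
  show "surj fourier"
    by (rule surjI[where g = fourier]) (rule fourier_inverse)
qed

section \<open>Multipliers\<close>

definition l2_mult :: "(real^2 \<Rightarrow> cl2) \<Rightarrow> l2 \<Rightarrow> l2" where
  "l2_mult m F = abs_l2 (\<lambda>\<xi>. m \<xi> * rep_l2 F \<xi>)"

locale multiplier =
  fixes m :: "real^2 \<Rightarrow> cl2" and C :: real
  assumes measurable_m [measurable]: "m \<in> borel_measurable borel"
    and bound: "\<And>\<xi>. norm (m \<xi>) \<le> C"
begin

lemma norm_m_mult_le: "norm (m \<xi> * x) \<le> 4 * C * norm x"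
  using norm_cl2_mult_le[of "m \<xi>" x] mult_right_mono[OF bound[of \<xi>], of "4 * norm x"] by simp

lemma square_integrable_m:
  assumes "square_integrable f"
  shows "square_integrable (\<lambda>\<xi>. m \<xi> * f \<xi>)"
proof (rule square_integrable_bound[OF assms])
  note [measurable] = square_integrableD(1)[OF assms]
  show "(\<lambda>\<xi>. m \<xi> * f \<xi>) \<in> borel_measurable borel" by measurable
  show "norm (m \<xi> * f \<xi>) \<le> 4 * C * norm (f \<xi>)" for \<xi> by (rule norm_m_mult_le)
qed

lemma l2_mult_abs:
  assumes "square_integrable f"
  shows "l2_mult m (abs_l2 f) = abs_l2 (\<lambda>\<xi>. m \<xi> * f \<xi>)"
  unfolding l2_mult_def
proof (rule abs_l2_eqI)
  show "AE x in lborel. m x * rep_l2 (abs_l2 f) x = m x * f x"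
    using AE_rep_abs_l2[OF assms] by eventually_elim simp
qed (intro square_integrable_m assms square_integrable_rep_l2)+

lemma bounded_linear_l2_mult: "bounded_linear (l2_mult m)"
proof (rule bounded_linear_intro)
  show "l2_mult m (F + G) = l2_mult m F + l2_mult m G" for F G
    using l2_mult_abs[OF square_integrable_add[OF square_integrable_rep_l2[of F] square_integrable_rep_l2[of G]]]
      abs_l2_add[OF square_integrable_m[OF square_integrable_rep_l2[of F]] square_integrable_m[OF square_integrable_rep_l2[of G]]]
    by (simp add: abs_l2_add l2_mult_def distrib_left)
  show "l2_mult m (r *\<^sub>R F) = r *\<^sub>R l2_mult m F" for r F
    using l2_mult_abs[OF square_integrable_scaleR[OF square_integrable_rep_l2[of F]], of r]
      abs_l2_scaleR[OF square_integrable_m[OF square_integrable_rep_l2[of F]], of r]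
    by (simp add: abs_l2_scaleR l2_mult_def)
  show "norm (l2_mult m F) \<le> norm F * (4 * C)" for F
  proof (rule power2_le_imp_le)
    have C0: "0 \<le> C" using bound[of 0] norm_ge_zero[of "m 0"] by linarith
    have sq: "square_integrable (\<lambda>\<xi>. m \<xi> * rep_l2 F \<xi>)" by (rule square_integrable_m) simp
    have "(norm (l2_mult m F))\<^sup>2 = (\<integral>\<xi>. (norm (m \<xi> * rep_l2 F \<xi>))\<^sup>2 \<partial>lborel)"
      unfolding l2_mult_def by (rule norm_abs_l2[OF sq])
    also have "\<dots> \<le> (\<integral>\<xi>. (4 * C)\<^sup>2 * (norm (rep_l2 F \<xi>))\<^sup>2 \<partial>lborel)"
    proof (rule integral_mono)
      show "(norm (m \<xi> * rep_l2 F \<xi>))\<^sup>2 \<le> (4 * C)\<^sup>2 * (norm (rep_l2 F \<xi>))\<^sup>2" for \<xi>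
        using power_mono[OF norm_m_mult_le norm_ge_zero, of \<xi> "rep_l2 F \<xi>" 2] by (simp only: power_mult_distrib)
    qed (use square_integrableD(2)[OF sq] square_integrableD(2)[OF square_integrable_rep_l2] in auto)
    also have "\<dots> = (norm F * (4 * C))\<^sup>2"
      using norm_l2[of F] by (simp add: power_mult_distrib)
    finally show "(norm (l2_mult m F))\<^sup>2 \<le> (norm F * (4 * C))\<^sup>2" .
    show "0 \<le> norm F * (4 * C)" using C0 by simp
  qed
qed

end

lemma l2_mult_tendsto:
  assumes m: "\<And>n. multiplier (m n) C" and m0: "multiplier m' C"
    and lim: "AE \<xi> in lborel. (\<lambda>n. m n \<xi>) \<longlonglongrightarrow> m' \<xi>"
  shows "(\<lambda>n. l2_mult (m n) F) \<longlonglongrightarrow> l2_mult m' F"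
  unfolding l2_mult_def
proof (rule l2_dominated_convergence)
  show "square_integrable (\<lambda>\<xi>. m n \<xi> * rep_l2 F \<xi>)" for n
    by (rule multiplier.square_integrable_m[OF m]) simp
  show "square_integrable (\<lambda>\<xi>. m' \<xi> * rep_l2 F \<xi>)"
    by (rule multiplier.square_integrable_m[OF m0]) simp
  show "AE \<xi> in lborel. (\<lambda>n. m n \<xi> * rep_l2 F \<xi>) \<longlonglongrightarrow> m' \<xi> * rep_l2 F \<xi>"
    using lim by eventually_elim (intro tendsto_cl2_mult tendsto_const)
  show "integrable lborel (\<lambda>\<xi>. (8 * C)\<^sup>2 * (norm (rep_l2 F \<xi>))\<^sup>2)"
    using square_integrableD(2)[OF square_integrable_rep_l2] by simp
  show "AE \<xi> in lborel. (norm (m n \<xi> * rep_l2 F \<xi> - m' \<xi> * rep_l2 F \<xi>))\<^sup>2 \<le> (8 * C)\<^sup>2 * (norm (rep_l2 F \<xi>))\<^sup>2" for n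
  proof (rule AE_I2)
    fix \<xi>
    have "norm (m n \<xi> * rep_l2 F \<xi> - m' \<xi> * rep_l2 F \<xi>) \<le> 8 * C * norm (rep_l2 F \<xi>)"
      using multiplier.norm_m_mult_le[OF m, of n \<xi> "rep_l2 F \<xi>"] multiplier.norm_m_mult_le[OF m0, of \<xi> "rep_l2 F \<xi>"]
        norm_triangle_ineq4[of "m n \<xi> * rep_l2 F \<xi>" "m' \<xi> * rep_l2 F \<xi>"] by linarith
    from power_mono[OF this norm_ge_zero, of 2]
    show "(norm (m n \<xi> * rep_l2 F \<xi> - m' \<xi> * rep_l2 F \<xi>))\<^sup>2 \<le> (8 * C)\<^sup>2 * (norm (rep_l2 F \<xi>))\<^sup>2"
      by (simp only: power_mult_distrib)
  qed
qed

lemma multiplier_fourier_integral: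
  assumes "integrable lborel K"
  shows "multiplier (fourier_integral K) (\<integral>x. norm (K x) \<partial>lborel)"
  by (rule multiplier.intro[OF borel_measurable_fourier_integral[OF assms] norm_fourier_integral_le[OF assms]])

lemma
  assumes K: "integrable lborel K" and f: "integrable lborel f"
  shows integrable_conv: "integrable lborel (conv K f)"
    and fourier_integral_conv: "fourier_integral (conv K f) \<xi> = fourier_integral K \<xi> * fourier_integral f \<xi>"
proof -
  have [measurable]: "K \<in> borel_measurable borel" "f \<in> borel_measurable borel"
    using K f by auto
  have Kf: "integrable lborel (\<lambda>x. K z * f x)" for z
    by (rule integrable_bounded_linear[OF bounded_linear_cl2_mult_right f])
  have tr: "integrable lborel (\<lambda>x. K z * f (x - z))" for z
    using integrable_translate[OF Kf, of z z] .
  have pair: "integrable (lborel \<Otimes>\<^sub>M lborel) (\<lambda>(z, x). K z * f (x - z))"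
  proof (rule lborel_pair.Fubini_integrable)
    show "(\<lambda>(z, x). K z * f (x - z)) \<in> borel_measurable (lborel \<Otimes>\<^sub>M lborel)" by measurable
    show "AE z in lborel. integrable lborel (\<lambda>x. case (z, x) of (z, x) \<Rightarrow> K z * f (x - z))"
      using tr by simp
    show "integrable lborel (\<lambda>z. \<integral>x. norm (case (z, x) of (z, x) \<Rightarrow> K z * f (x - z)) \<partial>lborel)"
    proof (rule Bochner_Integration.integrable_bound)
      show "integrable lborel (\<lambda>z. norm (K z) * (4 * (\<integral>x. norm (f x) \<partial>lborel)))"
        using K by (intro integrable_mult_left integrable_norm)
      show "AE z in lborel. norm (\<integral>x. norm (case (z, x) of (z, x) \<Rightarrow> K z * f (x - z)) \<partial>lborel)
          \<le> norm (norm (K z) * (4 * (\<integral>x. norm (f x) \<partial>lborel)))"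
      proof (rule AE_I2)
        fix z
        have "(\<integral>x. norm (K z * f (x - z)) \<partial>lborel) = (\<integral>x. norm (K z * f x) \<partial>lborel)"
          by (rule integral_translate[of "\<lambda>x. norm (K z * f x)"])
        also have "\<dots> \<le> (\<integral>x. 4 * norm (K z) * norm (f x) \<partial>lborel)"
          using Kf f by (intro integral_mono norm_cl2_mult_le) auto
        also have "\<dots> = norm (K z) * (4 * (\<integral>x. norm (f x) \<partial>lborel))"
          by simp
        finally show "norm (\<integral>x. norm (case (z, x) of (z, x) \<Rightarrow> K z * f (x - z)) \<partial>lborel)
          \<le> norm (norm (K z) * (4 * (\<integral>x. norm (f x) \<partial>lborel)))"
          by simp
      qed
    qed measurable
  qed
  show "integrable lborel (conv K f)"
    unfolding conv_def[abs_def] by (rule lborel_pair.integrable_snd[OF pair])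
  have pair': "integrable (lborel \<Otimes>\<^sub>M lborel) (\<lambda>(z, x). fchar (x \<bullet> \<xi>) * (K z * f (x - z)))"
  proof (rule Bochner_Integration.integrable_bound[OF pair])
    show "AE p in lborel \<Otimes>\<^sub>M lborel. norm (case p of (z, x) \<Rightarrow> fchar (x \<bullet> \<xi>) * (K z * f (x - z)))
        \<le> norm (case p of (z, x) \<Rightarrow> K z * f (x - z))"
      by (intro AE_I2) (simp add: split_beta)
  qed measurable
  have AE: "AE x in lborel. integrable lborel (\<lambda>z. K z * f (x - z))"
    using lborel_pair.AE_integrable_snd[OF pair] by simp
  have "fourier_integral (conv K f) \<xi> = (\<integral>x. (\<integral>z. fchar (x \<bullet> \<xi>) * (K z * f (x - z)) \<partial>lborel) \<partial>lborel)"
    unfolding fourier_integral_fchar conv_def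
  proof (rule integral_cong_AE)
    show "AE x in lborel. fchar (x \<bullet> \<xi>) * (\<integral>z. K z * f (x - z) \<partial>lborel) = (\<integral>z. fchar (x \<bullet> \<xi>) * (K z * f (x - z)) \<partial>lborel)"
      using AE by eventually_elim (rule integral_bounded_linear[OF bounded_linear_cl2_mult_right, symmetric])
  qed measurable
  also have "\<dots> = (\<integral>z. (\<integral>x. fchar (x \<bullet> \<xi>) * (K z * f (x - z)) \<partial>lborel) \<partial>lborel)"
    by (rule lborel_pair.Fubini_integral[OF pair'])
  also have "\<dots> = (\<integral>z. (fchar (z \<bullet> \<xi>) * K z) * fourier_integral f \<xi> \<partial>lborel)"
  proof (intro Bochner_Integration.integral_cong refl)
    fix z
    have "(\<integral>x. fchar (x \<bullet> \<xi>) * (K z * f (x - z)) \<partial>lborel)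
      = (\<integral>x. (fchar (z \<bullet> \<xi>) * K z) * (fchar ((x - z) \<bullet> \<xi>) * f (x - z)) \<partial>lborel)"
    proof (intro Bochner_Integration.integral_cong refl)
      fix x
      have "(fchar (z \<bullet> \<xi>) * K z) * (fchar ((x - z) \<bullet> \<xi>) * f (x - z))
         = fchar ((x - z) \<bullet> \<xi>) * (fchar (z \<bullet> \<xi>) * K z * f (x - z))"
        by (rule mult_fchar)
      also have "\<dots> = fchar ((x - z) \<bullet> \<xi> + z \<bullet> \<xi>) * (K z * f (x - z))"
        by (simp only: fchar_add mult.assoc)
      also have "(x - z) \<bullet> \<xi> + z \<bullet> \<xi> = x \<bullet> \<xi>" by (simp add: inner_diff_left)
      finally show "fchar (x \<bullet> \<xi>) * (K z * f (x - z)) = (fchar (z \<bullet> \<xi>) * K z) * (fchar ((x - z) \<bullet> \<xi>) * f (x - z))" ..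
    qed
    also have "\<dots> = (\<integral>x. (fchar (z \<bullet> \<xi>) * K z) * (fchar (x \<bullet> \<xi>) * f x) \<partial>lborel)"
      by (rule integral_translate[of "\<lambda>x. (fchar (z \<bullet> \<xi>) * K z) * (fchar (x \<bullet> \<xi>) * f x)"])
    also have "\<dots> = (fchar (z \<bullet> \<xi>) * K z) * fourier_integral f \<xi>"
      unfolding fourier_integral_fchar by (rule integral_bounded_linear[OF bounded_linear_cl2_mult_right integrable_fchar[OF f]])
    finally show "(\<integral>x. fchar (x \<bullet> \<xi>) * (K z * f (x - z)) \<partial>lborel) = (fchar (z \<bullet> \<xi>) * K z) * fourier_integral f \<xi>" .
  qed
  also have "\<dots> = fourier_integral K \<xi> * fourier_integral f \<xi>"
    unfolding fourier_integral_fchar[of K]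
    by (rule integral_bounded_linear[OF bounded_linear_cl2_mult_left integrable_fchar[OF K]])
  finally show "fourier_integral (conv K f) \<xi> = fourier_integral K \<xi> * fourier_integral f \<xi>" .
qed

lemma abs_l2_conv_diff:
  assumes K: "integrable lborel K" and f: "square_integrable f" and g: "square_integrable g"
  shows "abs_l2 (conv K (\<lambda>x. f x - g x)) = abs_l2 (conv K f) - abs_l2 (conv K g)"
proof -
  have "AE x in lborel. conv K (\<lambda>x. f x - g x) x = conv K f x - conv K g x"
    using AE_integrable_conv[OF K f] AE_integrable_conv[OF K g]
    by eventually_elim (simp add: conv_def right_diff_distrib)
  then have "abs_l2 (conv K (\<lambda>x. f x - g x)) = abs_l2 (\<lambda>x. conv K f x - conv K g x)"
    by (intro abs_l2_eqI square_integrable_conv square_integrable_diff K f g)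
  then show ?thesis
    by (simp only: abs_l2_diff square_integrable_conv K f g)
qed

theorem fourier_conv:
  assumes K: "integrable lborel K" and f: "square_integrable f"
  shows "fourier (abs_l2 (conv K f)) = l2_mult (fourier_integral K) (fourier (abs_l2 f))"
proof -
  interpret multiplier "fourier_integral K" "\<integral>x. norm (K x) \<partial>lborel"
    by (rule multiplier_fourier_integral[OF K])
  from integrable_approx[of "abs_l2 f"] obtain g where
    "\<forall>n. integrable lborel (g n) \<and> square_integrable (g n) \<and> (\<lambda>n. abs_l2 (g n)) \<longlonglongrightarrow> abs_l2 f" ..
  then have g: "integrable lborel (g n)" "square_integrable (g n)" "(\<lambda>n. abs_l2 (g n)) \<longlonglongrightarrow> abs_l2 f" for n
    by blast+
  have eq: "fourier (abs_l2 (conv K (g n))) = l2_mult (fourier_integral K) (fourier (abs_l2 (g n)))" for n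
  proof -
    have "fourier (abs_l2 (conv K (g n))) = abs_l2 (fourier_integral (conv K (g n)))"
      by (intro fourier_abs_l2 integrable_conv square_integrable_conv K g)
    also have "fourier_integral (conv K (g n)) = (\<lambda>\<xi>. fourier_integral K \<xi> * fourier_integral (g n) \<xi>)"
      by (intro ext fourier_integral_conv K g)
    also have "abs_l2 \<dots> = l2_mult (fourier_integral K) (abs_l2 (fourier_integral (g n)))"
      by (intro l2_mult_abs[symmetric] plancherel g)
    also have "abs_l2 (fourier_integral (g n)) = fourier (abs_l2 (g n))"
      by (intro fourier_abs_l2[symmetric] g)
    finally show ?thesis .
  qed
  have "(\<lambda>n. abs_l2 (conv K (g n)) - abs_l2 (conv K f)) \<longlonglongrightarrow> 0"
  proof (rule Lim_null_comparison)
    show "\<forall>\<^sub>F n in sequentially. norm (abs_l2 (conv K (g n)) - abs_l2 (conv K f)) \<le>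
      4 * (\<integral>z. norm (K z) \<partial>lborel) * norm (abs_l2 (g n) - abs_l2 f)"
      using norm_conv_le[OF K square_integrable_diff[OF g(2) f]]
      by (intro always_eventually allI) (simp only: abs_l2_conv_diff[OF K g(2) f] abs_l2_diff[OF g(2) f])
    have "(\<lambda>n. norm (abs_l2 (g n) - abs_l2 f)) \<longlonglongrightarrow> 0"
      using g(3) by (intro tendsto_norm_zero) (rule LIM_zero)
    then show "(\<lambda>n. 4 * (\<integral>z. norm (K z) \<partial>lborel) * norm (abs_l2 (g n) - abs_l2 f)) \<longlonglongrightarrow> 0"
      by (rule tendsto_mult_right_zero)
  qed
  then have "(\<lambda>n. abs_l2 (conv K (g n))) \<longlonglongrightarrow> abs_l2 (conv K f)"
    by (rule LIM_zero_cancel)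
  from fourier_tendsto[OF this]
  have "(\<lambda>n. l2_mult (fourier_integral K) (fourier (abs_l2 (g n)))) \<longlonglongrightarrow> fourier (abs_l2 (conv K f))"
    unfolding eq .
  moreover have "(\<lambda>n. l2_mult (fourier_integral K) (fourier (abs_l2 (g n)))) \<longlonglongrightarrow> l2_mult (fourier_integral K) (fourier (abs_l2 f))"
    by (intro bounded_linear.tendsto[OF bounded_linear_l2_mult] fourier_tendsto g)
  ultimately show ?thesis by (rule LIMSEQ_unique)
qed

section \<open>Gaussian decomposition of the Riesz kernel\<close>

text \<open>
  For \<open>a = 0\<close>, \<open>b = \<infinity>\<close> the profile would be \<open>1 / (2 \<pi> |x|\<^sup>3)\<close>, so that the kernel
  \<open>x / (2 \<pi> |x|\<^sup>3)\<close> is a superposition of the functions \<open>x exp (- \<pi> t\<^sup>2 |x|\<^sup>2)\<close>, whose Fourier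
  transforms are explicit.
\<close>

definition riesz_profile :: "real \<Rightarrow> real \<Rightarrow> real^2 \<Rightarrow> real" where
  "riesz_profile a b x = (\<integral>t. indicator {a..b} t * (2 * t\<^sup>2 * gauss (t\<^sup>2) x) \<partial>lborel)"

definition riesz_kernel :: "real \<Rightarrow> real \<Rightarrow> real^2 \<Rightarrow> cl2" where
  "riesz_kernel a b x = riesz_profile a b x *\<^sub>R vec_cl x"

lemma gauss_le_1: "s \<ge> 0 \<Longrightarrow> gauss s x \<le> 1"
  by (simp add: gauss_def)

lemma riesz_integrand_measurable [measurable]:
  "(\<lambda>(x, t). indicator {a..b} t * (2 * t\<^sup>2 * gauss (t\<^sup>2) x) :: real) \<in> borel_measurable (lborel \<Otimes>\<^sub>M lborel)"
  unfolding gauss_def by measurable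

lemma integrable_riesz_profile:
  "integrable lborel (\<lambda>t. indicator {a..b} t * (2 * t\<^sup>2 * gauss (t\<^sup>2) x))"
proof -
  have "integrable lborel (\<lambda>t. indicator {a..b} t *\<^sub>R (2 * t\<^sup>2 * gauss (t\<^sup>2) x))"
    unfolding gauss_def by (intro borel_integrable_compact continuous_intros) auto
  then show ?thesis by simp
qed

lemma borel_measurable_riesz_profile [measurable]: "riesz_profile a b \<in> borel_measurable borel"
proof -
  have "(\<lambda>x. \<integral>t. indicator {a..b} t * (2 * t\<^sup>2 * gauss (t\<^sup>2) x) \<partial>lborel) \<in> borel_measurable lborel"
    by (rule lborel.borel_measurable_lebesgue_integral) measurable
  then show ?thesis unfolding riesz_profile_def[abs_def] by simp
qed

lemma borel_measurable_riesz_kernel [measurable]: "riesz_kernel a b \<in> borel_measurable borel"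
  unfolding riesz_kernel_def[abs_def] by measurable

lemma riesz_profile_nonneg: "0 \<le> riesz_profile a b x"
  unfolding riesz_profile_def by (intro Bochner_Integration.integral_nonneg) (simp add: less_imp_le)

lemma norm_riesz_kernel: "norm (riesz_kernel a b x) = riesz_profile a b x * norm x"
  using riesz_profile_nonneg[of a b x] by (simp add: riesz_kernel_def norm_vec_cl)

lemma riesz_profile_split:
  assumes "a \<le> c" "c \<le> b"
  shows "riesz_profile a b x = riesz_profile a c x + riesz_profile c b x"
proof -
  have "riesz_profile a b x = (\<integral>t. indicator {a..c} t * (2 * t\<^sup>2 * gauss (t\<^sup>2) x) + indicator {c..b} t * (2 * t\<^sup>2 * gauss (t\<^sup>2) x) \<partial>lborel)"
    unfolding riesz_profile_def
  proof (rule integral_cong_AE)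
    have "AE t in lborel. t \<noteq> c" by (rule AE_lborel_singleton)
    then show "AE t in lborel. indicator {a..b} t * (2 * t\<^sup>2 * gauss (t\<^sup>2) x) = indicator {a..c} t * (2 * t\<^sup>2 * gauss (t\<^sup>2) x) + indicator {c..b} t * (2 * t\<^sup>2 * gauss (t\<^sup>2) x)"
      by eventually_elim (use assms in \<open>auto simp: indicator_def\<close>)
  qed (simp_all add: gauss_def)
  also have "\<dots> = riesz_profile a c x + riesz_profile c b x"
    unfolding riesz_profile_def by (intro Bochner_Integration.integral_add integrable_riesz_profile)
  finally show ?thesis .
qed

lemma riesz_kernel_split:
  "a \<le> c \<Longrightarrow> c \<le> b \<Longrightarrow> riesz_kernel a b x = riesz_kernel a c x + riesz_kernel c b x"
  by (simp add: riesz_kernel_def riesz_profile_split[of a c b] scaleR_add_left)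

lemma riesz_profile_scale:
  assumes \<epsilon>: "\<epsilon> > 0"
  shows "riesz_profile 0 1 (z /\<^sub>R \<epsilon>) = \<epsilon> ^ 3 * riesz_profile 0 (1 / \<epsilon>) z"
proof -
  have eq: "indicator {0..1 / \<epsilon>} (0 + inverse \<epsilon> *\<^sub>R t) * (2 * (0 + inverse \<epsilon> *\<^sub>R t)\<^sup>2 * gauss ((0 + inverse \<epsilon> *\<^sub>R t)\<^sup>2) z)
    = inverse (\<epsilon>\<^sup>2) * (indicator {0..1} t * (2 * t\<^sup>2 * gauss (t\<^sup>2) (z /\<^sub>R \<epsilon>)) :: real)" for t
  proof -
    have "indicator {0..1 / \<epsilon>} (0 + inverse \<epsilon> *\<^sub>R t) = (indicator {0..1} t :: real)"
      using \<epsilon> by (auto simp: indicator_def field_simps)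
    moreover have "gauss ((0 + inverse \<epsilon> *\<^sub>R t)\<^sup>2) z = gauss (t\<^sup>2) (z /\<^sub>R \<epsilon>)"
      using \<epsilon> by (simp add: gauss_def power_mult_distrib mult_ac)
    ultimately show ?thesis by (simp add: power_mult_distrib power_inverse mult_ac)
  qed
  have "(\<integral>t. inverse (\<epsilon>\<^sup>2) * (indicator {0..1} t * (2 * t\<^sup>2 * gauss (t\<^sup>2) (z /\<^sub>R \<epsilon>))) \<partial>lborel)
      = riesz_profile 0 (1 / \<epsilon>) z /\<^sub>R \<bar>inverse \<epsilon>\<bar> ^ DIM(real)"
    using integral_affine[of "inverse \<epsilon>" "\<lambda>t. indicator {0..1 / \<epsilon>} t * (2 * t\<^sup>2 * gauss (t\<^sup>2) z)" 0] \<epsilon>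
    unfolding eq riesz_profile_def by simp
  then have "inverse (\<epsilon>\<^sup>2) * riesz_profile 0 1 (z /\<^sub>R \<epsilon>) = \<epsilon> * riesz_profile 0 (1 / \<epsilon>) z"
    unfolding integral_mult_right_zero riesz_profile_def[symmetric] using \<epsilon> by simp
  then show ?thesis
    using \<epsilon> by (simp add: field_simps power2_eq_square power3_eq_cube)
qed

lemma dilate_riesz_kernel:
  assumes \<epsilon>: "\<epsilon> > 0"
  shows "dilate (riesz_kernel 0 1) \<epsilon> z = riesz_kernel 0 (1 / \<epsilon>) z"
  using \<epsilon> unfolding dilate_def riesz_kernel_def riesz_profile_scale[OF \<epsilon>]
  by (simp add: vec_cl_linear power2_eq_square power3_eq_cube) (simp add: field_simps)

lemma riesz_profile_total:
  fixes x :: "real^2"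
  assumes "x \<noteq> 0"
  shows "has_bochner_integral lborel (\<lambda>t. indicator {0..} t * (2 * t\<^sup>2 * gauss (t\<^sup>2) x)) (1 / (2 * pi * norm x ^ 3))"
proof -
  define c where "c = sqrt pi * norm x"
  have c: "c > 0" "c\<^sup>2 = pi * (norm x)\<^sup>2" using assms by (auto simp: c_def power_mult_distrib)
  let ?f = "\<lambda>t::real. indicator {0..} t * (exp (- t\<^sup>2) * t\<^sup>2)"
  have f: "integrable lborel ?f" "integral\<^sup>L lborel ?f = sqrt pi / 4"
    using gaussian_moment_even_pos[of 1] by (auto simp: has_bochner_integral_iff fact_numeral)
  have eq: "indicator {0..} t * (2 * t\<^sup>2 * gauss (t\<^sup>2) x) = 2 / c\<^sup>2 * ?f (0 + c *\<^sub>R t)" for t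
  proof -
    have "indicator {0..} (0 + c *\<^sub>R t) = (indicator {0..} t :: real)"
      using c(1) by (auto simp: indicator_def zero_le_mult_iff)
    moreover have "gauss (t\<^sup>2) x = exp (- (0 + c *\<^sub>R t)\<^sup>2)"
      by (simp add: gauss_def power_mult_distrib c(2) mult_ac)
    moreover have "2 / c\<^sup>2 * (0 + c *\<^sub>R t)\<^sup>2 = 2 * t\<^sup>2"
      using c(1) by (simp add: power_mult_distrib)
    moreover have "2 / c\<^sup>2 * ?f (0 + c *\<^sub>R t) = indicator {0..} (0 + c *\<^sub>R t) * ((2 / c\<^sup>2 * (0 + c *\<^sub>R t)\<^sup>2) * exp (- (0 + c *\<^sub>R t)\<^sup>2))"
      by (simp only: mult_ac)
    ultimately show ?thesis by simp
  qed
  have "(\<integral>t. indicator {0..} t * (2 * t\<^sup>2 * gauss (t\<^sup>2) x) \<partial>lborel) = 2 / c\<^sup>2 * (\<integral>t. ?f (0 + c *\<^sub>R t) \<partial>lborel)"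
    unfolding eq by (rule integral_mult_right_zero)
  also have "(\<integral>t. ?f (0 + c *\<^sub>R t) \<partial>lborel) = sqrt pi / 4 / c"
  proof -
    have "(\<integral>t. ?f (0 + c *\<^sub>R t) \<partial>lborel) = integral\<^sup>L lborel ?f /\<^sub>R \<bar>c\<bar> ^ DIM(real)"
      using c(1) by (intro integral_affine) simp
    also have "\<dots> = sqrt pi / 4 / c"
      unfolding f(2) using c(1) by (simp add: field_simps)
    finally show ?thesis .
  qed
  also have "2 / c\<^sup>2 * (sqrt pi / 4 / c) = 1 / (2 * pi * norm x ^ 3)"
  proof -
    have cube: "c\<^sup>2 * c = pi * (norm x)\<^sup>2 * (sqrt pi * norm x)" unfolding c(2) by (simp add: c_def)
    have "2 / a * (p / 4 / d) = (2 * p) / (4 * (a * d))" for a d p :: real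
      by simp
    then have "2 / c\<^sup>2 * (sqrt pi / 4 / c) = (2 * sqrt pi) / (4 * (pi * (norm x)\<^sup>2 * (sqrt pi * norm x)))"
      unfolding cube[symmetric] .
    also have "\<dots> = 1 / (2 * pi * norm x ^ 3)"
      using assms by (simp add: divide_simps) (simp add: power2_eq_square power3_eq_cube)
    finally show ?thesis .
  qed
  finally show ?thesis
    unfolding has_bochner_integral_iff using integrable_affine[OF _ f(1), of c 0] c(1)
    unfolding eq by (intro conjI integrable_mult_right) auto
qed

lemma riesz_profile_le_total:
  assumes "x \<noteq> 0" "0 \<le> a"
  shows "riesz_profile a b x \<le> 1 / (2 * pi * norm x ^ 3)"
proof -
  have "riesz_profile a b x \<le> (\<integral>t. indicator {0..} t * (2 * t\<^sup>2 * gauss (t\<^sup>2) x) \<partial>lborel)"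
    unfolding riesz_profile_def
    using riesz_profile_total[OF assms(1)] assms(2)
    by (intro integral_mono integrable_riesz_profile) (auto simp: has_bochner_integral_iff indicator_def less_imp_le)
  then show ?thesis using riesz_profile_total[OF assms(1)] by (simp add: has_bochner_integral_iff)
qed

lemma riesz_profile_le_2: "riesz_profile 0 1 x \<le> 2"
proof -
  have "riesz_profile 0 1 x \<le> (\<integral>t. indicator {0..1::real} t * 2 \<partial>lborel)"
    unfolding riesz_profile_def
  proof (rule integral_mono[OF integrable_riesz_profile])
    fix t :: real
    have "t\<^sup>2 * gauss (t\<^sup>2) x \<le> 1" if "0 \<le> t" "t \<le> 1"
      using mult_mono[OF power_le_one[OF that] gauss_le_1, of "t\<^sup>2" x 2] by simp
    then show "indicator {0..1} t * (2 * t\<^sup>2 * gauss (t\<^sup>2) x) \<le> indicator {0..1} t * 2"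
      by (auto simp: indicator_def)
  qed simp
  then show ?thesis by simp
qed

lemma exp_minus_le_cube:
  fixes y :: real
  assumes "y > 0"
  shows "exp (- y) \<le> 27 / y ^ 3"
proof -
  have "y / 3 \<le> exp (y / 3)"
    using exp_ge_add_one_self[of "y / 3"] by linarith
  from power_mono[OF this, of 3] have "y ^ 3 / 27 \<le> exp y"
    using assms by (simp add: power_divide flip: exp_of_nat_mult)
  then show ?thesis
    using assms by (simp add: exp_minus field_simps)
qed

lemma has_integral_arctan_kernel: "has_bochner_integral lborel (\<lambda>t::real. 1 / (1 + t\<^sup>2)) pi"
  using integrable_inverse_1_plus_square LBINT_inverse_1_plus_square
  by (simp add: has_bochner_integral_iff set_integrable_def interval_lebesgue_integral_def
      set_lebesgue_integral_def inverse_eq_divide)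

lemma riesz_profile_tail:
  assumes x: "x \<noteq> 0"
  shows "\<bar>1 / (2 * pi * norm x ^ 3) - riesz_profile 0 1 x\<bar> \<le> 108 / norm x ^ 6 * pi"
proof -
  let ?g = "\<lambda>t. 2 * t\<^sup>2 * gauss (t\<^sup>2) x"
  have tot: "integrable lborel (\<lambda>t. indicator {0..} t * ?g t)"
    "(\<integral>t. indicator {0..} t * ?g t \<partial>lborel) = 1 / (2 * pi * norm x ^ 3)"
    using riesz_profile_total[OF x] by (auto simp: has_bochner_integral_iff)
  have "1 / (2 * pi * norm x ^ 3) - riesz_profile 0 1 x = (\<integral>t. indicator {0..} t * ?g t - indicator {0..1} t * ?g t \<partial>lborel)"
    unfolding riesz_profile_def tot(2)[symmetric]
    by (rule Bochner_Integration.integral_diff[symmetric, OF tot(1) integrable_riesz_profile])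
  also have "\<dots> = (\<integral>t. indicator {1<..} t * ?g t \<partial>lborel)"
    by (intro Bochner_Integration.integral_cong refl) (auto simp: indicator_def)
  finally have eq: "1 / (2 * pi * norm x ^ 3) - riesz_profile 0 1 x = (\<integral>t. indicator {1<..} t * ?g t \<partial>lborel)" .
  have "(\<integral>t. indicator {1<..} t * ?g t \<partial>lborel) \<le> (\<integral>t. 108 / norm x ^ 6 * (1 / (1 + t\<^sup>2)) \<partial>lborel)"
  proof (rule integral_mono)
    show "integrable lborel (\<lambda>t. indicator {1<..} t * ?g t)"
      by (rule Bochner_Integration.integrable_bound[OF tot(1)]) (auto simp: indicator_def gauss_def)
    show "integrable lborel (\<lambda>t. 108 / norm x ^ 6 * (1 / (1 + t\<^sup>2)))"
      using has_integral_arctan_kernel by (intro integrable_mult_right) (simp add: has_bochner_integral_iff)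
    fix t :: real
    show "indicator {1<..} t * ?g t \<le> 108 / norm x ^ 6 * (1 / (1 + t\<^sup>2))"
    proof (cases "t > 1")
      case True
      have y: "pi * t\<^sup>2 * (norm x)\<^sup>2 > 0" using True x by simp
      have "gauss (t\<^sup>2) x \<le> 27 / (pi * t\<^sup>2 * (norm x)\<^sup>2) ^ 3"
        unfolding gauss_def by (rule exp_minus_le_cube[OF y])
      also have "\<dots> \<le> 27 / (t\<^sup>2 * (norm x)\<^sup>2) ^ 3"
      proof (rule divide_left_mono)
        have "1 * (t\<^sup>2 * (norm x)\<^sup>2) \<le> pi * (t\<^sup>2 * (norm x)\<^sup>2)"
          using pi_ge_two by (intro mult_right_mono) auto
        then show "(t\<^sup>2 * (norm x)\<^sup>2) ^ 3 \<le> (pi * t\<^sup>2 * (norm x)\<^sup>2) ^ 3"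
          by (intro power_mono) (auto simp: mult.assoc)
      qed (use True x in auto)
      also have "\<dots> = 27 / (t ^ 6 * norm x ^ 6)"
        by (simp add: power_mult_distrib flip: power_mult)
      finally have "2 * t\<^sup>2 * gauss (t\<^sup>2) x \<le> 2 * t\<^sup>2 * (27 / (t ^ 6 * norm x ^ 6))"
        by (intro mult_left_mono) auto
      also have "\<dots> = 54 / norm x ^ 6 * (1 / t ^ 4)"
        using True by (simp add: power_def numeral_eq_Suc field_simps)
      also have "\<dots> \<le> 54 / norm x ^ 6 * (2 / (1 + t\<^sup>2))"
      proof (rule mult_left_mono)
        have "1 \<le> t\<^sup>2" using True by (simp add: one_le_power)
        then have "1 + t\<^sup>2 \<le> 2 * (t\<^sup>2 * t\<^sup>2)"
          using mult_mono[of 1 "t\<^sup>2" 1 "t\<^sup>2"] mult_right_mono[of 1 "t\<^sup>2" "t\<^sup>2"] by simp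
        then have "1 + t\<^sup>2 \<le> 2 * t ^ 4" by (simp flip: power_add)
        then show "1 / t ^ 4 \<le> 2 / (1 + t\<^sup>2)"
          using True by (simp add: field_simps add_pos_nonneg)
      qed simp
      finally show ?thesis using True by simp
    qed (simp add: add_nonneg_nonneg)
  qed
  also have "\<dots> = 108 / norm x ^ 6 * pi"
    using has_integral_arctan_kernel by (subst integral_mult_right_zero) (simp only: has_bochner_integral_iff)
  finally have le: "1 / (2 * pi * norm x ^ 3) - riesz_profile 0 1 x \<le> 108 / norm x ^ 6 * pi"
    unfolding eq .
  have "0 \<le> 1 / (2 * pi * norm x ^ 3) - riesz_profile 0 1 x"
    using riesz_profile_le_total[OF x, of 0 1] by simp
  with le show ?thesis by simp
qed

definition decay :: "real^2 \<Rightarrow> real" where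
  "decay x = 1 / (1 + (x $ 1)\<^sup>2) * (1 / (1 + (x $ 2)\<^sup>2))"

lemma borel_measurable_vec_nth [measurable]: "(\<lambda>x :: real^2. x $ i) \<in> borel_measurable borel"
  by (intro borel_measurable_continuous_onI continuous_intros)

lemma integrable_decay: "integrable lborel decay"
proof -
  have "has_bochner_integral lborel (\<lambda>t::real. complex_of_real (1 / (1 + t\<^sup>2))) (of_real pi)"
    using has_bochner_integral_of_real[OF has_integral_arctan_kernel] .
  from has_bochner_integral_product_2D[OF this this]
  have "integrable lborel (\<lambda>x :: real^2. complex_of_real (1 / (1 + (x $ 1)\<^sup>2)) * complex_of_real (1 / (1 + (x $ 2)\<^sup>2)))"
    by (simp only: has_bochner_integral_iff)
  then have "integrable lborel (\<lambda>x :: real^2. complex_of_real (decay x))"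
    unfolding decay_def of_real_mult .
  then show ?thesis by (simp only: complex_of_real_integrable_eq)
qed

lemma decay_ge:
  "norm x \<le> 1 \<Longrightarrow> 1 \<le> 4 * decay x"
  "norm x \<ge> 1 \<Longrightarrow> 1 / norm x ^ 4 \<le> 3 * decay x"
proof -
  define a b where "a = (x $ 1)\<^sup>2" and "b = (x $ 2)\<^sup>2"
  have ab: "a \<ge> 0" "b \<ge> 0" "(norm x)\<^sup>2 = a + b" by (auto simp: a_def b_def norm_sq_2D)
  have pos: "(1 + a) * (1 + b) > 0" using ab by (intro mult_pos_pos) auto
  have w: "decay x = 1 / ((1 + a) * (1 + b))" by (simp add: decay_def a_def b_def)
  show "1 \<le> 4 * decay x" if "norm x \<le> 1"
  proof -
    have "a + b \<le> 1" using power_le_one[OF norm_ge_zero that, of 2] ab by simp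
    then have "(1 + a) * (1 + b) \<le> 2 * 2" using ab by (intro mult_mono) auto
    then show ?thesis using pos by (simp add: w field_simps)
  qed
  show "1 / norm x ^ 4 \<le> 3 * decay x" if "norm x \<ge> 1"
  proof -
    have s: "1 \<le> a + b" using one_le_power[OF that, of 2] ab by simp
    have "a * b \<le> (a + b) * (a + b)" using ab by (intro mult_mono) auto
    moreover have "(a + b) * 1 \<le> (a + b) * (a + b)" using ab s by (intro mult_left_mono) auto
    ultimately have le: "(1 + a) * (1 + b) \<le> 3 * ((a + b) * (a + b))"
      using s by (simp add: algebra_simps)
    have "norm x ^ 4 = (norm x)\<^sup>2 * (norm x)\<^sup>2" by (simp flip: power_add)
    then have eq: "norm x ^ 4 = (a + b) * (a + b)" by (simp only: ab(3))
    have "(a + b) * (a + b) > 0" using s by (intro mult_pos_pos) auto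
    then show ?thesis unfolding eq w using le pos by (simp add: divide_simps)
  qed
qed

definition riesz_trunc :: "real \<Rightarrow> real^2 \<Rightarrow> cl2" where
  "riesz_trunc \<epsilon> z = (if \<epsilon> < norm z then (1 / (2 * pi * norm z ^ 3)) *\<^sub>R vec_cl z else 0)"

lemma borel_measurable_riesz_trunc [measurable]: "riesz_trunc \<epsilon> \<in> borel_measurable borel"
  unfolding riesz_trunc_def[abs_def] by measurable

lemma truncated_hilbert_eq_conv: "truncated_hilbert \<epsilon> f x = conv (riesz_trunc \<epsilon>) f x"
proof -
  have "truncated_hilbert \<epsilon> f x = (\<integral>y. (1 / (2 * pi)) *\<^sub>R (indicator {y. \<epsilon> < norm (x - y)} y *\<^sub>R ((vec_cl (x - y) /\<^sub>R norm (x - y) ^ 3) * f y)) \<partial>lborel)"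
    unfolding truncated_hilbert_def set_lebesgue_integral_def
    by (rule Bochner_Integration.integral_scaleR_right[symmetric])
  also have "\<dots> = (\<integral>y. riesz_trunc \<epsilon> (x - y) * f y \<partial>lborel)"
  proof (intro Bochner_Integration.integral_cong refl)
    have "(1 / (2 * pi)) *\<^sub>R ((v /\<^sub>R n) * g) = ((1 / (2 * pi * n)) *\<^sub>R v) * g" for v g :: cl2 and n :: real
      by (simp only: mult_scaleR_left scaleR_scaleR divide_inverse inverse_mult_distrib mult_1_left)
    then show "(1 / (2 * pi)) *\<^sub>R (indicator {y. \<epsilon> < norm (x - y)} y *\<^sub>R ((vec_cl (x - y) /\<^sub>R norm (x - y) ^ 3) * f y))
        = riesz_trunc \<epsilon> (x - y) * f y" for y
      by (cases "\<epsilon> < norm (x - y)") (simp_all only: riesz_trunc_def indicator_simps mem_Collect_eq if_True if_False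
          scaleR_one scaleR_zero_left scaleR_zero_right mult_zero_left not_False_eq_True)
  qed
  finally show ?thesis unfolding conv_reflect .
qed

lemma dilate_riesz_trunc:
  assumes \<epsilon>: "\<epsilon> > 0"
  shows "dilate (riesz_trunc 1) \<epsilon> z = riesz_trunc \<epsilon> z"
proof -
  have "1 < norm (z /\<^sub>R \<epsilon>) \<longleftrightarrow> \<epsilon> < norm z"
    using \<epsilon> by (simp add: field_simps)
  moreover have "(1 / (2 * pi * norm (z /\<^sub>R \<epsilon>) ^ 3)) *\<^sub>R vec_cl (z /\<^sub>R \<epsilon>) /\<^sub>R \<epsilon>\<^sup>2 = (1 / (2 * pi * norm z ^ 3)) *\<^sub>R vec_cl z"
  proof -
    have "1 / (2 * pi * norm (z /\<^sub>R \<epsilon>) ^ 3) * inverse \<epsilon> * inverse (\<epsilon>\<^sup>2) = 1 / (2 * pi * norm z ^ 3)"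
      using \<epsilon> by (simp add: power_mult_distrib power_inverse field_simps power2_eq_square power3_eq_cube)
    moreover have "(1 / (2 * pi * norm (z /\<^sub>R \<epsilon>) ^ 3)) *\<^sub>R vec_cl (z /\<^sub>R \<epsilon>) /\<^sub>R \<epsilon>\<^sup>2
      = (1 / (2 * pi * norm (z /\<^sub>R \<epsilon>) ^ 3) * inverse \<epsilon> * inverse (\<epsilon>\<^sup>2)) *\<^sub>R vec_cl z"
      by (simp only: vec_cl_linear scaleR_scaleR mult_ac)
    ultimately show ?thesis by simp
  qed
  ultimately show ?thesis
    unfolding dilate_def riesz_trunc_def
    by (cases "\<epsilon> < norm z") (simp_all only: if_True if_False scaleR_zero_right)
qed

definition riesz_remainder :: "real^2 \<Rightarrow> cl2" where
  "riesz_remainder z = riesz_trunc 1 z - riesz_kernel 0 1 z"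

lemma norm_riesz_remainder_le: "norm (riesz_remainder z) \<le> 324 * pi * decay z"
proof (cases "1 < norm z")
  case True
  then have z: "z \<noteq> 0" "norm z \<ge> 1" by auto
  have "riesz_remainder z = (1 / (2 * pi * norm z ^ 3) - riesz_profile 0 1 z) *\<^sub>R vec_cl z"
    using True by (simp add: riesz_remainder_def riesz_trunc_def riesz_kernel_def scaleR_diff_left)
  then have "norm (riesz_remainder z) = \<bar>1 / (2 * pi * norm z ^ 3) - riesz_profile 0 1 z\<bar> * norm z"
    by (simp add: norm_vec_cl)
  also have "\<dots> \<le> 108 / norm z ^ 6 * pi * norm z"
    using riesz_profile_tail[OF z(1)] by (intro mult_right_mono) auto
  also have "\<dots> = 108 * pi * (1 / norm z ^ 5)"
    using z by (simp add: power_def numeral_eq_Suc)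
  also have "\<dots> \<le> 108 * pi * (1 / norm z ^ 4)"
    using z by (intro mult_left_mono divide_left_mono power_increasing) auto
  also have "\<dots> \<le> 108 * pi * (3 * decay z)"
    using decay_ge(2)[OF z(2)] by (intro mult_left_mono) auto
  finally show ?thesis by simp
next
  case False
  then have z: "norm z \<le> 1" by simp
  have "norm (riesz_remainder z) = riesz_profile 0 1 z * norm z"
    using False by (simp add: riesz_remainder_def riesz_trunc_def norm_riesz_kernel)
  also have "\<dots> \<le> 2 * 1"
    using riesz_profile_le_2 z by (intro mult_mono) auto
  also have "\<dots> \<le> 2 * (4 * decay z)"
    using decay_ge(1)[OF z] by (intro mult_left_mono) auto
  also have "\<dots> \<le> 324 * pi * decay z"
  proof -
    have "0 \<le> decay z" using decay_ge(1)[OF z] by simp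
    then have "8 * decay z \<le> (324 * pi) * decay z"
      using pi_ge_two by (intro mult_right_mono) auto
    then show ?thesis by simp
  qed
  finally show ?thesis .
qed

lemma decay_nonneg: "0 \<le> decay z"
  unfolding decay_def by (intro mult_nonneg_nonneg divide_nonneg_nonneg add_nonneg_nonneg) auto

lemma borel_measurable_riesz_remainder [measurable]: "riesz_remainder \<in> borel_measurable borel"
  unfolding riesz_remainder_def[abs_def] by measurable

lemma integrable_riesz_remainder: "integrable lborel riesz_remainder"
proof (rule Bochner_Integration.integrable_bound)
  show "integrable lborel (\<lambda>z. 324 * pi * decay z)"
    by (intro integrable_mult_right integrable_decay)
  show "AE z in lborel. norm (riesz_remainder z) \<le> norm (324 * pi * decay z)"
    using norm_riesz_remainder_le by (intro AE_I2) (simp add: abs_mult decay_nonneg)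
qed simp

lemma gauss_minus [simp]: "gauss s (- x) = gauss s x"
  by (simp add: gauss_def)

lemma integral_riesz_remainder: "(\<integral>z. riesz_remainder z \<partial>lborel) = 0"
  by (rule integral_odd)
     (simp add: riesz_remainder_def riesz_trunc_def riesz_kernel_def riesz_profile_def vec_cl_linear)

lemma riesz_trunc_decomp:
  assumes "\<epsilon> > 0" "\<epsilon> \<le> 1"
  shows "riesz_trunc \<epsilon> z = dilate riesz_remainder \<epsilon> z + riesz_kernel 0 \<epsilon> z + riesz_kernel \<epsilon> (1 / \<epsilon>) z"
proof -
  have "dilate riesz_remainder \<epsilon> z = dilate (riesz_trunc 1) \<epsilon> z - dilate (riesz_kernel 0 1) \<epsilon> z"
    by (simp add: dilate_def riesz_remainder_def scaleR_diff_right)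
  also have "\<dots> = riesz_trunc \<epsilon> z - riesz_kernel 0 (1 / \<epsilon>) z"
    by (simp only: dilate_riesz_trunc[OF assms(1)] dilate_riesz_kernel[OF assms(1)])
  also have "riesz_kernel 0 (1 / \<epsilon>) z = riesz_kernel 0 \<epsilon> z + riesz_kernel \<epsilon> (1 / \<epsilon>) z"
    using assms mult_le_one[of \<epsilon> \<epsilon>] by (intro riesz_kernel_split) (auto simp: field_simps)
  finally show ?thesis by simp
qed

lemma square_integrable_riesz_kernel_0_1: "square_integrable (riesz_kernel 0 1)"
proof -
  have "(norm (riesz_kernel 0 1 z))\<^sup>2 \<le> 16 * decay z" for z
  proof (cases "norm z \<le> 1")
    case True
    have "norm (riesz_kernel 0 1 z) \<le> 2 * 1"
      unfolding norm_riesz_kernel using riesz_profile_le_2 True by (intro mult_mono) auto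
    from power_mono[OF this norm_ge_zero, of 2] show ?thesis
      using decay_ge(1)[OF True] by simp
  next
    case False
    then have z: "z \<noteq> 0" "norm z \<ge> 1" by auto
    have "norm (riesz_kernel 0 1 z) \<le> 1 / (2 * pi * norm z ^ 3) * norm z"
      unfolding norm_riesz_kernel using riesz_profile_le_total[OF z(1)] by (intro mult_right_mono) auto
    also have "\<dots> = 1 / (2 * pi) * (1 / (norm z)\<^sup>2)"
      using z by (simp add: power2_eq_square power3_eq_cube)
    also have "\<dots> \<le> 1 * (1 / (norm z)\<^sup>2)"
      using pi_ge_two by (intro mult_right_mono) auto
    finally have "norm (riesz_kernel 0 1 z) \<le> 1 / (norm z)\<^sup>2" by simp
    from power_mono[OF this norm_ge_zero, of 2] have "(norm (riesz_kernel 0 1 z))\<^sup>2 \<le> 1 / norm z ^ 4"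
      by (simp add: power_divide flip: power_mult)
    then show ?thesis using decay_ge(2)[OF z(2)] decay_nonneg[of z] by linarith
  qed
  then have "integrable lborel (\<lambda>z. (norm (riesz_kernel 0 1 z))\<^sup>2)"
    by (intro Bochner_Integration.integrable_bound[OF integrable_mult_right[OF integrable_decay, of 16]] AE_I2)
       (auto simp: decay_nonneg)
  then show ?thesis by (simp add: square_integrable_def)
qed

lemma riesz_kernel_0_eq:
  assumes "a > 0"
  shows "riesz_kernel 0 a z = a\<^sup>2 *\<^sub>R riesz_kernel 0 1 (a *\<^sub>R z)"
  using dilate_riesz_kernel[of "1 / a" z] assms by (simp add: dilate_def power_divide)

lemma
  assumes K: "square_integrable K" and f: "square_integrable f"
  shows integrable_conv_L2: "integrable lborel (\<lambda>z. K z * f (x - z))"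
    and norm_conv_le_L2: "norm (conv K f x) \<le> 4 * (norm (abs_l2 K) * norm (abs_l2 f))"
proof -
  note [measurable] = square_integrableD(1)[OF K] square_integrableD(1)[OF f]
  let ?g = "\<lambda>z. f (x - z)"
  have g: "square_integrable ?g" using square_integrable_affine[of "-1" f x] f by simp
  have ng: "norm (abs_l2 ?g) = norm (abs_l2 f)"
  proof (rule power2_eq_imp_eq)
    show "(norm (abs_l2 ?g))\<^sup>2 = (norm (abs_l2 f))\<^sup>2"
      unfolding norm_abs_l2[OF g] norm_abs_l2[OF f] by (rule integral_reflect[of "\<lambda>z. (norm (f z))\<^sup>2"])
  qed simp_all
  have sq1: "square_integrable (\<lambda>z. norm (K z) *\<^sub>R (1 :: cl2))" and sq2: "square_integrable (\<lambda>z. norm (f (x - z)) *\<^sub>R (1 :: cl2))"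
    by (rule square_integrable_bound[OF K, where c = 1]; simp) (rule square_integrable_bound[OF g, where c = 1]; simp)
  have in1: "inner (1 :: cl2) 1 = 1" by (simp add: power2_norm_eq_inner[symmetric])
  have int: "integrable lborel (\<lambda>z. norm (K z) * norm (f (x - z)))"
    using integrable_inner_square_integrable[OF sq1 sq2] by (simp add: in1 mult.commute)
  have int4: "integrable lborel (\<lambda>z. 4 * norm (K z) * norm (f (x - z)))"
    using integrable_mult_right[OF int, of 4] by (simp add: mult.assoc)
  show Kf: "integrable lborel (\<lambda>z. K z * f (x - z))"
    by (rule Bochner_Integration.integrable_bound[OF int4])
       (auto intro!: AE_I2 intro: order_trans[OF norm_cl2_mult_le] simp: abs_mult)
  have "norm (conv K f x) \<le> (\<integral>z. norm (K z * f (x - z)) \<partial>lborel)"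
    unfolding conv_def by (rule integral_norm_bound)
  also have "\<dots> \<le> (\<integral>z. 4 * norm (K z) * norm (f (x - z)) \<partial>lborel)"
    by (intro integral_mono integrable_norm Kf int4 norm_cl2_mult_le)
  also have "\<dots> = 4 * (\<integral>z. norm (K z) * norm (f (x - z)) \<partial>lborel)"
    by (simp add: mult.assoc)
  also have "(\<integral>z. norm (K z) * norm (f (x - z)) \<partial>lborel) = inner (abs_l2 (\<lambda>z. norm (K z) *\<^sub>R 1)) (abs_l2 (\<lambda>z. norm (f (x - z)) *\<^sub>R 1))"
    unfolding inner_abs_l2[OF sq1 sq2] by (simp add: in1 mult.commute)
  also have "\<dots> \<le> norm (abs_l2 (\<lambda>z. norm (K z) *\<^sub>R 1)) * norm (abs_l2 (\<lambda>z. norm (f (x - z)) *\<^sub>R 1))"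
    by (rule norm_cauchy_schwarz)
  also have "norm (abs_l2 (\<lambda>z. norm (K z) *\<^sub>R 1)) = norm (abs_l2 K)"
  proof (rule power2_eq_imp_eq)
    show "(norm (abs_l2 (\<lambda>z. norm (K z) *\<^sub>R 1)))\<^sup>2 = (norm (abs_l2 K))\<^sup>2"
      unfolding norm_abs_l2[OF sq1] norm_abs_l2[OF K] by simp
  qed simp_all
  also have "norm (abs_l2 (\<lambda>z. norm (f (x - z)) *\<^sub>R 1)) = norm (abs_l2 ?g)"
  proof (rule power2_eq_imp_eq)
    show "(norm (abs_l2 (\<lambda>z. norm (f (x - z)) *\<^sub>R 1)))\<^sup>2 = (norm (abs_l2 ?g))\<^sup>2"
      unfolding norm_abs_l2[OF sq2] norm_abs_l2[OF g] by simp
  qed simp_all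
  finally show "norm (conv K f x) \<le> 4 * (norm (abs_l2 K) * norm (abs_l2 f))"
    unfolding ng by simp
qed

lemma
  assumes a: "a > 0"
  shows square_integrable_riesz_kernel_0: "square_integrable (riesz_kernel 0 a)"
    and norm_riesz_kernel_0: "norm (abs_l2 (riesz_kernel 0 a)) = a * norm (abs_l2 (riesz_kernel 0 1))"
proof -
  have eq: "riesz_kernel 0 a = (\<lambda>z. a\<^sup>2 *\<^sub>R riesz_kernel 0 1 (0 + a *\<^sub>R z))"
    using riesz_kernel_0_eq[OF a] by (simp add: fun_eq_iff)
  have "square_integrable (\<lambda>z. riesz_kernel 0 1 (0 + a *\<^sub>R z))"
    using a by (intro square_integrable_affine square_integrable_riesz_kernel_0_1) simp
  then show sq: "square_integrable (riesz_kernel 0 a)"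
    unfolding eq by (rule square_integrable_scaleR)
  show "norm (abs_l2 (riesz_kernel 0 a)) = a * norm (abs_l2 (riesz_kernel 0 1))"
  proof (rule power2_eq_imp_eq)
    have "(norm (abs_l2 (riesz_kernel 0 a)))\<^sup>2 = (\<integral>z. (norm (riesz_kernel 0 a z))\<^sup>2 \<partial>lborel)"
      by (rule norm_abs_l2[OF sq])
    also have "\<dots> = (\<integral>z. (a\<^sup>2)\<^sup>2 * (norm (riesz_kernel 0 1 (0 + a *\<^sub>R z)))\<^sup>2 \<partial>lborel)"
      unfolding eq by (simp add: power_mult_distrib)
    also have "\<dots> = (a\<^sup>2)\<^sup>2 * (\<integral>z. (norm (riesz_kernel 0 1 (0 + a *\<^sub>R z)))\<^sup>2 \<partial>lborel)"
      by (rule integral_mult_right_zero)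
    also have "(\<integral>z. (norm (riesz_kernel 0 1 (0 + a *\<^sub>R z)))\<^sup>2 \<partial>lborel) = (norm (abs_l2 (riesz_kernel 0 1)))\<^sup>2 /\<^sub>R \<bar>a\<bar> ^ DIM(real^2)"
      unfolding norm_abs_l2[OF square_integrable_riesz_kernel_0_1]
      using a by (intro integral_affine) simp
    also have "(a\<^sup>2)\<^sup>2 * \<dots> = (a * norm (abs_l2 (riesz_kernel 0 1)))\<^sup>2"
      using a by (simp add: power_mult_distrib power2_eq_square) (simp add: field_simps)
    finally show "(norm (abs_l2 (riesz_kernel 0 a)))\<^sup>2 = (a * norm (abs_l2 (riesz_kernel 0 1)))\<^sup>2" .
  qed (use a in auto)
qed

lemma
  assumes s: "s > 0"
  shows integrable_gauss_norm: "integrable lborel (\<lambda>x. gauss s x * norm x)"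
    and fourier_integral_gauss_vec: "fourier_integral (\<lambda>x. gauss s x *\<^sub>R vec_cl x) \<xi> =
      (gauss (1 / s) \<xi> / s\<^sup>2) *\<^sub>R (of_complex (- \<i>) * vec_cl \<xi>)"
proof -
  let ?h = "\<lambda>i x. (x $ i * gauss s x) *\<^sub>R cis (- (2 * pi * (x \<bullet> \<xi>)))"
  note h = gauss_moment_fourier_complex[OF s, of \<xi>]
  have "integrable lborel (\<lambda>x. norm (?h 1 x) + norm (?h 2 x))"
    using h by (intro Bochner_Integration.integrable_add integrable_norm) (auto simp only: has_bochner_integral_iff)
  then have int: "integrable lborel (\<lambda>x. \<bar>x $ 1\<bar> * gauss s x + \<bar>x $ 2\<bar> * gauss s x)"
    by (simp add: abs_mult less_imp_le)
  have le: "gauss s x * norm x \<le> \<bar>x $ 1\<bar> * gauss s x + \<bar>x $ 2\<bar> * gauss s x" for x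
  proof -
    have "norm x \<le> \<bar>x $ 1\<bar> + \<bar>x $ 2\<bar>"
      using norm_le_l1_cart[of x] by (simp add: UNIV_2)
    then have "norm x * gauss s x \<le> (\<bar>x $ 1\<bar> + \<bar>x $ 2\<bar>) * gauss s x"
      by (intro mult_right_mono) auto
    then show ?thesis by (simp add: algebra_simps)
  qed
  show "integrable lborel (\<lambda>x. gauss s x * norm x)"
  proof (rule Bochner_Integration.integrable_bound[OF int])
    show "AE x in lborel. norm (gauss s x * norm x) \<le> norm (\<bar>x $ 1\<bar> * gauss s x + \<bar>x $ 2\<bar> * gauss s x)"
      using le by (intro AE_I2) (simp add: abs_mult less_imp_le)
  qed measurable
  have eq: "fchar (x \<bullet> \<xi>) * (gauss s x *\<^sub>R vec_cl x) = of_complex (?h 1 x) * e1 + of_complex (?h 2 x) * e2" for x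
    by (simp add: vec_cl_def fchar_def of_complex_scaleR distrib_left scaleR_add_right mult.commute[of "gauss s x"])
  have lin: "bounded_linear (\<lambda>z. of_complex z * w)" for w
    by (rule bounded_linear_compose[OF bounded_linear_cl2_mult_left bounded_linear_of_complex])
  have "has_bochner_integral lborel (\<lambda>x. of_complex (?h 1 x) * e1 + of_complex (?h 2 x) * e2)
    (of_complex (- \<i> * of_real (\<xi> $ 1 * gauss (1 / s) \<xi> / s\<^sup>2)) * e1 + of_complex (- \<i> * of_real (\<xi> $ 2 * gauss (1 / s) \<xi> / s\<^sup>2)) * e2)"
    by (intro has_bochner_integral_add has_bochner_integral_bounded_linear[OF lin] h)
  then have "fourier_integral (\<lambda>x. gauss s x *\<^sub>R vec_cl x) \<xi> =
     of_complex (- \<i> * of_real (\<xi> $ 1 * gauss (1 / s) \<xi> / s\<^sup>2)) * e1 + of_complex (- \<i> * of_real (\<xi> $ 2 * gauss (1 / s) \<xi> / s\<^sup>2)) * e2"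
    unfolding fourier_integral_fchar eq by (simp only: has_bochner_integral_iff)
  also have "\<dots> = (gauss (1 / s) \<xi> / s\<^sup>2) *\<^sub>R (of_complex (- \<i>) * vec_cl \<xi>)"
  proof -
    have *: "of_complex (- \<i> * of_real (\<xi> $ i * gauss (1 / s) \<xi> / s\<^sup>2)) * w = (gauss (1 / s) \<xi> / s\<^sup>2) *\<^sub>R (of_complex (- \<i>) * (\<xi> $ i *\<^sub>R w))" for i w
    proof -
      have "- \<i> * of_real (\<xi> $ i * gauss (1 / s) \<xi> / s\<^sup>2) = (\<xi> $ i * (gauss (1 / s) \<xi> / s\<^sup>2)) *\<^sub>R (- \<i>)"
        by (simp only: scaleR_conv_of_real times_divide_eq_right mult.commute)
      then show ?thesis
        by (simp only: of_complex_scaleR mult_scaleR_left mult_scaleR_right scaleR_scaleR mult.commute)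
    qed
    show ?thesis unfolding * vec_cl_def by (simp only: distrib_left scaleR_add_right)
  qed
  finally show "fourier_integral (\<lambda>x. gauss s x *\<^sub>R vec_cl x) \<xi> = (gauss (1 / s) \<xi> / s\<^sup>2) *\<^sub>R (of_complex (- \<i>) * vec_cl \<xi>)" .
qed

lemma gauss_antimono: "s \<le> s' \<Longrightarrow> gauss s' x \<le> gauss s x"
  by (simp add: gauss_def mult_right_mono)

lemma riesz_kernel_pair_integrable:
  assumes a: "0 < a"
  shows "integrable (lborel \<Otimes>\<^sub>M lborel) (\<lambda>(t, x). (indicator {a..b} t * (2 * t\<^sup>2 * gauss (t\<^sup>2) x)) *\<^sub>R vec_cl x)"
proof (rule integrable_pair_bound)
  show "integrable lborel (\<lambda>t. indicator {a..b} t * (2 * b\<^sup>2))"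
    by (intro integrable_mult_left integrable_real_indicator) (auto simp: emeasure_lborel_Icc_eq)
  show "integrable lborel (\<lambda>x. gauss (a\<^sup>2) x * norm x)"
    using a by (intro integrable_gauss_norm) simp
  show "norm ((indicator {a..b} t * (2 * t\<^sup>2 * gauss (t\<^sup>2) x)) *\<^sub>R vec_cl x) \<le> indicator {a..b} t * (2 * b\<^sup>2) * (gauss (a\<^sup>2) x * norm x)" for t x
  proof (cases "t \<in> {a..b}")
    case True
    then have "t\<^sup>2 \<le> b\<^sup>2" "a\<^sup>2 \<le> t\<^sup>2" using a by (auto intro!: power_mono)
    then have "2 * t\<^sup>2 * gauss (t\<^sup>2) x * norm x \<le> 2 * b\<^sup>2 * gauss (a\<^sup>2) x * norm x"
      by (intro mult_right_mono mult_mono gauss_antimono) auto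
    then show ?thesis using True by (simp add: norm_vec_cl abs_mult less_imp_le mult.assoc)
  qed simp
  show "(\<lambda>(t, x). (indicator {a..b} t * (2 * t\<^sup>2 * gauss (t\<^sup>2) x)) *\<^sub>R vec_cl x) \<in> borel_measurable (lborel \<Otimes>\<^sub>M lborel)"
    unfolding gauss_def by measurable
qed

lemma riesz_kernel_eq_integral:
  "riesz_kernel a b x = (\<integral>t. (indicator {a..b} t * (2 * t\<^sup>2 * gauss (t\<^sup>2) x)) *\<^sub>R vec_cl x \<partial>lborel)"
  unfolding riesz_kernel_def riesz_profile_def
  by (rule integral_scaleR_left[symmetric]) (rule integrable_riesz_profile)

lemma integrable_riesz_kernel:
  assumes a: "0 < a"
  shows "integrable lborel (riesz_kernel a b)"
  unfolding riesz_kernel_eq_integral[abs_def]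
  by (rule lborel_pair.integrable_snd[OF riesz_kernel_pair_integrable[OF a]])

definition riesz_symbol :: "real \<Rightarrow> real \<Rightarrow> real^2 \<Rightarrow> real" where
  "riesz_symbol a b \<xi> = (\<integral>u. indicator {- 1 / a..- 1 / b} u * (2 * gauss (u\<^sup>2) \<xi>) \<partial>lborel)"

lemma riesz_symbol_subst:
  assumes a: "0 < a" "a \<le> b"
  shows "(\<integral>t. indicator {a..b} t * (2 / t\<^sup>2 * gauss (1 / t\<^sup>2) \<xi>) \<partial>lborel) = riesz_symbol a b \<xi>"
proof -
  let ?f = "\<lambda>u. 2 * gauss (u\<^sup>2) \<xi>"
  have "(\<integral>u. ?f u * indicator {- 1 / a..- 1 / b} u \<partial>lborel) = (\<integral>t. ?f (- 1 / t) * (1 / t\<^sup>2) * indicator {a..b} t \<partial>lborel)"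
  proof (rule integral_substitution(2))
    show "set_integrable lborel {- 1 / a..- 1 / b} ?f"
      unfolding set_integrable_def gauss_def by (intro borel_integrable_compact continuous_intros) auto
    show "((\<lambda>t. - 1 / t) has_real_derivative 1 / t\<^sup>2) (at t)" if "t \<in> {a..b}" for t
      using that a by (auto intro!: derivative_eq_intros simp: power2_eq_square)
    show "continuous_on {a..b} (\<lambda>t. 1 / t\<^sup>2)"
      using a by (intro continuous_intros) auto
  qed (use a in auto)
  also have "\<dots> = (\<integral>t. indicator {a..b} t * (2 / t\<^sup>2 * gauss (1 / t\<^sup>2) \<xi>) \<partial>lborel)"
    by (intro Bochner_Integration.integral_cong refl) (simp add: power_divide)
  finally show ?thesis by (simp add: riesz_symbol_def mult_ac)
qed

lemma fourier_integral_riesz_kernel: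
  assumes a: "0 < a" "a \<le> b"
  shows "fourier_integral (riesz_kernel a b) \<xi> = riesz_symbol a b \<xi> *\<^sub>R (of_complex (- \<i>) * vec_cl \<xi>)"
proof -
  let ?k = "\<lambda>t x. (indicator {a..b} t * (2 * t\<^sup>2 * gauss (t\<^sup>2) x)) *\<^sub>R vec_cl x"
  have int: "integrable lborel (\<lambda>t. ?k t x)" for x
    by (rule integrable_scaleR_left) (rule integrable_riesz_profile)
  have pair: "integrable (lborel \<Otimes>\<^sub>M lborel) (\<lambda>(t, x). fchar (x \<bullet> \<xi>) * ?k t x)"
  proof (rule Bochner_Integration.integrable_bound[OF riesz_kernel_pair_integrable[OF a(1), of b]])
    show "(\<lambda>(t, x). fchar (x \<bullet> \<xi>) * ?k t x) \<in> borel_measurable (lborel \<Otimes>\<^sub>M lborel)"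
      unfolding gauss_def by measurable
    show "AE p in lborel \<Otimes>\<^sub>M lborel. norm (case p of (t, x) \<Rightarrow> fchar (x \<bullet> \<xi>) * ?k t x) \<le> norm (case p of (t, x) \<Rightarrow> ?k t x)"
      by (intro AE_I2) (simp only: split_beta norm_fchar_mult)
  qed
  have "fourier_integral (riesz_kernel a b) \<xi> = (\<integral>x. (\<integral>t. fchar (x \<bullet> \<xi>) * ?k t x \<partial>lborel) \<partial>lborel)"
    unfolding fourier_integral_fchar riesz_kernel_eq_integral
    by (intro Bochner_Integration.integral_cong refl integral_bounded_linear[OF bounded_linear_cl2_mult_right int, symmetric])
  also have "\<dots> = (\<integral>t. (\<integral>x. fchar (x \<bullet> \<xi>) * ?k t x \<partial>lborel) \<partial>lborel)"
    by (rule lborel_pair.Fubini_integral[OF pair])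
  also have "\<dots> = (\<integral>t. (indicator {a..b} t * (2 / t\<^sup>2 * gauss (1 / t\<^sup>2) \<xi>)) *\<^sub>R (of_complex (- \<i>) * vec_cl \<xi>) \<partial>lborel)"
  proof (intro Bochner_Integration.integral_cong refl)
    fix t
    show "(\<integral>x. fchar (x \<bullet> \<xi>) * ?k t x \<partial>lborel) = (indicator {a..b} t * (2 / t\<^sup>2 * gauss (1 / t\<^sup>2) \<xi>)) *\<^sub>R (of_complex (- \<i>) * vec_cl \<xi>)"
    proof (cases "t \<in> {a..b}")
      case True
      then have t: "t > 0" "t\<^sup>2 > 0" using a by auto
      have "(\<integral>x. fchar (x \<bullet> \<xi>) * ?k t x \<partial>lborel) = (\<integral>x. (2 * t\<^sup>2) *\<^sub>R (fchar (x \<bullet> \<xi>) * (gauss (t\<^sup>2) x *\<^sub>R vec_cl x)) \<partial>lborel)"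
        using True by simp
      also have "\<dots> = (2 * t\<^sup>2) *\<^sub>R fourier_integral (\<lambda>x. gauss (t\<^sup>2) x *\<^sub>R vec_cl x) \<xi>"
        unfolding fourier_integral_fchar by (rule Bochner_Integration.integral_scaleR_right)
      also have "\<dots> = (2 * t\<^sup>2 * (gauss (1 / t\<^sup>2) \<xi> / (t\<^sup>2)\<^sup>2)) *\<^sub>R (of_complex (- \<i>) * vec_cl \<xi>)"
        by (simp only: fourier_integral_gauss_vec[OF t(2)] scaleR_scaleR)
      also have "2 * t\<^sup>2 * (gauss (1 / t\<^sup>2) \<xi> / (t\<^sup>2)\<^sup>2) = indicator {a..b} t * (2 / t\<^sup>2 * gauss (1 / t\<^sup>2) \<xi>)"
        using True t by (simp add: power2_eq_square)
      finally show ?thesis .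
    qed simp
  qed
  also have "\<dots> = (\<integral>t. indicator {a..b} t * (2 / t\<^sup>2 * gauss (1 / t\<^sup>2) \<xi>) \<partial>lborel) *\<^sub>R (of_complex (- \<i>) * vec_cl \<xi>)"
  proof (rule integral_scaleR_left)
    have "integrable lborel (\<lambda>t. indicator {a..b} t *\<^sub>R (2 / t\<^sup>2 * gauss (1 / t\<^sup>2) \<xi>))"
      unfolding gauss_def using a by (intro borel_integrable_compact continuous_intros) auto
    then show "integrable lborel (\<lambda>t. indicator {a..b} t * (2 / t\<^sup>2 * gauss (1 / t\<^sup>2) \<xi>))" by simp
  qed
  finally show ?thesis unfolding riesz_symbol_subst[OF a] .
qed

lemma half_gaussian:
  assumes "\<xi> \<noteq> 0"
  shows "has_bochner_integral lborel (\<lambda>u. indicator {..<0} u * (2 * gauss (u\<^sup>2) \<xi>)) (1 / norm \<xi>)"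
proof -
  define s where "s = (norm \<xi>)\<^sup>2"
  have s: "s > 0" using assms by (simp add: s_def)
  let ?g = "\<lambda>u. gauss (u\<^sup>2) \<xi>"
  have g_eq: "?g = (\<lambda>u. exp (- (pi * s * u\<^sup>2)))"
    by (auto simp: gauss_def s_def mult_ac)
  have g: "integrable lborel ?g" unfolding g_eq by (rule gaussian_integrable_1D[OF s])
  have "complex_of_real (\<integral>u. exp (- (pi * s * u\<^sup>2)) \<partial>lborel) = of_real (1 / sqrt s)"
    using gaussian_1D[OF s, of 0] by (simp add: has_bochner_integral_iff scaleR_conv_of_real)
  then have G: "(\<integral>u. ?g u \<partial>lborel) = 1 / norm \<xi>"
    unfolding g_eq by (simp only: of_real_eq_iff) (simp add: s_def)
  have hint: "integrable lborel (\<lambda>u. indicator S u * ?g u)" if "S \<in> sets borel" for S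
    using integrable_mult_indicator[of S lborel ?g] g that by simp
  have refl: "(\<integral>u. indicator {..<0} u * ?g u \<partial>lborel) = (\<integral>u. indicator {0<..} u * ?g u \<partial>lborel)"
  proof -
    have "(\<integral>u. indicator {..<0} (0 - u) * ?g (0 - u) \<partial>lborel) = (\<integral>u. indicator {..<0} u * ?g u \<partial>lborel)"
      by (rule integral_reflect)
    then show ?thesis by (simp add: indicator_def)
  qed
  have "(\<integral>u. ?g u \<partial>lborel) = (\<integral>u. indicator {..<0} u * ?g u + indicator {0<..} u * ?g u \<partial>lborel)"
  proof (rule integral_cong_AE)
    have "AE u in lborel. u \<noteq> (0::real)" by (rule AE_lborel_singleton)
    then show "AE u in lborel. ?g u = indicator {..<0} u * ?g u + indicator {0<..} u * ?g u"
      by eventually_elim (auto simp: indicator_def)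
  qed (simp_all add: gauss_def)
  also have "\<dots> = 2 * (\<integral>u. indicator {..<0} u * ?g u \<partial>lborel)"
    by (subst Bochner_Integration.integral_add) (simp_all add: hint refl)
  finally have "2 * (\<integral>u. indicator {..<0} u * ?g u \<partial>lborel) = 1 / norm \<xi>" unfolding G by simp
  then have "(\<integral>u. 2 * (indicator {..<0} u * ?g u) \<partial>lborel) = 1 / norm \<xi>"
    unfolding integral_mult_right_zero .
  moreover have "integrable lborel (\<lambda>u. 2 * (indicator {..<0} u * ?g u))"
    by (intro integrable_mult_right hint) simp
  ultimately show ?thesis
    by (simp add: has_bochner_integral_iff mult.left_commute)
qed

lemma riesz_symbol_nonneg: "0 \<le> riesz_symbol a b \<xi>"
  unfolding riesz_symbol_def by (intro Bochner_Integration.integral_nonneg) (simp add: less_imp_le)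

lemma riesz_symbol_le:
  assumes "\<xi> \<noteq> 0" "b > 0"
  shows "riesz_symbol a b \<xi> \<le> 1 / norm \<xi>"
proof -
  have h: "integrable lborel (\<lambda>u. indicator {..<0} u * (2 * gauss (u\<^sup>2) \<xi>))"
    "(\<integral>u. indicator {..<0} u * (2 * gauss (u\<^sup>2) \<xi>) \<partial>lborel) = 1 / norm \<xi>"
    using half_gaussian[OF assms(1)] by (simp_all only: has_bochner_integral_iff)
  show ?thesis
    unfolding riesz_symbol_def h(2)[symmetric]
  proof (rule integral_mono[OF _ h(1)])
    have b: "- 1 / b < 0" using assms(2) by simp
    show "indicator {- 1 / a..- 1 / b} u * (2 * gauss (u\<^sup>2) \<xi>) \<le> indicator {..<0} u * (2 * gauss (u\<^sup>2) \<xi>)" for u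
    proof (rule mult_right_mono)
      show "indicator {- 1 / a..- 1 / b} u \<le> (indicator {..<0} u :: real)"
        by (intro indicator_leI) (metis atLeastAtMost_iff lessThan_iff b order_le_less_trans)
    qed simp
    have "integrable lborel (\<lambda>u. indicator {- 1 / a..- 1 / b} u *\<^sub>R (2 * gauss (u\<^sup>2) \<xi>))"
      unfolding gauss_def by (intro borel_integrable_compact continuous_intros) auto
    then show "integrable lborel (\<lambda>u. indicator {- 1 / a..- 1 / b} u * (2 * gauss (u\<^sup>2) \<xi>))" by simp
  qed
qed

lemma riesz_symbol_tendsto:
  assumes \<xi>: "\<xi> \<noteq> 0" and \<epsilon>: "\<And>n. \<epsilon> n > 0" "\<epsilon> \<longlonglongrightarrow> 0"
  shows "(\<lambda>n. riesz_symbol (\<epsilon> n) (1 / \<epsilon> n) \<xi>) \<longlonglongrightarrow> 1 / norm \<xi>"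
proof -
  have h: "integrable lborel (\<lambda>u. indicator {..<0} u * (2 * gauss (u\<^sup>2) \<xi>))"
    "(\<integral>u. indicator {..<0} u * (2 * gauss (u\<^sup>2) \<xi>) \<partial>lborel) = 1 / norm \<xi>"
    using half_gaussian[OF \<xi>] by (simp_all only: has_bochner_integral_iff)
  show ?thesis
    unfolding riesz_symbol_def h(2)[symmetric]
  proof (rule integral_dominated_convergence[OF _ _ h(1)])
    show "AE u in lborel. norm (indicator {- 1 / \<epsilon> n..- 1 / (1 / \<epsilon> n)} u * (2 * gauss (u\<^sup>2) \<xi>)) \<le> indicator {..<0} u * (2 * gauss (u\<^sup>2) \<xi>)" for n
      using \<epsilon>(1)[of n] by (intro AE_I2) (auto simp: indicator_def less_imp_le)
    show "AE u in lborel. (\<lambda>n. indicator {- 1 / \<epsilon> n..- 1 / (1 / \<epsilon> n)} u * (2 * gauss (u\<^sup>2) \<xi>)) \<longlonglongrightarrow> indicator {..<0} u * (2 * gauss (u\<^sup>2) \<xi>)"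
    proof (rule AE_I2)
      fix u :: real
      have "\<forall>\<^sub>F n in sequentially. indicator {- 1 / \<epsilon> n..- 1 / (1 / \<epsilon> n)} u = (indicator {..<0} u :: real)"
      proof (cases "u < 0")
        case True
        have "min (- u) (1 / - u) > 0" using True by simp
        then have "\<forall>\<^sub>F n in sequentially. \<epsilon> n < min (- u) (1 / - u)"
          by (rule order_tendstoD(2)[OF \<epsilon>(2)])
        then show ?thesis
        proof eventually_elim
          fix n assume n: "\<epsilon> n < min (- u) (1 / - u)"
          then have "\<epsilon> n * - u < 1" using True by (simp add: field_simps)
          then have "- 1 / \<epsilon> n \<le> u" using \<epsilon>(1)[of n] by (simp add: field_simps)
          moreover have "u \<le> - 1 / (1 / \<epsilon> n)" using n by simp
          ultimately show "indicator {- 1 / \<epsilon> n..- 1 / (1 / \<epsilon> n)} u = (indicator {..<0} u :: real)"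
            using True by simp
        qed
      next
        case False
        have "u \<notin> {- 1 / \<epsilon> n..- 1 / (1 / \<epsilon> n)}" for n
          using False \<epsilon>(1)[of n] by auto
        then show ?thesis using False by simp
      qed
      then show "(\<lambda>n. indicator {- 1 / \<epsilon> n..- 1 / (1 / \<epsilon> n)} u * (2 * gauss (u\<^sup>2) \<xi>)) \<longlonglongrightarrow> indicator {..<0} u * (2 * gauss (u\<^sup>2) \<xi>)"
        by (intro tendsto_mult tendsto_const tendsto_eventually)
    qed
  qed (simp_all add: gauss_def)
qed

definition hilbert_symbol :: "real^2 \<Rightarrow> cl2" where
  "hilbert_symbol \<xi> = (1 / norm \<xi>) *\<^sub>R (of_complex (- \<i>) * vec_cl \<xi>)"

lemma multiplier_hilbert_symbol: "multiplier hilbert_symbol 1"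
proof
  show "hilbert_symbol \<in> borel_measurable borel"
    unfolding hilbert_symbol_def[abs_def] by measurable
  show "norm (hilbert_symbol \<xi>) \<le> 1" for \<xi>
    by (simp add: hilbert_symbol_def norm_of_complex_mult norm_vec_cl)
qed

lemma multiplier_riesz_kernel:
  assumes a: "0 < a" "a \<le> b"
  shows "multiplier (fourier_integral (riesz_kernel a b)) 1"
proof
  show "fourier_integral (riesz_kernel a b) \<in> borel_measurable borel"
    by (rule borel_measurable_fourier_integral[OF integrable_riesz_kernel[OF a(1)]])
  show "norm (fourier_integral (riesz_kernel a b) \<xi>) \<le> 1" for \<xi>
  proof (cases "\<xi> = 0")
    case False
    have "norm (fourier_integral (riesz_kernel a b) \<xi>) = riesz_symbol a b \<xi> * norm \<xi>"
      by (simp add: fourier_integral_riesz_kernel[OF a] norm_of_complex_mult norm_vec_cl riesz_symbol_nonneg)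
    also have "\<dots> \<le> 1 / norm \<xi> * norm \<xi>"
      using a by (intro mult_right_mono riesz_symbol_le False) auto
    finally show ?thesis using False by simp
  qed (simp add: fourier_integral_riesz_kernel[OF a] vec_cl_def)
qed

section \<open>The Hilbert transformation as a multiplier\<close>

definition hilbert_op :: "l2 \<Rightarrow> l2" where
  "hilbert_op F = l2_reflect (fourier (l2_mult hilbert_symbol (fourier F)))"

interpretation hilbert_symbol: multiplier hilbert_symbol 1
  by (rule multiplier_hilbert_symbol)

lemma fourier_hilbert_op: "fourier (hilbert_op F) = l2_mult hilbert_symbol (fourier F)"
  unfolding hilbert_op_def by (rule fourier_inverse)

lemma fourier_inverse': "l2_reflect (fourier (fourier F)) = F"
  using injD[OF bij_is_inj[OF bij_fourier] fourier_inverse[of "fourier F"]] .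

lemma bounded_linear_hilbert_op: "bounded_linear hilbert_op"
  unfolding hilbert_op_def[abs_def]
  by (intro bounded_linear_compose[OF bounded_linear_l2_reflect] bounded_linear_compose[OF bounded_linear_fourier]
      bounded_linear_compose[OF hilbert_symbol.bounded_linear_l2_mult] bounded_linear_fourier)

lemma AE_conv_decomp:
  assumes f: "square_integrable f" and \<epsilon>: "\<epsilon> > 0" "\<epsilon> \<le> 1"
  shows "AE x in lborel. truncated_hilbert \<epsilon> f x =
    conv (dilate riesz_remainder \<epsilon>) f x + conv (riesz_kernel \<epsilon> (1 / \<epsilon>)) f x + conv (riesz_kernel 0 \<epsilon>) f x"
  using AE_integrable_conv[OF integrable_dilate[OF integrable_riesz_remainder \<epsilon>(1)] f]
    AE_integrable_conv[OF integrable_riesz_kernel[OF \<epsilon>(1)] f, of "1 / \<epsilon>"]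
proof eventually_elim
  fix x
  assume i: "integrable lborel (\<lambda>z. dilate riesz_remainder \<epsilon> z * f (x - z))"
    "integrable lborel (\<lambda>z. riesz_kernel \<epsilon> (1 / \<epsilon>) z * f (x - z))"
  note i0 = integrable_conv_L2[OF square_integrable_riesz_kernel_0[OF \<epsilon>(1)] f, of x]
  have "truncated_hilbert \<epsilon> f x = (\<integral>z. (dilate riesz_remainder \<epsilon> z * f (x - z) + riesz_kernel \<epsilon> (1 / \<epsilon>) z * f (x - z)) + riesz_kernel 0 \<epsilon> z * f (x - z) \<partial>lborel)"
    unfolding truncated_hilbert_eq_conv conv_def riesz_trunc_decomp[OF \<epsilon>]
    by (intro Bochner_Integration.integral_cong refl) (simp only: distrib_right add_ac)
  also have "\<dots> = conv (dilate riesz_remainder \<epsilon>) f x + conv (riesz_kernel \<epsilon> (1 / \<epsilon>)) f x + conv (riesz_kernel 0 \<epsilon>) f x"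
    unfolding conv_def
    by (simp only: Bochner_Integration.integral_add[OF Bochner_Integration.integrable_add[OF i] i0] Bochner_Integration.integral_add[OF i])
  finally show "truncated_hilbert \<epsilon> f x =
    conv (dilate riesz_remainder \<epsilon>) f x + conv (riesz_kernel \<epsilon> (1 / \<epsilon>)) f x + conv (riesz_kernel 0 \<epsilon>) f x" .
qed

text \<open>
  The two regularised parts converge in \<open>L\<^sup>2\<close>, hence almost everywhere along a subsequence, and the
  low-frequency part \<open>riesz_kernel 0 \<epsilon>\<close> contributes \<open>O(\<epsilon>)\<close> uniformly.
\<close>

theorem truncated_hilbert_subseq:
  assumes f: "square_integrable f"
  shows "\<exists>r. strict_mono r \<and>
    (AE x in lborel. (\<lambda>n. truncated_hilbert (1 / Suc (r n)) f x) \<longlonglongrightarrow> rep_l2 (hilbert_op (abs_l2 f)) x)"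
proof -
  define \<epsilon> where "\<epsilon> n = 1 / real (Suc n)" for n
  have \<epsilon>: "\<epsilon> n > 0" "\<epsilon> n \<le> 1" for n by (simp_all add: \<epsilon>_def)
  have \<epsilon>0: "\<epsilon> \<longlonglongrightarrow> 0" unfolding \<epsilon>_def using LIMSEQ_inverse_real_of_nat by (simp add: inverse_eq_divide)
  have \<epsilon>1: "\<epsilon> n \<le> 1 / \<epsilon> n" for n
    using \<epsilon>[of n] mult_le_one[of "\<epsilon> n" "\<epsilon> n"] by (simp add: field_simps)
  let ?D = "\<lambda>n. conv (dilate riesz_remainder (\<epsilon> n)) f"
  let ?K = "\<lambda>n. conv (riesz_kernel (\<epsilon> n) (1 / \<epsilon> n)) f"
  have sqD: "square_integrable (?D n)" for n
    by (intro square_integrable_conv integrable_dilate integrable_riesz_remainder \<epsilon> f)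
  have sqK: "square_integrable (?K n)" for n
    by (intro square_integrable_conv integrable_riesz_kernel \<epsilon> f)
  have D: "(\<lambda>n. abs_l2 (?D n)) \<longlonglongrightarrow> 0"
    using conv_dilate_tendsto[OF integrable_riesz_remainder f \<epsilon>(1) \<epsilon>0]
    by (simp only: integral_riesz_remainder mult_zero_left abs_l2_0)
  have "(\<lambda>n. l2_mult (fourier_integral (riesz_kernel (\<epsilon> n) (1 / \<epsilon> n))) (fourier (abs_l2 f))) \<longlonglongrightarrow> l2_mult hilbert_symbol (fourier (abs_l2 f))"
  proof (rule l2_mult_tendsto[OF multiplier_riesz_kernel[OF \<epsilon>(1) \<epsilon>1] multiplier_hilbert_symbol])
    have "AE \<xi> in lborel. \<xi> \<noteq> (0 :: real^2)" by (rule AE_lborel_singleton)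
    then show "AE \<xi> in lborel. (\<lambda>n. fourier_integral (riesz_kernel (\<epsilon> n) (1 / \<epsilon> n)) \<xi>) \<longlonglongrightarrow> hilbert_symbol \<xi>"
    proof eventually_elim
      fix \<xi> :: "real^2" assume "\<xi> \<noteq> 0"
      from riesz_symbol_tendsto[OF this \<epsilon>(1) \<epsilon>0]
      show "(\<lambda>n. fourier_integral (riesz_kernel (\<epsilon> n) (1 / \<epsilon> n)) \<xi>) \<longlonglongrightarrow> hilbert_symbol \<xi>"
        unfolding fourier_integral_riesz_kernel[OF \<epsilon>(1) \<epsilon>1] hilbert_symbol_def
        by (intro tendsto_scaleR tendsto_const)
    qed
  qed
  then have "(\<lambda>n. fourier (abs_l2 (?K n))) \<longlonglongrightarrow> l2_mult hilbert_symbol (fourier (abs_l2 f))"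
    by (simp only: fourier_conv[OF integrable_riesz_kernel[OF \<epsilon>(1)] f])
  from bounded_linear.tendsto[OF bounded_linear_l2_reflect fourier_tendsto[OF this]]
  have "(\<lambda>n. abs_l2 (?K n)) \<longlonglongrightarrow> hilbert_op (abs_l2 f)"
    by (simp only: fourier_inverse' hilbert_op_def)
  from tendsto_add[OF D this]
  have lim: "(\<lambda>n. abs_l2 (\<lambda>x. ?D n x + ?K n x)) \<longlonglongrightarrow> abs_l2 (rep_l2 (hilbert_op (abs_l2 f)))"
    by (simp only: abs_l2_add[OF sqD sqK] add_0_left abs_l2_rep_l2)
  obtain r where r: "strict_mono r"
    "AE x in lborel. (\<lambda>n. ?D (r n) x + ?K (r n) x) \<longlonglongrightarrow> rep_l2 (hilbert_op (abs_l2 f)) x"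
    using l2_tendsto_AE_subseq[OF square_integrable_add[OF sqD sqK] square_integrable_rep_l2 lim] by blast
  have low: "(\<lambda>n. conv (riesz_kernel 0 (\<epsilon> (r n))) f x) \<longlonglongrightarrow> 0" for x
  proof (rule Lim_null_comparison)
    let ?C = "4 * (norm (abs_l2 (riesz_kernel 0 1)) * norm (abs_l2 f))"
    have "4 * (norm (abs_l2 (riesz_kernel 0 (\<epsilon> m))) * norm (abs_l2 f)) = ?C * \<epsilon> m" for m
      unfolding norm_riesz_kernel_0[OF \<epsilon>(1)] by (simp only: mult_ac)
    then have "norm (conv (riesz_kernel 0 (\<epsilon> m)) f x) \<le> ?C * \<epsilon> m" for m
      using norm_conv_le_L2[OF square_integrable_riesz_kernel_0[OF \<epsilon>(1)] f, of m x] by (simp only:)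
    then show "\<forall>\<^sub>F n in sequentially. norm (conv (riesz_kernel 0 (\<epsilon> (r n))) f x) \<le> ?C * \<epsilon> (r n)"
      by (intro always_eventually allI)
    have "(\<lambda>n. \<epsilon> (r n)) \<longlonglongrightarrow> 0"
      using LIMSEQ_subseq_LIMSEQ[OF \<epsilon>0 r(1)] by (simp add: o_def)
    then show "(\<lambda>n. ?C * \<epsilon> (r n)) \<longlonglongrightarrow> 0" by (rule tendsto_mult_right_zero)
  qed
  have "AE x in lborel. \<forall>n. truncated_hilbert (\<epsilon> n) f x = ?D n x + ?K n x + conv (riesz_kernel 0 (\<epsilon> n)) f x"
    unfolding AE_all_countable by (intro allI AE_conv_decomp f \<epsilon>)
  with r(2) have "AE x in lborel. (\<lambda>n. truncated_hilbert (\<epsilon> (r n)) f x) \<longlonglongrightarrow> rep_l2 (hilbert_op (abs_l2 f)) x"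
  proof eventually_elim
    fix x
    assume x: "(\<lambda>n. ?D (r n) x + ?K (r n) x) \<longlonglongrightarrow> rep_l2 (hilbert_op (abs_l2 f)) x"
      "\<forall>n. truncated_hilbert (\<epsilon> n) f x = ?D n x + ?K n x + conv (riesz_kernel 0 (\<epsilon> n)) f x"
    from tendsto_add[OF x(1) low[of x]]
    show "(\<lambda>n. truncated_hilbert (\<epsilon> (r n)) f x) \<longlonglongrightarrow> rep_l2 (hilbert_op (abs_l2 f)) x"
      by (simp only: x(2) add_0_right)
  qed
  then show ?thesis using r(1) unfolding \<epsilon>_def by blast
qed

lemma principal_value_eq:
  assumes f: "square_integrable f"
    and pv: "AE x in lborel. ((\<lambda>\<epsilon>. truncated_hilbert \<epsilon> f x) \<longlongrightarrow> g x) (at_right 0)"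
  shows "AE x in lborel. g x = rep_l2 (hilbert_op (abs_l2 f)) x"
proof -
  obtain r where r: "strict_mono r"
    "AE x in lborel. (\<lambda>n. truncated_hilbert (1 / Suc (r n)) f x) \<longlonglongrightarrow> rep_l2 (hilbert_op (abs_l2 f)) x"
    using truncated_hilbert_subseq[OF f] by blast
  have "filterlim (\<lambda>n. 1 / real (Suc n)) (at_right 0) sequentially"
    unfolding filterlim_at using LIMSEQ_inverse_real_of_nat by (auto simp: inverse_eq_divide)
  from filterlim_compose[OF this filterlim_subseq[OF r(1)]]
  have lim: "filterlim (\<lambda>n. 1 / real (Suc (r n))) (at_right 0) sequentially" .
  show ?thesis
    using pv r(2)
  proof eventually_elim
    fix x
    assume 1: "((\<lambda>\<epsilon>. truncated_hilbert \<epsilon> f x) \<longlongrightarrow> g x) (at_right 0)"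
      and 2: "(\<lambda>n. truncated_hilbert (1 / Suc (r n)) f x) \<longlonglongrightarrow> rep_l2 (hilbert_op (abs_l2 f)) x"
    from LIMSEQ_unique[OF filterlim_compose[OF 1 lim] 2]
    show "g x = rep_l2 (hilbert_op (abs_l2 f)) x" .
  qed
qed

lemma square_integrable_riesz_trunc:
  assumes "\<epsilon> > 0"
  shows "square_integrable (riesz_trunc \<epsilon>)"
proof -
  have "(norm (riesz_trunc 1 z))\<^sup>2 \<le> 3 * decay z" for z
  proof (cases "1 < norm z")
    case True
    then have z: "z \<noteq> 0" "norm z \<ge> 1" by auto
    have "norm (riesz_trunc 1 z) = 1 / (2 * pi) * (1 / (norm z)\<^sup>2)"
      using True z by (simp add: riesz_trunc_def norm_vec_cl power2_eq_square power3_eq_cube)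
    also have "\<dots> \<le> 1 * (1 / (norm z)\<^sup>2)"
      using pi_ge_two by (intro mult_right_mono) auto
    finally have "norm (riesz_trunc 1 z) \<le> 1 / (norm z)\<^sup>2" by simp
    from power_mono[OF this norm_ge_zero, of 2] have "(norm (riesz_trunc 1 z))\<^sup>2 \<le> 1 / norm z ^ 4"
      by (simp add: power_divide flip: power_mult)
    then show ?thesis using decay_ge(2)[OF z(2)] by linarith
  qed (simp add: riesz_trunc_def decay_nonneg)
  then have "integrable lborel (\<lambda>z. (norm (riesz_trunc 1 z))\<^sup>2)"
    by (intro Bochner_Integration.integrable_bound[OF integrable_mult_right[OF integrable_decay, of 3]] AE_I2)
       (auto simp: decay_nonneg)
  then have 1: "square_integrable (riesz_trunc 1)" by (simp add: square_integrable_def)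
  have "riesz_trunc \<epsilon> = (\<lambda>z. inverse (\<epsilon>\<^sup>2) *\<^sub>R riesz_trunc 1 (0 + inverse \<epsilon> *\<^sub>R z))"
    using dilate_riesz_trunc[OF assms] by (simp add: fun_eq_iff dilate_def)
  then show ?thesis
    using square_integrable_scaleR[OF square_integrable_affine[OF _ 1, of "inverse \<epsilon>" 0]] assms by simp
qed

lemma truncated_hilbert_add:
  assumes "\<epsilon> > 0" "square_integrable f" "square_integrable g"
  shows "truncated_hilbert \<epsilon> (\<lambda>x. f x + g x) x = truncated_hilbert \<epsilon> f x + truncated_hilbert \<epsilon> g x"
  unfolding truncated_hilbert_eq_conv conv_def distrib_left
  by (intro Bochner_Integration.integral_add integrable_conv_L2 square_integrable_riesz_trunc assms)

lemma truncated_hilbert_scaleR: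
  "truncated_hilbert \<epsilon> (\<lambda>x. r *\<^sub>R f x) x = r *\<^sub>R truncated_hilbert \<epsilon> f x"
  unfolding truncated_hilbert_eq_conv conv_def mult_scaleR_right
  by (rule Bochner_Integration.integral_scaleR_right)

text \<open>The kernel is odd, so an annulus on which \<open>f\<close> is constant contributes nothing.\<close>

lemma truncated_hilbert_locally_const:
  assumes f: "square_integrable f" and \<epsilon>: "0 < \<epsilon>" "\<epsilon> \<le> \<delta>"
    and const: "\<And>y. norm (x - y) \<le> \<delta> \<Longrightarrow> f y = f x"
  shows "truncated_hilbert \<epsilon> f x = truncated_hilbert \<delta> f x"
proof -
  let ?d = "\<lambda>z. riesz_trunc \<epsilon> z - riesz_trunc \<delta> z"
  have i: "integrable lborel (\<lambda>z. riesz_trunc \<epsilon> z * f (x - z))" "integrable lborel (\<lambda>z. riesz_trunc \<delta> z * f (x - z))"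
    using \<epsilon> by (auto intro!: integrable_conv_L2 square_integrable_riesz_trunc f)
  have "truncated_hilbert \<epsilon> f x - truncated_hilbert \<delta> f x = (\<integral>z. ?d z * f (x - z) \<partial>lborel)"
    unfolding truncated_hilbert_eq_conv conv_def left_diff_distrib
    by (rule Bochner_Integration.integral_diff[OF i, symmetric])
  also have "\<dots> = (\<integral>z. ?d z * f x \<partial>lborel)"
  proof (intro Bochner_Integration.integral_cong refl)
    fix z
    show "?d z * f (x - z) = ?d z * f x"
    proof (cases "norm z \<le> \<delta>")
      case True
      then show ?thesis using const[of "x - z"] by simp
    next
      case False
      then have "?d z = 0" using \<epsilon> by (simp add: riesz_trunc_def)
      then show ?thesis by simp
    qed
  qed
  also have "\<dots> = 0"
    by (rule integral_odd) (simp add: riesz_trunc_def vec_cl_linear)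
  finally show ?thesis by simp
qed

theorem hilbert_eq: "hilbert = hilbert_op"
proof -
  define T where "T = {(abs_l2 f, abs_l2 g) | f g. square_integrable f \<and> square_integrable g \<and>
     (AE x in lborel. ((\<lambda>\<epsilon>. truncated_hilbert \<epsilon> f x) \<longlongrightarrow> g x) (at_right 0))}"
  have T_hilbert_op: "G = hilbert_op F" if "(F, G) \<in> T" for F G
  proof -
    obtain f g where fg: "F = abs_l2 f" "G = abs_l2 g" "square_integrable f" "square_integrable g"
      "AE x in lborel. ((\<lambda>\<epsilon>. truncated_hilbert \<epsilon> f x) \<longlongrightarrow> g x) (at_right 0)"
      using \<open>(F, G) \<in> T\<close> unfolding T_def by blast
    have "abs_l2 g = abs_l2 (rep_l2 (hilbert_op (abs_l2 f)))"
      by (rule abs_l2_eqI[OF fg(4) square_integrable_rep_l2 principal_value_eq[OF fg(3,5)]])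
    then show ?thesis by (simp only: fg(1,2) abs_l2_rep_l2)
  qed
  have pos: "\<forall>\<^sub>F \<epsilon> in at_right (0::real). \<epsilon> > 0" by (rule eventually_at_right_less)
  have sub: "subspace (fst ` T)"
    unfolding subspace_def
  proof (intro conjI ballI allI)
    have "truncated_hilbert \<epsilon> (\<lambda>_. 0) x = 0" for \<epsilon> x
      by (simp add: truncated_hilbert_eq_conv conv_def)
    then have "(abs_l2 (\<lambda>_. 0), abs_l2 (\<lambda>_. 0)) \<in> T"
      unfolding T_def using square_integrable_0 by (intro CollectI exI[of _ "\<lambda>_. 0"]) simp
    then show "0 \<in> fst ` T" unfolding abs_l2_0 by (rule image_eqI[rotated]) simp
    fix F c assume "F \<in> fst ` T"
    then obtain f g where f: "F = abs_l2 f" "square_integrable f" "square_integrable g"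
      "AE x in lborel. ((\<lambda>\<epsilon>. truncated_hilbert \<epsilon> f x) \<longlongrightarrow> g x) (at_right 0)"
      unfolding T_def by auto
    have "AE x in lborel. ((\<lambda>\<epsilon>. truncated_hilbert \<epsilon> (\<lambda>x. c *\<^sub>R f x) x) \<longlongrightarrow> c *\<^sub>R g x) (at_right 0)"
      using f(4) unfolding truncated_hilbert_scaleR by eventually_elim (intro tendsto_scaleR tendsto_const)
    then have "(c *\<^sub>R F, abs_l2 (\<lambda>x. c *\<^sub>R g x)) \<in> T"
      unfolding T_def f(1) abs_l2_scaleR[OF f(2), symmetric]
      using square_integrable_scaleR[OF f(2)] square_integrable_scaleR[OF f(3)] by blast
    then show "c *\<^sub>R F \<in> fst ` T" by (rule image_eqI[rotated]) simp
    fix F' assume "F' \<in> fst ` T"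
    then obtain f' g' where f': "F' = abs_l2 f'" "square_integrable f'" "square_integrable g'"
      "AE x in lborel. ((\<lambda>\<epsilon>. truncated_hilbert \<epsilon> f' x) \<longlongrightarrow> g' x) (at_right 0)"
      unfolding T_def by auto
    have "AE x in lborel. ((\<lambda>\<epsilon>. truncated_hilbert \<epsilon> (\<lambda>x. f x + f' x) x) \<longlongrightarrow> g x + g' x) (at_right 0)"
      using f(4) f'(4)
    proof eventually_elim
      fix x
      assume lim: "((\<lambda>\<epsilon>. truncated_hilbert \<epsilon> f x) \<longlongrightarrow> g x) (at_right 0)"
        "((\<lambda>\<epsilon>. truncated_hilbert \<epsilon> f' x) \<longlongrightarrow> g' x) (at_right 0)"
      have "\<forall>\<^sub>F \<epsilon> in at_right 0. truncated_hilbert \<epsilon> f x + truncated_hilbert \<epsilon> f' x = truncated_hilbert \<epsilon> (\<lambda>x. f x + f' x) x"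
        using pos by eventually_elim (rule truncated_hilbert_add[OF _ f(2) f'(2), symmetric])
      then show "((\<lambda>\<epsilon>. truncated_hilbert \<epsilon> (\<lambda>x. f x + f' x) x) \<longlongrightarrow> g x + g' x) (at_right 0)"
        by (rule Lim_transform_eventually[OF tendsto_add[OF lim]])
    qed
    then have "(F + F', abs_l2 (\<lambda>x. g x + g' x)) \<in> T"
      unfolding T_def f(1) f'(1) abs_l2_add[OF f(2) f'(2), symmetric]
      using square_integrable_add[OF f(2) f'(2)] square_integrable_add[OF f(3) f'(3)] by blast
    then show "F + F' \<in> fst ` T" by (rule image_eqI[rotated]) simp
  qed
  have "F \<in> closure (fst ` T)" for F
  proof (rule l2_step_induct)
    show "closed (closure (fst ` T))" by simp
    show "subspace (closure (fst ` T))" by (rule closure_of_subspace[OF sub])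
    fix B :: "(real^2) set" and c :: cl2
    assume B: "bounded B" "open B" "negligible (frontier B)"
    define f where "f = (\<lambda>x. indicator B x *\<^sub>R c)"
    have f: "square_integrable f"
      unfolding f_def by (rule square_integrable_indicator_bounded[OF B(1,2)])
    have ex: "AE x in lborel. \<exists>l. ((\<lambda>\<epsilon>. truncated_hilbert \<epsilon> f x) \<longlongrightarrow> l) (at_right 0)"
      using AE_negligible[OF B(3)]
    proof eventually_elim
      fix x assume "x \<notin> frontier B"
      from indicator_eventually_const[OF this, where ?'b = real]
      obtain d where d: "d > 0" "\<And>y. dist y x < d \<Longrightarrow> indicator B y = (indicator B x :: real)"
        unfolding eventually_nhds_metric by blast
      define \<delta> where "\<delta> = d / 2"
      have \<delta>: "\<delta> > 0" "\<delta> < d" using d by (auto simp: \<delta>_def)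
      have const: "f y = f x" if "norm (x - y) \<le> \<delta>" for y
        using d(2)[of y] that \<delta> unfolding f_def by (simp add: dist_norm norm_minus_commute)
      have "\<forall>\<^sub>F \<epsilon> in at_right 0. \<epsilon> \<in> {0<..<\<delta>}" by (rule eventually_at_right_real[OF \<delta>(1)])
      then have "\<forall>\<^sub>F \<epsilon> in at_right 0. truncated_hilbert \<epsilon> f x = truncated_hilbert \<delta> f x"
        by eventually_elim (rule truncated_hilbert_locally_const[OF f _ _ const], auto)
      then show "\<exists>l. ((\<lambda>\<epsilon>. truncated_hilbert \<epsilon> f x) \<longlongrightarrow> l) (at_right 0)"
        by (intro exI tendsto_eventually)
    qed
    define L where "L x = (SOME l. ((\<lambda>\<epsilon>. truncated_hilbert \<epsilon> f x) \<longlongrightarrow> l) (at_right 0))" for x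
    have L: "AE x in lborel. ((\<lambda>\<epsilon>. truncated_hilbert \<epsilon> f x) \<longlongrightarrow> L x) (at_right 0)"
      using ex unfolding L_def by eventually_elim (rule someI_ex)
    have "AE x in lborel. ((\<lambda>\<epsilon>. truncated_hilbert \<epsilon> f x) \<longlongrightarrow> rep_l2 (hilbert_op (abs_l2 f)) x) (at_right 0)"
      using L principal_value_eq[OF f L] by eventually_elim (simp only:)
    then have "(abs_l2 f, abs_l2 (rep_l2 (hilbert_op (abs_l2 f)))) \<in> T"
      unfolding T_def using f square_integrable_rep_l2 by blast
    then have "abs_l2 f \<in> fst ` T" by (rule image_eqI[rotated]) simp
    then show "abs_l2 (\<lambda>x. indicator B x *\<^sub>R c) \<in> closure (fst ` T)"
      unfolding f_def by (rule closure_subset[THEN subsetD])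
  qed
  then have "closure (fst ` T) = UNIV" by blast
  moreover have "continuous_on UNIV hilbert_op"
    by (rule linear_continuous_on[OF bounded_linear_hilbert_op])
  ultimately show ?thesis
    unfolding hilbert_def T_def[symmetric] using T_hilbert_op by (intro l2_extension_eqI) auto
qed

section \<open>Rotors\<close>

text \<open>
  With \<open>\<omega> = s e\<^sub>2 s\<inverse> = s\<^sup>2 e\<^sub>2\<close> and \<open>s = cos \<phi> + sin \<phi> e\<^sub>1 e\<^sub>2\<close> one has
  \<open>\<omega> = - sin (2 \<phi>) e\<^sub>1 + cos (2 \<phi>) e\<^sub>2\<close>, which is solved for the half angle.
\<close>

definition rotor_sin :: "real^2 \<Rightarrow> real" where
  "rotor_sin \<omega> = sqrt ((1 - \<omega> $ 2) / 2)"

definition rotor_cos :: "real^2 \<Rightarrow> real" where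
  "rotor_cos \<omega> = (if \<omega> $ 2 = 1 then 1 else - (\<omega> $ 1) / (2 * rotor_sin \<omega>))"

definition spinor :: "real \<Rightarrow> real \<Rightarrow> cl2" where
  "spinor c d = Cl2 (of_real c) 0 0 (of_real d)"

lemma spinor_eq: "of_real c + of_real d * (e1 * e2) = spinor c d"
  by (simp add: spinor_def of_real_def cl2_eq_iff cl2_ring_defs e1_def e2_def scaleR_cl2_def complex_eq_iff)

lemma spinor_inverse:
  assumes "c\<^sup>2 + d\<^sup>2 = 1"
  shows "spinor c d * spinor c (- d) = 1" "spinor c (- d) * spinor c d = 1"
proof -
  have "complex_of_real c * of_real c + of_real d * of_real d = 1"
    using assms by (simp add: power2_eq_square flip: of_real_mult of_real_add)
  then show "spinor c d * spinor c (- d) = 1" "spinor c (- d) * spinor c d = 1"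
    by (simp_all add: spinor_def cl2_eq_iff cl2_ring_defs mult.commute)
qed

lemma cl_inv_spinor:
  assumes "c\<^sup>2 + d\<^sup>2 = 1"
  shows "cl_inv (spinor c d) = spinor c (- d)"
  unfolding cl_inv_def
proof (rule the_equality)
  show "spinor c d * spinor c (- d) = 1 \<and> spinor c (- d) * spinor c d = 1"
    using spinor_inverse[OF assms] by blast
  fix t assume t: "spinor c d * t = 1 \<and> t * spinor c d = 1"
  have "t = (spinor c (- d) * spinor c d) * t" by (simp only: spinor_inverse[OF assms] mult_1_left)
  also have "\<dots> = spinor c (- d)" by (simp only: mult.assoc t mult_1_right)
  finally show "t = spinor c (- d)" .
qed

lemma spinor_conj_e2:
  "spinor c d * e2 * spinor c (- d) = (- (2 * c * d)) *\<^sub>R e1 + (c\<^sup>2 - d\<^sup>2) *\<^sub>R e2"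
  by (simp add: spinor_def cl2_eq_iff cl2_ring_defs e1_def e2_def scaleR_cl2_def complex_eq_iff power2_eq_square)

lemma vec_cl_eq_iff: "a *\<^sub>R e1 + b *\<^sub>R e2 = vec_cl \<omega> \<longleftrightarrow> \<omega> $ 1 = a \<and> \<omega> $ 2 = b"
  by (auto simp: vec_cl_def cl2_eq_iff cl2_ring_defs e1_def e2_def scaleR_cl2_def complex_eq_iff)

lemma
  assumes \<omega>: "norm \<omega> = 1"
  shows rotor_eq: "rotor \<omega> = spinor (rotor_cos \<omega>) (rotor_sin \<omega>)"
    and rotor_unit: "(rotor_cos \<omega>)\<^sup>2 + (rotor_sin \<omega>)\<^sup>2 = 1"
    and rotor_conj: "spinor (rotor_cos \<omega>) (rotor_sin \<omega>) * e2 * spinor (rotor_cos \<omega>) (- rotor_sin \<omega>) = vec_cl \<omega>"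
proof -
  let ?c = "rotor_cos \<omega>" and ?d = "rotor_sin \<omega>"
  have n: "(\<omega> $ 1)\<^sup>2 + (\<omega> $ 2)\<^sup>2 = 1"
    using \<omega> norm_sq_2D[of \<omega>] by simp
  have le: "\<omega> $ 2 \<le> 1"
    using \<omega> component_le_norm_cart[of \<omega> 2] by simp
  have d: "?d \<ge> 0" "?d\<^sup>2 = (1 - \<omega> $ 2) / 2"
    using le by (auto simp: rotor_sin_def)
  have cd: "- (2 * ?c * ?d) = \<omega> $ 1 \<and> ?c\<^sup>2 + ?d\<^sup>2 = 1"
  proof (cases "\<omega> $ 2 = 1")
    case True
    then have "?d = 0" "?c = 1" "\<omega> $ 1 = 0"
      using n by (auto simp: rotor_sin_def rotor_cos_def)
    then show ?thesis by simp
  next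
    case False
    then have d0: "?d > 0" using le by (simp add: rotor_sin_def)
    have c: "?c = - (\<omega> $ 1) / (2 * ?d)" using False by (simp add: rotor_cos_def)
    have "?c\<^sup>2 = (\<omega> $ 1)\<^sup>2 / (4 * ?d\<^sup>2)"
      unfolding c by (simp add: power_divide power_mult_distrib)
    also have "(\<omega> $ 1)\<^sup>2 = (1 - \<omega> $ 2) * (1 + \<omega> $ 2)"
      using n by (simp add: power2_eq_square algebra_simps)
    also have "\<dots> / (4 * ?d\<^sup>2) = (1 - \<omega> $ 2) * (1 + \<omega> $ 2) / (2 * (1 - \<omega> $ 2))"
    proof -
      have "4 * ?d\<^sup>2 = 2 * (1 - \<omega> $ 2)" unfolding d(2) by simp
      then show ?thesis by (simp only:)
    qed
    also have "\<dots> = (1 + \<omega> $ 2) / 2"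
    proof -
      have "a * b / (2 * a) = b / 2" if "a \<noteq> 0" for a b :: real
        using that by simp
      then show ?thesis using False by (metis right_minus_eq)
    qed
    finally have c2: "?c\<^sup>2 = (1 + \<omega> $ 2) / 2" .
    have "?c\<^sup>2 + ?d\<^sup>2 = 1" unfolding c2 d(2) by (simp add: field_simps)
    moreover have "- (2 * ?c * ?d) = \<omega> $ 1" using c d0 by (simp add: field_simps)
    ultimately show ?thesis by blast
  qed
  then show unit: "?c\<^sup>2 + ?d\<^sup>2 = 1" by simp
  have "?c\<^sup>2 - ?d\<^sup>2 = \<omega> $ 2" using unit d(2) by (simp add: field_simps)
  then show conj: "spinor ?c ?d * e2 * spinor ?c (- ?d) = vec_cl \<omega>"
    unfolding spinor_conj_e2 vec_cl_eq_iff using cd by simp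
  show "rotor \<omega> = spinor ?c ?d"
    unfolding rotor_def spinor_eq
  proof (rule the_equality)
    obtain t where t: "0 \<le> t" "t \<le> pi" "?c = cos t" "?d = sin t"
      using sincos_total_pi[OF d(1) unit] by blast
    have "t \<noteq> pi"
    proof
      assume "t = pi"
      then have "?d = 0" "?c = - 1" using t by auto
      then show False using d(2) by (auto simp: rotor_cos_def split: if_splits)
    qed
    then have "t \<in> {0..<pi}" using t by auto
    moreover have "spinor ?c ?d * e2 * cl_inv (spinor ?c ?d) = vec_cl \<omega>"
      unfolding cl_inv_spinor[OF unit] by (rule conj)
    ultimately show "(\<exists>\<phi>\<in>{0..<pi}. spinor ?c ?d = spinor (cos \<phi>) (sin \<phi>)) \<and> spinor ?c ?d * e2 * cl_inv (spinor ?c ?d) = vec_cl \<omega>"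
      using t(3,4) by (intro conjI bexI[of _ t]) auto
    fix s
    assume "(\<exists>\<phi>\<in>{0..<pi}. s = spinor (cos \<phi>) (sin \<phi>)) \<and> s * e2 * cl_inv s = vec_cl \<omega>"
    then obtain \<phi> where \<phi>: "0 \<le> \<phi>" "\<phi> < pi" "s = spinor (cos \<phi>) (sin \<phi>)" and s: "s * e2 * cl_inv s = vec_cl \<omega>"
      by auto
    have "\<omega> $ 1 = - (2 * cos \<phi> * sin \<phi>) \<and> \<omega> $ 2 = (cos \<phi>)\<^sup>2 - (sin \<phi>)\<^sup>2"
      using s unfolding \<phi>(3) cl_inv_spinor[OF sin_cos_squared_add2] spinor_conj_e2 vec_cl_eq_iff .
    then have o1: "\<omega> $ 1 = - (2 * cos \<phi> * sin \<phi>)" and o2: "\<omega> $ 2 = 1 - 2 * (sin \<phi>)\<^sup>2"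
      by (auto simp: cos_squared_eq)
    have "0 \<le> sin \<phi>" using \<phi> by (intro sin_ge_zero) auto
    then have sin: "?d = sin \<phi>" unfolding rotor_sin_def o2 by simp
    have "?c = cos \<phi>"
    proof (cases "\<omega> $ 2 = 1")
      case True
      then have "sin \<phi> = 0" using o2 by simp
      then have "\<phi> = 0" using \<phi>(1,2) sin_gt_zero[of \<phi>] by (cases "\<phi> = 0") auto
      then show ?thesis using True by (simp add: rotor_cos_def)
    next
      case False
      then have "sin \<phi> \<noteq> 0" using o2 by auto
      then show ?thesis using False sin o1 by (simp add: rotor_cos_def)
    qed
    then show "s = spinor ?c ?d" using sin \<phi>(3) by simp
  qed
qed

definition rot :: "real^2 \<Rightarrow> cl2" where
  "rot y = rotor (y /\<^sub>R norm y)"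

definition rot_inv :: "real^2 \<Rightarrow> cl2" where
  "rot_inv y = spinor (rotor_cos (y /\<^sub>R norm y)) (- rotor_sin (y /\<^sub>R norm y))"

lemma
  assumes "y \<noteq> 0"
  shows rot_rot_inv: "rot y * rot_inv y = 1"
    and rot_inv_rot: "rot_inv y * rot y = 1"
    and hilbert_symbol_rot: "hilbert_symbol y * rot y = rot y * (of_complex (- \<i>) * e2)"
proof -
  let ?\<omega> = "y /\<^sub>R norm y"
  have n: "norm ?\<omega> = 1" using assms by simp
  have r: "rot y = spinor (rotor_cos ?\<omega>) (rotor_sin ?\<omega>)"
    unfolding rot_def by (rule rotor_eq[OF n])
  show 1: "rot y * rot_inv y = 1" and 2: "rot_inv y * rot y = 1"
    unfolding r rot_inv_def using spinor_inverse[OF rotor_unit[OF n]] by blast+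
  have "hilbert_symbol y = of_complex (- \<i>) * vec_cl ?\<omega>"
    by (simp add: hilbert_symbol_def vec_cl_linear inverse_eq_divide)
  also have "vec_cl ?\<omega> = rot y * e2 * rot_inv y"
    unfolding r rot_inv_def by (rule rotor_conj[OF n, symmetric])
  finally have "hilbert_symbol y * rot y = of_complex (- \<i>) * (rot y * e2 * (rot_inv y * rot y))"
    by (simp only: mult.assoc)
  also have "\<dots> = rot y * (of_complex (- \<i>) * e2)"
    by (simp only: 2 mult_1_right mult_of_complex)
  finally show "hilbert_symbol y * rot y = rot y * (of_complex (- \<i>) * e2)" .
qed

lemma borel_measurable_Cl2 [measurable (raw)]:
  assumes [measurable]: "a \<in> borel_measurable M" "b \<in> borel_measurable M" "c \<in> borel_measurable M" "d \<in> borel_measurable M"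
  shows "(\<lambda>x. Cl2 (a x) (b x) (c x) (d x)) \<in> borel_measurable M"
proof -
  have "Cl2 p q r s = of_complex p + of_complex q * e1 + of_complex r * e2 + of_complex s * (e1 * e2)" for p q r s
    using cl2_expand[of "Cl2 p q r s"] by simp
  then show ?thesis by simp
qed

lemma borel_measurable_spinor_rotor:
  "(\<lambda>y. spinor (rotor_cos (y /\<^sub>R norm y)) (rotor_sin (y /\<^sub>R norm y))) \<in> borel_measurable borel"
  "rot_inv \<in> borel_measurable borel"
  unfolding rot_inv_def[abs_def] spinor_def rotor_cos_def rotor_sin_def by measurable

lemma borel_measurable_rot [measurable]: "rot \<in> borel_measurable borel"
proof -
  have eq: "rot = (\<lambda>y. if y = 0 then rotor 0 else spinor (rotor_cos (y /\<^sub>R norm y)) (rotor_sin (y /\<^sub>R norm y)))"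
    by (auto simp: rot_def fun_eq_iff intro!: rotor_eq)
  note [measurable] = borel_measurable_spinor_rotor(1)
  show ?thesis by (subst eq) measurable
qed

lemma borel_measurable_rot_inv [measurable]: "rot_inv \<in> borel_measurable borel"
  by (rule borel_measurable_spinor_rotor(2))

lemma norm_spinor: "c\<^sup>2 + d\<^sup>2 = 1 \<Longrightarrow> norm (spinor c d) = 1"
  by (rule power2_eq_imp_eq) (simp_all add: power2_norm_cl2 spinor_def)

lemma rot_bounded: "\<exists>C. \<forall>y. norm (rot y) \<le> C \<and> norm (rot_inv y) \<le> C"
proof -
  have "norm (rot y) \<le> 1 \<and> norm (rot_inv y) \<le> 1" if "y \<noteq> 0" for y
  proof -
    have n: "norm (y /\<^sub>R norm y) = 1" using that by simp
    show ?thesis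
      unfolding rot_def rot_inv_def rotor_eq[OF n] using rotor_unit[OF n] by (simp add: norm_spinor)
  qed
  then show ?thesis
    by (intro exI[of _ "1 + norm (rot 0) + norm (rot_inv 0)"]) (smt (verit) norm_ge_zero)
qed

section \<open>The frequency spaces\<close>

text \<open>
  \<open>cl_u\<close>, \<open>cl_u e\<^sub>1\<close>, \<open>cl_v\<close>, \<open>cl_v e\<^sub>1\<close> are Hermitian orthogonal of square norm \<open>4\<close>, and left
  multiplication by \<open>e\<^sub>2\<close> is \<open>- \<i>\<close> on the first two and \<open>\<i>\<close> on the last two.
\<close>

definition coef :: "cl2 \<Rightarrow> cl2 \<Rightarrow> complex" where
  "coef w x = (cl_0 x * cnj (cl_0 w) + cl_1 x * cnj (cl_1 w) + cl_2 x * cnj (cl_2 w) + cl_12 x * cnj (cl_12 w)) / 4"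

lemma cl_uv_eq:
  "cl_u = Cl2 1 1 \<i> (- \<i>)" "cl_u * e1 = Cl2 (- 1) 1 (- \<i>) (- \<i>)"
  "cl_v = Cl2 (- 1) 1 \<i> \<i>" "cl_v * e1 = Cl2 (- 1) (- 1) \<i> (- \<i>)"
  by (simp_all add: cl_u_def cl_v_def cl2_eq_iff cl2_ring_defs e1_def e2_def of_complex_def)

lemma e2_cl_uv:
  "(of_complex (- \<i>) * e2) * cl_u = - cl_u" "(of_complex (- \<i>) * e2) * (cl_u * e1) = - (cl_u * e1)"
  "(of_complex (- \<i>) * e2) * cl_v = cl_v" "(of_complex (- \<i>) * e2) * (cl_v * e1) = cl_v * e1"
  unfolding cl_uv_eq by (simp_all add: cl2_eq_iff cl2_ring_defs e1_def e2_def of_complex_def)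

lemma coef_expand:
  "x = of_complex (coef cl_u x) * cl_u + of_complex (coef (cl_u * e1) x) * (cl_u * e1)
     + of_complex (coef cl_v x) * cl_v + of_complex (coef (cl_v * e1) x) * (cl_v * e1)"
  unfolding cl_uv_eq by (simp add: coef_def cl2_eq_iff cl2_ring_defs e1_def of_complex_def field_simps)

lemma coef_simps:
  "coef cl_u (of_complex a * cl_u) = a" "coef cl_u (of_complex a * (cl_u * e1)) = 0"
  "coef cl_v (of_complex a * cl_v) = a" "coef cl_v (of_complex a * (cl_v * e1)) = 0"
  unfolding cl_uv_eq by (simp_all add: coef_def cl2_ring_defs e1_def of_complex_def)

lemma coef_zero [simp]: "coef w 0 = 0"
  by (simp add: coef_def zero_cl2_def)

lemma bounded_linear_coef: "bounded_linear (coef w)"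
  unfolding linear_conv_bounded_linear[symmetric]
  by (rule linearI)
     (simp_all add: coef_def plus_cl2_def scaleR_cl2_def algebra_simps add_divide_distrib scaleR_conv_of_real)

lemma square_integrable_twist:
  fixes \<alpha> :: "real^2 \<Rightarrow> complex"
  assumes "square_integrable \<alpha>"
  shows "square_integrable (\<lambda>y. rot y * of_complex (\<alpha> y) * w)"
proof -
  obtain C where C: "\<And>y. norm (rot y) \<le> C" using rot_bounded by blast
  note [measurable] = square_integrableD(1)[OF assms]
  show ?thesis
  proof (rule square_integrable_bound[OF assms])
    show "(\<lambda>y. rot y * of_complex (\<alpha> y) * w) \<in> borel_measurable borel" by measurable
    show "norm (rot y * of_complex (\<alpha> y) * w) \<le> (4 * C * norm w) * norm (\<alpha> y)" for y
    proof -
      have "rot y * of_complex (\<alpha> y) * w = of_complex (\<alpha> y) * (rot y * w)"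
        by (simp only: mult.assoc mult_of_complex)
      then have "norm (rot y * of_complex (\<alpha> y) * w) = norm (\<alpha> y) * norm (rot y * w)"
        by (simp only: norm_of_complex_mult)
      also have "\<dots> \<le> norm (\<alpha> y) * (4 * C * norm w)"
        using C[of y] by (intro mult_left_mono order_trans[OF norm_cl2_mult_le] mult_right_mono) auto
      finally show ?thesis by (simp only: mult.commute)
    qed
  qed
qed

lemma L_space_iff: "G \<in> L_space w \<longleftrightarrow> (\<exists>\<alpha>. square_integrable \<alpha> \<and> G = abs_l2 (\<lambda>y. rot y * of_complex (\<alpha> y) * w))"
  unfolding L_space_def rot_def by blast

lemma AE_nonzero: "AE y in lborel. y \<noteq> (0 :: real^2)"
  by (rule AE_lborel_singleton)

lemma hilbert_symbol_L_space:
  assumes w: "(of_complex (- \<i>) * e2) * w = of_complex c * w" and G: "G \<in> L_space w"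
  shows "l2_mult hilbert_symbol G = c *\<^sub>C G"
proof -
  obtain \<alpha> where \<alpha>: "square_integrable \<alpha>" "G = abs_l2 (\<lambda>y. rot y * of_complex (\<alpha> y) * w)"
    using G unfolding L_space_iff by blast
  note sq = square_integrable_twist[OF \<alpha>(1), of w]
  have "abs_l2 (\<lambda>y. hilbert_symbol y * (rot y * of_complex (\<alpha> y) * w)) = abs_l2 (\<lambda>y. of_complex c * (rot y * of_complex (\<alpha> y) * w))"
  proof (rule abs_l2_eqI)
    show "AE y in lborel. hilbert_symbol y * (rot y * of_complex (\<alpha> y) * w) = of_complex c * (rot y * of_complex (\<alpha> y) * w)"
      using AE_nonzero
    proof eventually_elim
      fix y :: "real^2" assume y: "y \<noteq> 0"
      have "hilbert_symbol y * (rot y * of_complex (\<alpha> y) * w) = (hilbert_symbol y * rot y) * (of_complex (\<alpha> y) * w)"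
        by (simp only: mult.assoc)
      also have "\<dots> = rot y * ((of_complex (- \<i>) * e2) * (of_complex (\<alpha> y) * w))"
        by (simp only: hilbert_symbol_rot[OF y] mult.assoc)
      also have "(of_complex (- \<i>) * e2) * (of_complex (\<alpha> y) * w) = of_complex (\<alpha> y) * (of_complex c * w)"
        by (simp only: mult_of_complex[of "of_complex (- \<i>) * e2"] w)
      also have "rot y * (of_complex (\<alpha> y) * (of_complex c * w)) = of_complex c * (rot y * (of_complex (\<alpha> y) * w))"
        by (simp only: mult_of_complex[of "of_complex (\<alpha> y)" c] mult_of_complex[of "rot y" c])
      finally show "hilbert_symbol y * (rot y * of_complex (\<alpha> y) * w) = of_complex c * (rot y * of_complex (\<alpha> y) * w)"
        by (simp only: mult.assoc)
    qed
  qed (intro hilbert_symbol.square_integrable_m square_integrable_cmult sq)+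
  then show ?thesis
    unfolding \<alpha>(2) hilbert_symbol.l2_mult_abs[OF sq] abs_l2_scaleC[OF sq] .
qed

lemma hilbert_symbol_L_spaces:
  "G \<in> L_space cl_u \<Longrightarrow> l2_mult hilbert_symbol G = - G"
  "G \<in> L_space (cl_u * e1) \<Longrightarrow> l2_mult hilbert_symbol G = - G"
  "G \<in> L_space cl_v \<Longrightarrow> l2_mult hilbert_symbol G = G"
  "G \<in> L_space (cl_v * e1) \<Longrightarrow> l2_mult hilbert_symbol G = G"
proof -
  have m1: "of_complex (- 1) * w = - w" for w by (simp add: of_complex_minus)
  have n1: "(- 1) *\<^sub>C G = - G" for G using scaleC_of_real[of "- 1" G] by simp
  show "G \<in> L_space cl_u \<Longrightarrow> l2_mult hilbert_symbol G = - G"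
    using hilbert_symbol_L_space[of cl_u "- 1" G] e2_cl_uv by (simp only: m1 n1)
  show "G \<in> L_space (cl_u * e1) \<Longrightarrow> l2_mult hilbert_symbol G = - G"
    using hilbert_symbol_L_space[of "cl_u * e1" "- 1" G] e2_cl_uv by (simp only: m1 n1)
  show "G \<in> L_space cl_v \<Longrightarrow> l2_mult hilbert_symbol G = G"
    using hilbert_symbol_L_space[of cl_v 1 G] e2_cl_uv by (simp only: of_complex_simps mult_1_left scaleC_one)
  show "G \<in> L_space (cl_v * e1) \<Longrightarrow> l2_mult hilbert_symbol G = G"
    using hilbert_symbol_L_space[of "cl_v * e1" 1 G] e2_cl_uv by (simp only: of_complex_simps mult_1_left scaleC_one)
qed

lemma L_space_decomposition:
  obtains A B C D where "G = A + B + C + D" "A \<in> L_space cl_u" "B \<in> L_space (cl_u * e1)"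
    "C \<in> L_space cl_v" "D \<in> L_space (cl_v * e1)"
proof -
  define g where "g = rep_l2 G"
  have g: "square_integrable g" by (simp add: g_def)
  note [measurable] = square_integrableD(1)[OF g]
  define \<alpha> where "\<alpha> w y = coef w (rot_inv y * g y)" for w y
  have \<alpha>: "square_integrable (\<alpha> w)" for w
  proof -
    obtain C where C: "\<And>y. norm (rot_inv y) \<le> C" using rot_bounded by blast
    obtain K where K: "\<And>x. norm (coef w x) \<le> norm x * K" "K \<ge> 0"
      using bounded_linear.nonneg_bounded[OF bounded_linear_coef] by blast
    show ?thesis
    proof (rule square_integrable_bound[OF g])
      show "\<alpha> w \<in> borel_measurable borel"
        unfolding \<alpha>_def[abs_def]
        by (rule measurable_compose[OF _ borel_measurable_continuous_onI[OF linear_continuous_on[OF bounded_linear_coef]]]) measurable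
      show "norm (\<alpha> w y) \<le> (4 * C * K) * norm (g y)" for y
      proof -
        have "norm (\<alpha> w y) \<le> norm (rot_inv y * g y) * K" unfolding \<alpha>_def by (rule K)
        also have "\<dots> \<le> (4 * norm (rot_inv y) * norm (g y)) * K"
          by (intro mult_right_mono norm_cl2_mult_le K)
        also have "\<dots> \<le> (4 * C * norm (g y)) * K"
          using C[of y] K(2) by (intro mult_right_mono) auto
        finally show ?thesis by (simp only: mult_ac)
      qed
    qed
  qed
  define P where "P w = (\<lambda>y. rot y * of_complex (\<alpha> w y) * w)" for w
  have P: "square_integrable (P w)" for w unfolding P_def by (rule square_integrable_twist[OF \<alpha>])
  have PL: "abs_l2 (P w) \<in> L_space w" for w
    unfolding L_space_iff P_def using \<alpha> by blast
  have "AE y in lborel. g y = P cl_u y + P (cl_u * e1) y + P cl_v y + P (cl_v * e1) y"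
    using AE_nonzero
  proof eventually_elim
    fix y :: "real^2" assume y: "y \<noteq> 0"
    have "g y = rot y * (rot_inv y * g y)" by (simp only: mult.assoc[symmetric] rot_rot_inv[OF y] mult_1_left)
    also have "\<dots> = rot y * (of_complex (\<alpha> cl_u y) * cl_u + of_complex (\<alpha> (cl_u * e1) y) * (cl_u * e1)
     + of_complex (\<alpha> cl_v y) * cl_v + of_complex (\<alpha> (cl_v * e1) y) * (cl_v * e1))"
      unfolding \<alpha>_def by (subst coef_expand[of "rot_inv y * g y"]) (rule refl)
    also have "\<dots> = P cl_u y + P (cl_u * e1) y + P cl_v y + P (cl_v * e1) y"
      unfolding P_def by (simp only: distrib_left mult.assoc)
    finally show "g y = P cl_u y + P (cl_u * e1) y + P cl_v y + P (cl_v * e1) y" .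
  qed
  then have "abs_l2 g = abs_l2 (\<lambda>y. P cl_u y + P (cl_u * e1) y + P cl_v y + P (cl_v * e1) y)"
    by (intro abs_l2_eqI g square_integrable_add P)
  also have "\<dots> = abs_l2 (P cl_u) + abs_l2 (P (cl_u * e1)) + abs_l2 (P cl_v) + abs_l2 (P (cl_v * e1))"
    by (simp only: abs_l2_add square_integrable_add P)
  finally have "G = abs_l2 (P cl_u) + abs_l2 (P (cl_u * e1)) + abs_l2 (P cl_v) + abs_l2 (P (cl_v * e1))"
    by (simp only: g_def abs_l2_rep_l2)
  from this PL PL PL PL show thesis by (rule that)
qed

lemma L_space_zero: "0 \<in> L_space w"
  unfolding L_space_iff
  by (rule exI[of _ "\<lambda>_. 0"]) (simp add: square_integrable_0 abs_l2_0)

lemma L_space_Int: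
  assumes w: "\<And>a. coef w (of_complex a * w) = a" "\<And>a. coef w (of_complex a * w') = 0"
  shows "L_space w \<inter> L_space w' = {0}"
proof (intro equalityI subsetI)
  fix G assume "G \<in> L_space w \<inter> L_space w'"
  then obtain \<alpha> \<beta> where \<alpha>: "square_integrable \<alpha>" "G = abs_l2 (\<lambda>y. rot y * of_complex (\<alpha> y) * w)"
    and \<beta>: "square_integrable \<beta>" "G = abs_l2 (\<lambda>y. rot y * of_complex (\<beta> y) * w')"
    unfolding L_space_iff Int_iff by blast
  have "AE y in lborel. rot y * of_complex (\<alpha> y) * w = rot y * of_complex (\<beta> y) * w'"
    using abs_l2_eq_iff[OF square_integrable_twist[OF \<alpha>(1)] square_integrable_twist[OF \<beta>(1)], of w w'] \<alpha>(2) \<beta>(2) by metis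
  with AE_nonzero have "AE y in lborel. rot y * of_complex (\<alpha> y) * w = 0"
  proof eventually_elim
    fix y :: "real^2" assume y: "y \<noteq> 0" and eq: "rot y * of_complex (\<alpha> y) * w = rot y * of_complex (\<beta> y) * w'"
    have "(rot_inv y * rot y) * (of_complex (\<alpha> y) * w) = (rot_inv y * rot y) * (of_complex (\<beta> y) * w')"
      using arg_cong[OF eq, of "\<lambda>x. rot_inv y * x"] by (simp only: mult.assoc)
    then have "of_complex (\<alpha> y) * w = of_complex (\<beta> y) * w'"
      by (simp only: rot_inv_rot[OF y] mult_1_left)
    from arg_cong[OF this, of "coef w"] have "\<alpha> y = 0" by (simp only: w)
    then show "rot y * of_complex (\<alpha> y) * w = 0" by simp
  qed
  then have "abs_l2 (\<lambda>y. rot y * of_complex (\<alpha> y) * w) = abs_l2 (\<lambda>_. 0)"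
    by (intro abs_l2_eqI square_integrable_twist \<alpha> square_integrable_0)
  then show "G \<in> {0}" unfolding \<alpha>(2) abs_l2_0 by simp
qed (simp add: L_space_zero)

lemma L_space_nonzero:
  assumes w: "\<And>a. coef w (of_complex a * w) = a"
  shows "\<exists>G\<in>L_space w. G \<noteq> 0"
proof -
  define \<alpha> where "\<alpha> = (\<lambda>y :: real^2. indicator (ball 0 1) y :: complex)"
  have \<alpha>: "square_integrable \<alpha>"
  proof -
    have "(norm (\<alpha> y))\<^sup>2 = indicator (ball 0 1) y" for y by (auto simp: \<alpha>_def indicator_def)
    moreover have "integrable lborel (indicator (ball 0 1) :: real^2 \<Rightarrow> real)"
      using emeasure_bounded_finite[of "ball (0 :: real^2) 1"] by (intro integrable_real_indicator) auto
    moreover have "\<alpha> \<in> borel_measurable borel" unfolding \<alpha>_def by (intro borel_measurable_indicator) simp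
    ultimately show ?thesis by (simp add: square_integrable_def)
  qed
  let ?G = "abs_l2 (\<lambda>y. rot y * of_complex (\<alpha> y) * w)"
  have "?G \<noteq> 0"
  proof
    assume "?G = 0"
    then have "AE y in lborel. rot y * of_complex (\<alpha> y) * w = 0"
      unfolding abs_l2_0[symmetric] by (subst (asm) abs_l2_eq_iff[OF square_integrable_twist[OF \<alpha>] square_integrable_0])
    with AE_nonzero have "AE y in lborel. y \<notin> ball (0 :: real^2) 1"
    proof eventually_elim
      fix y :: "real^2" assume y: "y \<noteq> 0" and eq: "rot y * of_complex (\<alpha> y) * w = 0"
      have "(rot_inv y * rot y) * (of_complex (\<alpha> y) * w) = 0"
        using arg_cong[OF eq, of "\<lambda>x. rot_inv y * x"] by (simp only: mult.assoc mult_zero_right)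
      then have "of_complex (\<alpha> y) * w = 0" by (simp only: rot_inv_rot[OF y] mult_1_left)
      from arg_cong[OF this, of "coef w"] have "\<alpha> y = 0" by (simp only: w coef_zero)
      then show "y \<notin> ball 0 1" by (auto simp: \<alpha>_def)
    qed
    then have "ball (0 :: real^2) 1 \<in> null_sets lborel"
      by (subst AE_iff_null_sets) auto
    then have "negligible (ball (0 :: real^2) 1)"
      by (simp add: negligible_iff_null_sets null_sets_completionI)
    then show False using open_not_negligible[of "ball (0 :: real^2) 1"] by simp
  qed
  moreover have "?G \<in> L_space w" unfolding L_space_iff using \<alpha> by blast
  ultimately show ?thesis by blast
qed

section \<open>The eigenspaces of the Hilbert transformation\<close>

lemma fourier_hilbert: "fourier (hilbert F) = l2_mult hilbert_symbol (fourier F)"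
  unfolding hilbert_eq by (rule fourier_hilbert_op)

lemma fourier_eq_iff: "fourier F = fourier G \<longleftrightarrow> F = G"
  using bij_fourier by (auto simp: bij_def inj_def)

lemma fourier_0 [simp]: "fourier 0 = 0"
  by (rule linear_0[OF linear_fourier])

lemma fourier_uminus: "fourier (- F) = - fourier F"
  by (rule linear_neg[OF linear_fourier])

lemma fourier_preimage: obtains F where "fourier F = G"
  using bij_fourier by (metis bij_pointE)

lemma bounded_linear_hilbert: "bounded_linear hilbert"
  unfolding hilbert_eq by (rule bounded_linear_hilbert_op)

lemma hilbert_add: "hilbert (F + G) = hilbert F + hilbert G"
  by (rule bounded_linear.linear[OF bounded_linear_hilbert, THEN linear_add])

lemma hilbert_scaleC: "hilbert (c *\<^sub>C F) = c *\<^sub>C hilbert F"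
proof -
  let ?m = "hilbert_symbol" and ?f = "rep_l2 (fourier F)"
  have f: "square_integrable ?f" by simp
  have "l2_mult ?m (c *\<^sub>C fourier F) = l2_mult ?m (abs_l2 (\<lambda>\<xi>. of_complex c * ?f \<xi>))"
    by (simp only: abs_l2_scaleC[OF f] abs_l2_rep_l2)
  also have "\<dots> = abs_l2 (\<lambda>\<xi>. of_complex c * (?m \<xi> * ?f \<xi>))"
    by (simp only: hilbert_symbol.l2_mult_abs[OF square_integrable_cmult[OF f]] mult_of_complex)
  also have "\<dots> = c *\<^sub>C l2_mult ?m (fourier F)"
    unfolding l2_mult_def by (rule abs_l2_scaleC[OF hilbert_symbol.square_integrable_m[OF f]])
  finally have "fourier (hilbert (c *\<^sub>C F)) = fourier (c *\<^sub>C hilbert F)"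
    by (simp only: fourier_hilbert fourier_scaleC)
  then show ?thesis by (simp only: fourier_eq_iff)
qed

lemma hilbert_H:
  "F \<in> H1_plus \<Longrightarrow> hilbert F = F" "F \<in> H2_plus \<Longrightarrow> hilbert F = F"
  "F \<in> H1_minus \<Longrightarrow> hilbert F = - F" "F \<in> H2_minus \<Longrightarrow> hilbert F = - F"
  unfolding H1_plus_def H2_plus_def H1_minus_def H2_minus_def vimage_eq
  by (simp_all only: fourier_eq_iff[of "hilbert F", symmetric] fourier_hilbert fourier_uminus hilbert_symbol_L_spaces)

lemma hilbert_H_plus: "F \<in> H_plus \<Longrightarrow> hilbert F = F"
  unfolding H_plus_def by (auto simp: hilbert_add hilbert_H)

lemma hilbert_H_minus: "F \<in> H_minus \<Longrightarrow> hilbert F = - F"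
  unfolding H_minus_def by (auto simp: hilbert_add hilbert_H)

lemma H_decomposition:
  obtains f g where "F = f + g" "f \<in> H_plus" "g \<in> H_minus"
proof -
  obtain A B C D where G: "fourier F = A + B + C + D" and L: "A \<in> L_space cl_u" "B \<in> L_space (cl_u * e1)"
    "C \<in> L_space cl_v" "D \<in> L_space (cl_v * e1)"
    by (rule L_space_decomposition)
  obtain a where a: "fourier a = A" by (rule fourier_preimage)
  obtain b where b: "fourier b = B" by (rule fourier_preimage)
  obtain c where c: "fourier c = C" by (rule fourier_preimage)
  obtain d where d: "fourier d = D" by (rule fourier_preimage)
  have "fourier F = fourier ((c + d) + (a + b))"
    unfolding fourier_add a b c d G by (simp only: add_ac)
  then have "F = (c + d) + (a + b)" by (simp only: fourier_eq_iff)
  moreover have "c + d \<in> H_plus" "a + b \<in> H_minus"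
    unfolding H_plus_def H_minus_def H1_plus_def H2_plus_def H1_minus_def H2_minus_def
    using a b c d L by auto
  ultimately show thesis by (rule that)
qed

lemma l2_eq_uminus_iff: "F = - F \<longleftrightarrow> F = 0" for F :: l2
proof
  assume "F = - F"
  then have "2 *\<^sub>R F = 0" by (simp only: scaleR_2 eq_neg_iff_add_eq_0)
  then show "F = 0" by simp
qed simp

lemma H_plus_eq: "H_plus = {F. hilbert F = F}"
proof (intro equalityI subsetI)
  fix F assume "F \<in> {F. hilbert F = F}"
  then have F: "hilbert F = F" by simp
  obtain f g where fg: "F = f + g" "f \<in> H_plus" "g \<in> H_minus" by (rule H_decomposition)
  have "f + g = f + - g"
    using F unfolding fg(1) hilbert_add hilbert_H_plus[OF fg(2)] hilbert_H_minus[OF fg(3)] by (rule sym)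
  then have "g = 0" by (simp only: add_left_cancel l2_eq_uminus_iff)
  then show "F \<in> H_plus" using fg by simp
qed (simp add: hilbert_H_plus)

lemma H_minus_eq: "H_minus = {F. hilbert F = - F}"
proof (intro equalityI subsetI)
  fix F assume "F \<in> {F. hilbert F = - F}"
  then have F: "hilbert F = - F" by simp
  obtain f g where fg: "F = f + g" "f \<in> H_plus" "g \<in> H_minus" by (rule H_decomposition)
  have "f + - g = - f + - g"
    using F unfolding fg(1) hilbert_add hilbert_H_plus[OF fg(2)] hilbert_H_minus[OF fg(3)] minus_add_distrib .
  then have "f = 0" by (simp only: add_right_cancel l2_eq_uminus_iff)
  then show "F \<in> H_minus" using fg by simp
qed (simp add: hilbert_H_minus)

lemma fourier_vimage_Int:
  assumes "A \<inter> B = {0}"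
  shows "fourier -` A \<inter> fourier -` B = {0}"
proof -
  have "fourier -` A \<inter> fourier -` B = fourier -` {0}"
    unfolding vimage_Int[symmetric] assms by (rule refl)
  also have "\<dots> = {0}"
    using fourier_eq_iff[of _ 0] by auto
  finally show ?thesis .
qed

lemma complex_eigenspace:
  "complex_subspace {F. hilbert F = c *\<^sub>C F}" "closed {F. hilbert F = c *\<^sub>C F}"
proof -
  have "0 \<in> {F. hilbert F = c *\<^sub>C F}"
    using linear_0[OF bounded_linear.linear[OF bounded_linear_hilbert]]
      linear_0[OF bounded_linear.linear[OF bounded_linear_scaleC]] by simp
  then show "complex_subspace {F. hilbert F = c *\<^sub>C F}"
    unfolding complex_subspace_def
    by (auto simp: hilbert_add hilbert_scaleC scaleC_add scaleC_scaleC mult.commute)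
  show "closed {F. hilbert F = c *\<^sub>C F}"
    by (intro closed_Collect_eq linear_continuous_on bounded_linear_hilbert bounded_linear_scaleC)
qed

lemma scaleC_minus_one: "(- 1) *\<^sub>C F = - F"
  using scaleC_of_real[of "- 1" F] by simp

lemma H_eigenspaces: "H_plus = {F. hilbert F = 1 *\<^sub>C F}" "H_minus = {F. hilbert F = (- 1) *\<^sub>C F}"
  by (simp_all only: H_plus_eq H_minus_eq scaleC_one scaleC_minus_one)

lemma invariant_eigenspace: "invariant_space hilbert {F. hilbert F = c *\<^sub>C F}"
  unfolding invariant_space_def using complex_eigenspace[of c] by (auto simp: hilbert_scaleC)

lemma scaleC_cancel:
  assumes "c *\<^sub>C F = d *\<^sub>C F" "F \<noteq> 0"
  shows "c = d"
proof -
  have "cmod (c - d) * norm F = 0"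
    using assms(1) by (simp add: scaleC_diff_left flip: norm_scaleC)
  then show ?thesis using assms(2) by simp
qed

lemma maximal_eigenspace:
  assumes "{F. hilbert F = c *\<^sub>C F} \<noteq> {0}"
  shows "maximal_invariant_space hilbert {F. hilbert F = c *\<^sub>C F}"
  unfolding maximal_invariant_space_def
proof (intro conjI allI impI)
  let ?E = "{F. hilbert F = c *\<^sub>C F}"
  show "invariant_space hilbert ?E" by (rule invariant_eigenspace)
  show "acts_as_scalar hilbert ?E" unfolding acts_as_scalar_def by auto
  fix W assume W: "invariant_space hilbert W \<and> acts_as_scalar hilbert W \<and> ?E \<subseteq> W"
  then obtain d where d: "\<And>F. F \<in> W \<Longrightarrow> hilbert F = d *\<^sub>C F" unfolding acts_as_scalar_def by blast
  have "0 \<in> ?E" using complex_eigenspace(1)[of c] unfolding complex_subspace_def by blast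
  then obtain F where F: "F \<in> ?E" "F \<noteq> 0" using assms by blast
  then have "c *\<^sub>C F = d *\<^sub>C F" using d[of F] W by auto
  then have "c = d" using F(2) by (rule scaleC_cancel)
  then show "W = ?E" using W d by auto
qed

lemma hilbert_involution: "hilbert (hilbert F) = F"
proof -
  obtain f g where fg: "F = f + g" "f \<in> H_plus" "g \<in> H_minus" by (rule H_decomposition)
  have "hilbert (- g) = g"
    using linear_neg[OF bounded_linear.linear[OF bounded_linear_hilbert], of g] hilbert_H_minus[OF fg(3)] by simp
  then show ?thesis
    unfolding fg(1) hilbert_add hilbert_H_plus[OF fg(2)] hilbert_H_minus[OF fg(3)] by simp
qed

lemma H_nonzero: "H_plus \<noteq> {0}" "H_minus \<noteq> {0}"
proof -
  obtain G where G: "G \<in> L_space cl_v" "G \<noteq> 0" using L_space_nonzero[of cl_v] coef_simps by blast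
  obtain F where F: "fourier F = G" by (rule fourier_preimage)
  have "F \<in> H1_plus" "(0 :: l2) \<in> H2_plus" unfolding H1_plus_def H2_plus_def using F G by (auto simp: L_space_zero)
  then have "F + 0 \<in> H_plus" unfolding H_plus_def by blast
  moreover have "F \<noteq> 0" using F G(2) by auto
  ultimately show "H_plus \<noteq> {0}" by auto
  obtain G where G: "G \<in> L_space cl_u" "G \<noteq> 0" using L_space_nonzero[of cl_u] coef_simps by blast
  obtain F where F: "fourier F = G" by (rule fourier_preimage)
  have "F \<in> H1_minus" "(0 :: l2) \<in> H2_minus" unfolding H1_minus_def H2_minus_def using F G by (auto simp: L_space_zero)
  then have "F + 0 \<in> H_minus" unfolding H_minus_def by blast
  moreover have "F \<noteq> 0" using F G(2) by auto
  ultimately show "H_minus \<noteq> {0}" by auto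
qed

lemma H_Int: "H_plus \<inter> H_minus = {0}"
proof (intro equalityI subsetI)
  fix F assume "F \<in> H_plus \<inter> H_minus"
  then have "F = - F" using hilbert_H_plus[of F] hilbert_H_minus[of F] by simp
  then show "F \<in> {0}" by (simp only: l2_eq_uminus_iff singleton_iff)
next
  fix F :: l2 assume "F \<in> {0}"
  then show "F \<in> H_plus \<inter> H_minus"
    using complex_eigenspace(1)[of 1] complex_eigenspace(1)[of "- 1"]
    unfolding H_eigenspaces complex_subspace_def by auto
qed

theorem theorem6p5:
  shows "internal_direct_sum H_plus H1_plus H2_plus \<and> internal_direct_sum H_minus H1_minus H2_minus \<and>
    {V. nontrivial_space V \<and> maximal_invariant_space hilbert V} = {H_plus, H_minus} \<and>
    H_plus \<noteq> H_minus \<and>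
    internal_direct_sum UNIV H_plus H_minus \<and>
    (\<forall>f\<in>H_plus. hilbert f = f) \<and>
    (\<forall>g\<in>H_minus. hilbert g = - g)"
proof (intro conjI ballI)
  show "internal_direct_sum H_plus H1_plus H2_plus"
    unfolding internal_direct_sum_def H_plus_def[symmetric] H1_plus_def H2_plus_def
    using coef_simps by (auto intro!: fourier_vimage_Int L_space_Int simp: H_plus_def H1_plus_def H2_plus_def)
  show "internal_direct_sum H_minus H1_minus H2_minus"
    unfolding internal_direct_sum_def H_minus_def[symmetric] H1_minus_def H2_minus_def
    using coef_simps by (auto intro!: fourier_vimage_Int L_space_Int simp: H_minus_def H1_minus_def H2_minus_def)
  show "H_plus \<noteq> H_minus" using H_Int H_nonzero by auto
  show "internal_direct_sum UNIV H_plus H_minus"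
    unfolding internal_direct_sum_def
  proof (intro conjI H_Int equalityI subsetI UNIV_I)
    fix F :: l2
    obtain f g where "F = f + g" "f \<in> H_plus" "g \<in> H_minus" by (rule H_decomposition)
    then show "F \<in> {f + g | f g. f \<in> H_plus \<and> g \<in> H_minus}" by blast
  qed
  have nontrivial: "nontrivial_space H_plus" "nontrivial_space H_minus"
    unfolding nontrivial_space_def using H_nonzero H_Int by auto
  have maximal: "maximal_invariant_space hilbert H_plus" "maximal_invariant_space hilbert H_minus"
    using H_nonzero unfolding H_eigenspaces by (auto intro!: maximal_eigenspace)
  show "{V. nontrivial_space V \<and> maximal_invariant_space hilbert V} = {H_plus, H_minus}"
  proof (intro equalityI subsetI)
    fix V assume "V \<in> {V. nontrivial_space V \<and> maximal_invariant_space hilbert V}"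
    then have V: "V \<noteq> {0}" "invariant_space hilbert V" "acts_as_scalar hilbert V"
      and max: "\<And>W. invariant_space hilbert W \<Longrightarrow> acts_as_scalar hilbert W \<Longrightarrow> V \<subseteq> W \<Longrightarrow> W = V"
      unfolding nontrivial_space_def maximal_invariant_space_def by auto
    obtain c where c: "\<And>F. F \<in> V \<Longrightarrow> hilbert F = c *\<^sub>C F"
      using V(3) unfolding acts_as_scalar_def by blast
    have "0 \<in> V" using V(2) unfolding invariant_space_def complex_subspace_def by blast
    then obtain F where F: "F \<in> V" "F \<noteq> 0" using V(1) by blast
    have "(c * c) *\<^sub>C F = 1 *\<^sub>C F"
      using hilbert_involution[of F] by (simp only: c[OF F(1)] hilbert_scaleC scaleC_scaleC scaleC_one)
    then have "c * c = 1" using F(2) by (rule scaleC_cancel)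
    then have "c = 1 \<or> c = - 1" by (simp only: square_eq_1_iff)
    moreover have "V \<subseteq> {F. hilbert F = c *\<^sub>C F}" using c by blast
    then have "{F. hilbert F = c *\<^sub>C F} = V"
      by (intro max invariant_eigenspace) (auto simp: acts_as_scalar_def)
    ultimately show "V \<in> {H_plus, H_minus}"
      unfolding H_eigenspaces by auto
  next
    fix V assume "V \<in> {H_plus, H_minus}"
    then show "V \<in> {V. nontrivial_space V \<and> maximal_invariant_space hilbert V}"
      using nontrivial maximal by blast
  qed
qed (simp_all only: hilbert_H_plus hilbert_H_minus)

end
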